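(* Let $N>2$ be an integer, let $\Omega\subset\mathbb{R}^N$ be a bounded open set, and let $a:\Omega\to\mathbb{R}$ be a measurable function for which there are positive constants $\alpha,\beta$ with $\alpha\le a(x)\le\beta$ for almost every $x\in\Omega$. Let $\theta$ be a real number with $\frac{1}{N-1}<\theta<1$, and set $$m=\frac{N}{N+1-\theta(N-1)}.$$ Let $f\in L^m(\Omega)$. Then there exists a function $u\in W^{1,1}_0(\Omega)$ which is a distributional solution of the problem $$-\operatorname{div}\left(\frac{a(x)\nabla u}{(1+|u|)^\theta}\right)=f \ \text{ in }\Omega,\qquad u=0\ \text{ on }\partial\Omega.$$
   Context: A function $u\in W^{1,1}_0(\Omega)$ is a distributional solution of the problem $-\operatorname{div}\left(\frac{a(x)\nabla u}{(1+|u|)^\theta}\right)=f$ in $\Omega$, $u=0$ on $\partial\Omega$, if $$\int_\Omega \frac{a(x)\,\nabla u}{(1+|u|)^\theta}\cdot\nabla\varphi\,dx=\int_\Omega f\,\varphi\,dx\qquad\text{for all }\varphi\in C_0^\infty(\Omega).$$ The boundary condition $u=0$ on $\partial\Omega$ is understood as membership in $W^{1,1}_0(\Omega)$, the closure of $C_0^\infty(\Omega)$ in $W^{1,1}(\Omega)$. Here $C_0^\infty(\Omega)$ denotes the smooth functions with compact support in $\Omega$. *)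

theory Defs
  imports "HOL-Analysis.Analysis"
begin

definition partial :: "'a::euclidean_space \<Rightarrow> ('a \<Rightarrow> real) \<Rightarrow> 'a \<Rightarrow> real" where
  "partial b \<phi> x = frechet_derivative \<phi> (at x) b"

definition grad :: "('a::euclidean_space \<Rightarrow> real) \<Rightarrow> 'a \<Rightarrow> 'a" where
  "grad \<phi> x = (\<Sum>b\<in>Basis. partial b \<phi> x *\<^sub>R b)"

primrec Ck :: "nat \<Rightarrow> ('a::euclidean_space \<Rightarrow> real) \<Rightarrow> bool" where
  "Ck 0 \<phi> \<longleftrightarrow> continuous_on UNIV \<phi>"
| "Ck (Suc k) \<phi> \<longleftrightarrow> \<phi> differentiable_on UNIV \<and> (\<forall>b\<in>Basis. Ck k (partial b \<phi>))"

text \<open>Elements of \<open>C\<^sub>0\<^sup>\<infinity>(\<Omega>)\<close> are represented by their extension by zero to the whole space.\<close>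

definition test_functions :: "'a::euclidean_space set \<Rightarrow> ('a \<Rightarrow> real) set" where
  "test_functions \<Omega> =
    {\<phi>. (\<forall>k. Ck k \<phi>) \<and> compact (closure {x. \<phi> x \<noteq> 0}) \<and> closure {x. \<phi> x \<noteq> 0} \<subseteq> \<Omega>}"

text \<open>Functions on \<open>\<Omega>\<close> are represented by total functions whose values outside \<open>\<Omega>\<close> are
  irrelevant, and the elements of the Lebesgue and Sobolev spaces below are functions rather
  than equivalence classes modulo null sets.\<close>

definition Lp :: "real \<Rightarrow> 'a::euclidean_space set \<Rightarrow> ('a \<Rightarrow> real) set" where
  "Lp p \<Omega> = {f \<in> borel_measurable (lebesgue_on \<Omega>). integrable (lebesgue_on \<Omega>) (\<lambda>x. \<bar>f x\<bar> powr p)}"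

text \<open>\<open>W11_gradient \<Omega> u g\<close> says that \<open>u\<close> lies in \<open>W\<^sup>1\<^sup>,\<^sup>1(\<Omega>)\<close> and that \<open>g\<close> is a version of its weak
  gradient. For open \<open>\<Omega>\<close> such a \<open>g\<close> is determined by \<open>u\<close> up to a null set, so that statements
  about \<open>\<nabla>u\<close> that only involve integrals do not depend on the choice of \<open>g\<close>.\<close>

definition W11_gradient ::
  "'a::euclidean_space set \<Rightarrow> ('a \<Rightarrow> real) \<Rightarrow> ('a \<Rightarrow> 'a) \<Rightarrow> bool" where
  "W11_gradient \<Omega> u g \<longleftrightarrow>
    integrable (lebesgue_on \<Omega>) u \<and> integrable (lebesgue_on \<Omega>) g \<and>
    (\<forall>\<phi>\<in>test_functions \<Omega>. \<forall>b\<in>Basis.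
      (\<integral>x. u x * partial b \<phi> x \<partial>lebesgue_on \<Omega>) = - (\<integral>x. (g x \<bullet> b) * \<phi> x \<partial>lebesgue_on \<Omega>))"

text \<open>The closure of the test functions for the norm \<open>\<parallel>v\<parallel>\<^sub>1 + \<parallel>\<nabla>v\<parallel>\<^sub>1\<close> of \<open>W\<^sup>1\<^sup>,\<^sup>1(\<Omega>)\<close>.\<close>

definition W11_0 :: "'a::euclidean_space set \<Rightarrow> ('a \<Rightarrow> real) set" where
  "W11_0 \<Omega> = {u. \<exists>g. W11_gradient \<Omega> u g \<and>
    (\<forall>\<epsilon>>0. \<exists>\<phi>\<in>test_functions \<Omega>.
      (\<integral>x. \<bar>u x - \<phi> x\<bar> \<partial>lebesgue_on \<Omega>) + (\<integral>x. norm (g x - grad \<phi> x) \<partial>lebesgue_on \<Omega>) < \<epsilon>)}"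

definition distributional_solution ::
  "'a::euclidean_space set \<Rightarrow> ('a \<Rightarrow> real) \<Rightarrow> real \<Rightarrow> ('a \<Rightarrow> real) \<Rightarrow> ('a \<Rightarrow> real) \<Rightarrow> bool" where
  "distributional_solution \<Omega> a \<theta> f u \<longleftrightarrow> u \<in> W11_0 \<Omega> \<and>
    (\<exists>g. W11_gradient \<Omega> u g \<and>
      (\<forall>\<phi>\<in>test_functions \<Omega>.
        (\<integral>x. ((a x / (1 + \<bar>u x\<bar>) powr \<theta>) *\<^sub>R g x) \<bullet> grad \<phi> x \<partial>lebesgue_on \<Omega>)
          = (\<integral>x. f x * \<phi> x \<partial>lebesgue_on \<Omega>)))"

end

theory Submission imports Defs begin

text \<open>Let \<open>N\<close> be the dimension and \<open>p = N / (N - 1)\<close>. Writing \<open>u = G(v)\<close> with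
  \<open>G' = (1 + \<bar>G\<bar>) powr \<theta>\<close> turns the problem into the linear equation
  \<open>- div (a \<nabla>v) = f\<close>, for which solutions can be approximated without leaving the test
  functions: an almost minimiser of the quadratic energy with a bounded right-hand side \<open>h\<close>
  satisfies the weak equation up to \<open>\<surd>\<eta> \<parallel>\<nabla>\<psi>\<parallel>\<^sub>2\<close>, and this error is absorbed whenever \<open>\<psi>\<close> is a
  nonlinear function \<open>\<Psi>(\<phi>)\<close> of the approximate solution \<open>\<phi>\<close> itself with bounded \<open>\<Psi>'\<close>.

  If \<open>F'\<^sup>2 \<le> (1 + \<bar>F\<bar>) powr p * \<Psi>'\<close>, the Cauchy--Schwarz inequality bounds
  \<open>\<integral>\<bar>\<nabla>F(\<phi>)\<bar>\<close> by the energy \<open>\<integral>\<Psi>'(\<phi>) \<bar>\<nabla>\<phi>\<bar>\<^sup>2\<close> and \<open>\<integral>(1 + \<bar>F(\<phi>)\<bar>) powr p\<close>, and the Gagliardo--Nirenberg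
  inequality in \<open>W\<^sup>1\<^sup>,\<^sup>1\<close> bounds the latter by a power of \<open>\<integral>\<bar>\<nabla>F(\<phi>)\<bar>\<close>; the total exponent is less
  than one. With \<open>F = id\<close>, applied to differences and scaled by linearity, this shows that the
  approximate solutions form a Cauchy sequence in \<open>W\<^sup>1\<^sup>,\<^sup>1\<close>. With \<open>F\<close> a truncation of \<open>G\<close> it
  bounds \<open>\<nabla>u\<close> in \<open>L\<^sup>1\<close> by Fatou's lemma, and the value of \<open>m\<close> is exactly the one for which
  Hoelder's inequality closes the estimate.\<close>

text \<open>The space W^{1,1} is not reflexive, so bounds on approximate solutions of the degenerate
  problem would give neither a weak limit of the gradients nor the limit of the nonlinear flux. The
  linear equation avoids both: differences of approximate solutions are again approximate solutions,
  hence their gradients converge strongly and almost everywhere, and \<open>Gfun\<close> is applied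
  only to the limit. Since m may be close to 1, f need not belong to the dual of H^1_0, which is why
  the data are first made bounded.

  The error \<eta> is absorbed only if \<eta> times the supremum of \<Psi>' is at most 1, and the
  \<Psi>' that belongs to G itself is unbounded in general. The truncation level therefore stays
  fixed while \<eta> tends to 0 and is released afterwards, with Fatou's lemma in both passages.

  If the data term grows like the power r of the integral of (1 + |F|)^p, the estimate closes for p
  (1 + r) < 2. For F = id one has r = 0, and p < 2 says N > 2. For the nonlinear estimate p (1 + r)
  = 1 + \<theta>, so the requirement is \<theta> < 1, while \<theta> > 1 / (N - 1) says m >
  1.\<close>

section \<open>The Loomis--Whitney inequality\<close>

text \<open>The case \<open>S = {1, \<dots>, k}\<close> of Hoelder's inequality for \<open>p = (c \<Prod>\<^sub>i q\<^sub>i) powr (1 / k)\<close>, in a form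
  that needs no roots in \<^typ>\<open>ennreal\<close>.\<close>

lemma Hoelder_nn_integral_prod:
  fixes p :: "'a \<Rightarrow> ennreal" and q :: "'i \<Rightarrow> 'a \<Rightarrow> ennreal"
  assumes S: "finite S" "card S = k" "k > 0"
    and p [measurable]: "p \<in> borel_measurable M"
    and q [measurable]: "\<And>i. i \<in> S \<Longrightarrow> q i \<in> borel_measurable M"
    and le: "\<And>t. t \<in> space M \<Longrightarrow> (p t) ^ k \<le> c * (\<Prod>i\<in>S. q i t)"
  shows "(\<integral>\<^sup>+t. p t \<partial>M) ^ k \<le> c * (\<Prod>i\<in>S. \<integral>\<^sup>+t. q i t \<partial>M)"
proof (cases "c = 0 \<or> (\<exists>i\<in>S. (\<integral>\<^sup>+t. q i t \<partial>M) = 0)")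
  case True
  \<comment> \<open>The hypothesis forces \<open>p\<close> to vanish almost everywhere, which
    disposes of products of 0 and infinity.\<close>
  have "AE t in M. p t = 0"
  proof (cases "c = 0")
    case True
    then show ?thesis using le S by (auto intro!: AE_I2)
  next
    case False
    then obtain i where i: "i \<in> S" "(\<integral>\<^sup>+t. q i t \<partial>M) = 0" using True by auto
    then have "AE t in M. q i t = 0" by (simp add: nn_integral_0_iff_AE)
    then show ?thesis
    proof (rule AE_mp, intro AE_I2 impI)
      fix t assume "t \<in> space M" "q i t = 0"
      then have "(\<Prod>i\<in>S. q i t) = 0" using i S by (intro prod_zero) auto
      then have "(p t) ^ k = 0" using le[OF \<open>t \<in> space M\<close>] by (simp only: mult_zero_right le_zero_eq)
      then show "p t = 0" using S by auto
    qed
  qed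
  then have "(\<integral>\<^sup>+t. p t \<partial>M) = 0" by (simp add: nn_integral_0_iff_AE)
  then show ?thesis using S by (simp add: zero_power)
next
  case F: False
  show ?thesis
  proof (cases "c = top \<or> (\<exists>i\<in>S. (\<integral>\<^sup>+t. q i t \<partial>M) = top)")
    case True
    have nz: "(\<Prod>i\<in>S. \<integral>\<^sup>+t. q i t \<partial>M) \<noteq> 0" using F S by auto
    \<comment> \<open>No factor is zero here, so a single infinite one makes the right-hand side
      infinite.\<close>
    have "c * (\<Prod>i\<in>S. \<integral>\<^sup>+t. q i t \<partial>M) = top"
    proof (cases "c = top")
      case True then show ?thesis using nz by (simp add: ennreal_top_mult)
    next
      case False
      then obtain i where i: "i \<in> S" "(\<integral>\<^sup>+t. q i t \<partial>M) = top" using True by auto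
      have "(\<Prod>i\<in>S. \<integral>\<^sup>+t. q i t \<partial>M) = top * (\<Prod>i\<in>S-{i}. \<integral>\<^sup>+t. q i t \<partial>M)"
        unfolding prod.remove[OF S(1) i(1), of "\<lambda>i. \<integral>\<^sup>+t. q i t \<partial>M"] i(2) ..
      also have "\<dots> = top" using F S by (auto simp: ennreal_top_mult)
      finally show ?thesis using F by (simp add: ennreal_mult_top)
    qed
    then show ?thesis by (simp only: top_greatest)
  next
    case False
    define Q where "Q i = enn2real (\<integral>\<^sup>+t. q i t \<partial>M)" for i
    define c' where "c' = enn2real c"
    have c: "c = ennreal c'" "c' > 0" using F False unfolding c'_def
      by (auto simp: less_top enn2real_positive_iff zero_less_iff_neq_zero)
    have Q: "(\<integral>\<^sup>+t. q i t \<partial>M) = ennreal (Q i)" "Q i > 0" if "i \<in> S" for i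
      using F False that unfolding Q_def
      by (auto simp: less_top enn2real_positive_iff zero_less_iff_neq_zero)
    \<comment> \<open>\<open>R\<close> is the k-th root of the target. After division of each
      \<open>q i\<close> by its integral \<open>Q i\<close>, the arithmetic-geometric mean
      inequality bounds \<open>p\<close> pointwise by a linear combination of the \<open>q i\<close>
      whose integral is exactly \<open>R\<close>.\<close>
    define R where "R = root k (c' * (\<Prod>i\<in>S. Q i))"
    have prodQ: "(\<Prod>i\<in>S. Q i) > 0" using Q by (simp add: prod_pos)
    have R: "R > 0" "R ^ k = c' * (\<Prod>i\<in>S. Q i)"
      unfolding R_def using S c prodQ by (auto simp: real_root_pow_pos)
    have "AE t in M. \<forall>i\<in>S. q i t \<noteq> \<infinity>"
      using S(1) Q by (intro AE_finite_allI nn_integral_PInf_AE) auto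
    then have ae: "AE t in M. p t \<le> (\<Sum>i\<in>S. ennreal (R / k / Q i) * q i t)"
    proof (rule AE_mp, intro AE_I2 impI)
      fix t assume t: "t \<in> space M" and fin: "\<forall>i\<in>S. q i t \<noteq> \<infinity>"
      define r where "r i = enn2real (q i t)" for i
      have r: "q i t = ennreal (r i)" "r i \<ge> 0" if "i \<in> S" for i
        using fin that unfolding r_def by (auto simp: less_top)
      have "(p t) ^ k \<le> c * (\<Prod>i\<in>S. ennreal (r i))"
        using le[OF t] r by (simp cong: prod.cong)
      also have "\<dots> = ennreal (c' * (\<Prod>i\<in>S. r i))"
        using c r by (simp add: prod_ennreal ennreal_mult prod_nonneg)
      finally have pk: "(p t) ^ k \<le> ennreal (c' * (\<Prod>i\<in>S. r i))" .
      then have "p t \<noteq> top" using S by (auto simp: power_top_ennreal top_unique)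
      then obtain s where s: "p t = ennreal s" "s \<ge> 0" by (cases "p t") auto
      have sk: "s ^ k \<le> c' * (\<Prod>i\<in>S. r i)"
        using pk s r c by (simp add: ennreal_power prod_nonneg)
      also have "\<dots> = R ^ k * (\<Prod>i\<in>S. r i / Q i)"
        using R prodQ by (simp add: prod_dividef)
      finally have "root k (s ^ k) \<le> root k (R ^ k * (\<Prod>i\<in>S. r i / Q i))"
        using S by simp
      then have "s \<le> R * root k (\<Prod>i\<in>S. r i / Q i)"
        using S s R(1) by (simp only: real_root_mult real_root_power_cancel less_imp_le)
      also have "\<dots> \<le> R * (\<Sum>i\<in>S. r i / Q i / k)"
      proof (rule mult_left_mono)
        have "(\<Prod>i\<in>S. r i / Q i) powr (1 / k) \<le> (\<Sum>i\<in>S. r i / Q i / k)"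
          using S r Q arith_geom_mean[of S "\<lambda>i. r i / Q i"] by (force simp: less_imp_le)
        then show "root k (\<Prod>i\<in>S. r i / Q i) \<le> (\<Sum>i\<in>S. r i / Q i / k)"
          using S r Q by (subst root_powr_inverse) (auto intro!: prod_nonneg simp: less_imp_le)
      qed (use R in simp)
      also have "\<dots> = (\<Sum>i\<in>S. R / k / Q i * r i)"
        by (simp add: sum_distrib_left mult_ac)
      finally have "ennreal s \<le> ennreal (\<Sum>i\<in>S. R / k / Q i * r i)" by (rule ennreal_leI)
      also have "\<dots> = (\<Sum>i\<in>S. ennreal (R / k / Q i) * q i t)"
        using R(1) r Q by (subst sum_ennreal[symmetric])
          (auto simp: ennreal_mult'[symmetric] less_imp_le intro!: sum.cong)
      finally show "p t \<le> (\<Sum>i\<in>S. ennreal (R / k / Q i) * q i t)" using s by simp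
    qed
    have "(\<integral>\<^sup>+t. p t \<partial>M) \<le> (\<integral>\<^sup>+t. (\<Sum>i\<in>S. ennreal (R / k / Q i) * q i t) \<partial>M)"
      by (rule nn_integral_mono_AE[OF ae])
    also have "\<dots> = (\<Sum>i\<in>S. ennreal (R / k / Q i) * ennreal (Q i))"
      using Q by (subst nn_integral_sum) (auto simp: nn_integral_cmult)
    also have "\<dots> = (\<Sum>i\<in>S. ennreal (R / k))"
      using Q R by (intro sum.cong refl) (auto simp: ennreal_mult[symmetric] less_imp_le less_imp_neq[symmetric])
    also have "\<dots> = ennreal R" using S R
      by (simp add: ennreal_of_nat_eq_real_of_nat ennreal_mult[symmetric] less_imp_le)
    finally have "(\<integral>\<^sup>+t. p t \<partial>M) ^ k \<le> ennreal R ^ k" by (rule power_mono) simp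
    also have "\<dots> = c * (\<Prod>i\<in>S. \<integral>\<^sup>+t. q i t \<partial>M)"
      using R Q c by (simp add: ennreal_power ennreal_mult prod_ennreal prod_nonneg less_imp_le)
    finally show ?thesis .
  qed
qed

text \<open>The argument \<open>x\<close> stays a full assignment even for coordinates that are
  integrated out. All partial integrals thus live on one product space, and induction over the
  coordinates needs no change of index set.\<close>

fun iter_nn_integral ::
  "('i \<Rightarrow> 'a measure) \<Rightarrow> 'i list \<Rightarrow> (('i \<Rightarrow> 'a) \<Rightarrow> ennreal) \<Rightarrow> ('i \<Rightarrow> 'a) \<Rightarrow> ennreal" where
  "iter_nn_integral M [] h x = h x"
| "iter_nn_integral M (j # js) h x = (\<integral>\<^sup>+t. iter_nn_integral M js h (x(j := t)) \<partial>M j)"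

lemma iter_nn_integral_append:
  "iter_nn_integral M (js @ ks) h x = iter_nn_integral M js (iter_nn_integral M ks h) x"
  by (induction js arbitrary: x) auto

lemma iter_nn_integral_upd:
  assumes "\<And>x t. h (x(i := t)) = h x"
  shows "iter_nn_integral M js h (x(i := t)) = iter_nn_integral M js h x"
proof (induction js arbitrary: x)
  case (Cons j js)
  show ?case
  proof (cases "j = i")
    case False
    then have "i \<noteq> j" by simp
    then show ?thesis using Cons[of "x(j := s)" for s]
      by (simp add: fun_upd_twist[OF \<open>i \<noteq> j\<close>] del: fun_upd_apply cong: nn_integral_cong)
  qed (simp del: fun_upd_apply)
qed (use assms in auto)

lemma iter_nn_integral_cong:
  assumes "\<And>i. i \<notin> set js \<Longrightarrow> x i = y i"
  shows "iter_nn_integral M js h x = iter_nn_integral M js h y"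
  using assms
proof (induction js arbitrary: x y)
  case Nil
  then have "x = y" by auto
  then show ?case by simp
next
  case (Cons j js)
  then have "iter_nn_integral M js h (x(j := t)) = iter_nn_integral M js h (y(j := t))" for t
    by (intro Cons.IH) auto
  then show ?case by simp
qed

lemma space_PiM_upd:
  "x \<in> space (Pi\<^sub>M I M) \<Longrightarrow> i \<in> I \<Longrightarrow> t \<in> space (M i) \<Longrightarrow> x(i := t) \<in> space (Pi\<^sub>M I M)"
  by (auto simp: space_PiM PiE_iff extensional_def)

context product_sigma_finite
begin

lemma measurable_iter_nn_integral:
  assumes "h \<in> borel_measurable (Pi\<^sub>M I M)" "set js \<subseteq> I"
  shows "iter_nn_integral M js h \<in> borel_measurable (Pi\<^sub>M I M)"
  using assms(2)
proof (induction js)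
  case Nil
  then show ?case using assms(1) by (simp cong: measurable_cong)
next
  case (Cons j js)
  then have [measurable]: "iter_nn_integral M js h \<in> borel_measurable (Pi\<^sub>M I M)" by simp
  have j: "j \<in> I" using Cons by simp
  have m: "(\<lambda>(x, t). x(j := t)) \<in> measurable (Pi\<^sub>M I M \<Otimes>\<^sub>M M j) (Pi\<^sub>M I M)"
    unfolding case_prod_beta using j by (intro measurable_fun_upd[where J=I]) auto
  have "(\<lambda>(x, t). iter_nn_integral M js h (x(j := t))) \<in> borel_measurable (Pi\<^sub>M I M \<Otimes>\<^sub>M M j)"
    using measurable_compose[OF m \<open>iter_nn_integral M js h \<in> _\<close>] by (simp add: case_prod_beta)
  then have "(\<lambda>x. \<integral>\<^sup>+t. iter_nn_integral M js h (x(j := t)) \<partial>M j) \<in> borel_measurable (Pi\<^sub>M I M)"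
    by (rule sigma_finite_measure.borel_measurable_nn_integral[OF sigma_finite_measures])
  then show ?case by simp
qed

text \<open>Tonelli's theorem for a finite product. The set \<open>K\<close> of frozen coordinates
  is arbitrary because the induction moves the head of the list into it, and
  \<open>product_nn_integral_insert_rev\<close> moves it back.\<close>

lemma iter_nn_integral_eq_merge:
  assumes "distinct js" "set js \<inter> K = {}" "h \<in> borel_measurable (Pi\<^sub>M (set js \<union> K) M)"
    "x \<in> space (Pi\<^sub>M K M)"
  shows "iter_nn_integral M js h x = (\<integral>\<^sup>+y. h (merge (set js) K (y, x)) \<partial>Pi\<^sub>M (set js) M)"
  using assms
proof (induction js arbitrary: K x)
  case Nil
  have "merge {} K (\<lambda>_. undefined, x) = x"
    using Nil by (auto simp: merge_def space_PiM PiE_iff extensional_def)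
  then show ?case by (simp add: nn_integral_empty)
next
  case (Cons j js)
  have hm: "h \<in> borel_measurable (Pi\<^sub>M (set js \<union> insert j K) M)"
    using Cons.prems(3) by simp
  have "iter_nn_integral M (j # js) h x = (\<integral>\<^sup>+t. iter_nn_integral M js h (x(j := t)) \<partial>M j)" by simp
  also have "\<dots> = (\<integral>\<^sup>+t. (\<integral>\<^sup>+y. h (merge (set js) (insert j K) (y, x(j := t))) \<partial>Pi\<^sub>M (set js) M) \<partial>M j)"
  proof (rule nn_integral_cong)
    fix t assume "t \<in> space (M j)"
    then have "x(j := t) \<in> space (Pi\<^sub>M (insert j K) M)"
      using Cons.prems by (auto simp: space_PiM PiE_iff extensional_def)
    then show "iter_nn_integral M js h (x(j := t)) =
        (\<integral>\<^sup>+y. h (merge (set js) (insert j K) (y, x(j := t))) \<partial>Pi\<^sub>M (set js) M)"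
      using Cons.prems by (intro Cons.IH[OF _ _ hm]) (auto simp del: fun_upd_apply)
  qed
  also have "\<dots> = (\<integral>\<^sup>+t. (\<integral>\<^sup>+y. h (merge (insert j (set js)) K (y(j := t), x)) \<partial>Pi\<^sub>M (set js) M) \<partial>M j)"
  proof -
    have "merge (set js) (insert j K) (y, x(j := t)) = merge (insert j (set js)) K (y(j := t), x)" for y t
      using Cons.prems by (auto simp: merge_def fun_eq_iff)
    then show ?thesis by simp
  qed
  also have "\<dots> = (\<integral>\<^sup>+y. h (merge (insert j (set js)) K (y, x)) \<partial>Pi\<^sub>M (insert j (set js)) M)"
  proof (rule product_nn_integral_insert_rev[symmetric])
    have h2: "h \<in> borel_measurable (Pi\<^sub>M (insert j (set js) \<union> K) M)"
      using Cons.prems(3) by simp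
    have "(\<lambda>y. merge (insert j (set js)) K (y, x)) \<in>
        measurable (Pi\<^sub>M (insert j (set js)) M) (Pi\<^sub>M (insert j (set js) \<union> K) M)"
      using Cons.prems by (intro measurable_compose[OF _ measurable_merge]) auto
    from measurable_compose[OF this h2]
    show "(\<lambda>y. h (merge (insert j (set js)) K (y, x))) \<in> borel_measurable (Pi\<^sub>M (insert j (set js)) M)" .
  qed (use Cons.prems in auto)
  finally show ?case by simp
qed

lemma iter_nn_integral_eq_nn_integral_PiM:
  assumes "distinct js" "set js = I" "h \<in> borel_measurable (Pi\<^sub>M I M)" "x \<in> space (Pi\<^sub>M I M)"
  shows "iter_nn_integral M js h x = (\<integral>\<^sup>+y. h y \<partial>Pi\<^sub>M I M)"
proof -
  have "iter_nn_integral M js h x = iter_nn_integral M js h (\<lambda>_. undefined)"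
    using assms by (intro iter_nn_integral_cong) (auto simp: space_PiM PiE_iff extensional_def)
  also have "\<dots> = (\<integral>\<^sup>+y. h (merge (set js) {} (y, \<lambda>_. undefined)) \<partial>Pi\<^sub>M (set js) M)"
    using assms by (intro iter_nn_integral_eq_merge) (auto simp: space_PiM)
  also have "\<dots> = (\<integral>\<^sup>+y. h y \<partial>Pi\<^sub>M I M)"
    unfolding assms(2)
  proof (rule nn_integral_cong)
    fix y assume "y \<in> space (Pi\<^sub>M I M)"
    then have "merge I {} (y, \<lambda>_. undefined) = y"
      by (auto simp: merge_def fun_eq_iff space_PiM PiE_iff extensional_def)
    then show "h (merge I {} (y, \<lambda>_. undefined)) = h y" by simp
  qed
  finally show ?thesis .
qed

text \<open>Integrate in one direction j at a time. The factor \<open>F j\<close> does not depend on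
  that coordinate and comes out as the constant \<open>c\<close> of Hoelder's inequality; exactly k
  factors remain, matching the k-th power. \<open>removeAll\<close> records that no factor is ever
  integrated in its own direction.\<close>

lemma Loomis_Whitney_iter:
  assumes I: "finite I" "card I = Suc k" "k > 0"
    and p: "p \<in> borel_measurable (Pi\<^sub>M I M)"
    and F: "\<And>i. i \<in> I \<Longrightarrow> F i \<in> borel_measurable (Pi\<^sub>M I M)"
    and indep: "\<And>i x t. i \<in> I \<Longrightarrow> F i (x(i := t)) = F i x"
    and le: "\<And>x. x \<in> space (Pi\<^sub>M I M) \<Longrightarrow> (p x) ^ k \<le> (\<Prod>i\<in>I. F i x)"
    and js: "distinct js" "set js \<subseteq> I" and x: "x \<in> space (Pi\<^sub>M I M)"
  shows "(iter_nn_integral M js p x) ^ k \<le> (\<Prod>i\<in>I. iter_nn_integral M (removeAll i js) (F i) x)"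
  using js x
proof (induction js arbitrary: x)
  case Nil
  then show ?case using le by simp
next
  case (Cons j js)
  have j: "j \<in> I" "j \<notin> set js" using Cons.prems by auto
  have upd: "(\<lambda>t. x(j := t)) \<in> measurable (M j) (Pi\<^sub>M I M)"
    using Cons.prems j by (intro measurable_fun_upd[where J=I]) auto
  have m: "(\<lambda>t. iter_nn_integral M ks h (x(j := t))) \<in> borel_measurable (M j)"
    if "set ks \<subseteq> I" "h \<in> borel_measurable (Pi\<^sub>M I M)" for ks h
    by (rule measurable_compose[OF upd measurable_iter_nn_integral[OF that(2,1)]])
  have "(\<integral>\<^sup>+t. iter_nn_integral M js p (x(j := t)) \<partial>M j) ^ k \<le>
      iter_nn_integral M js (F j) x *
      (\<Prod>i\<in>I - {j}. \<integral>\<^sup>+t. iter_nn_integral M (removeAll i js) (F i) (x(j := t)) \<partial>M j)"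
  proof (rule Hoelder_nn_integral_prod)
    fix t assume "t \<in> space (M j)"
    then have "(iter_nn_integral M js p (x(j := t))) ^ k
        \<le> (\<Prod>i\<in>I. iter_nn_integral M (removeAll i js) (F i) (x(j := t)))"
      using Cons.prems j by (intro Cons.IH space_PiM_upd) auto
    also have "\<dots> = iter_nn_integral M js (F j) (x(j := t)) *
        (\<Prod>i\<in>I-{j}. iter_nn_integral M (removeAll i js) (F i) (x(j := t)))"
      using j by (subst prod.remove[OF I(1) j(1)]) simp
    also have "iter_nn_integral M js (F j) (x(j := t)) = iter_nn_integral M js (F j) x"
      using indep[OF j(1)] by (rule iter_nn_integral_upd)
    finally show "(iter_nn_integral M js p (x(j := t))) ^ k \<le> iter_nn_integral M js (F j) x *
        (\<Prod>i\<in>I-{j}. iter_nn_integral M (removeAll i js) (F i) (x(j := t)))" .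
  qed (use I j p F Cons.prems in \<open>auto intro!: m\<close>)
  also have "\<dots> = (\<Prod>i\<in>I. iter_nn_integral M (removeAll i (j # js)) (F i) x)"
    using j unfolding prod.remove[OF I(1) j(1), of "\<lambda>i. iter_nn_integral M (removeAll i (j # js)) (F i) x"]
    by (intro arg_cong2[of _ _ _ _ "(*)"] prod.cong) auto
  finally show ?case by simp
qed

text \<open>With \<open>F i\<close> taken as the integral of \<open>G i\<close> along direction i,
  the direction missing from the list of \<open>Loomis_Whitney_iter\<close> is supplied by
  \<open>F i\<close> itself, so each factor on the right becomes a full integral.\<close>

lemma Loomis_Whitney:
  assumes I: "finite I" "card I = Suc k" "k > 0"
    and p: "p \<in> borel_measurable (Pi\<^sub>M I M)"
    and G: "\<And>i. i \<in> I \<Longrightarrow> G i \<in> borel_measurable (Pi\<^sub>M I M)"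
    and le: "\<And>x. x \<in> space (Pi\<^sub>M I M) \<Longrightarrow> (p x) ^ k \<le> (\<Prod>i\<in>I. \<integral>\<^sup>+t. G i (x(i := t)) \<partial>M i)"
    and ne: "x \<in> space (Pi\<^sub>M I M)"
  shows "(\<integral>\<^sup>+x. p x \<partial>Pi\<^sub>M I M) ^ k \<le> (\<Prod>i\<in>I. \<integral>\<^sup>+x. G i x \<partial>Pi\<^sub>M I M)"
proof -
  obtain js where js: "distinct js" "set js = I" using finite_distinct_list[OF I(1)] by blast
  have "(\<integral>\<^sup>+x. p x \<partial>Pi\<^sub>M I M) ^ k = (iter_nn_integral M js p x) ^ k"
    using iter_nn_integral_eq_nn_integral_PiM[OF js p ne] by simp
  also have "\<dots> \<le> (\<Prod>i\<in>I. iter_nn_integral M (removeAll i js) (iter_nn_integral M [i] (G i)) x)"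
    using I p G le js ne
    by (intro Loomis_Whitney_iter measurable_iter_nn_integral) auto
  also have "\<dots> = (\<Prod>i\<in>I. \<integral>\<^sup>+x. G i x \<partial>Pi\<^sub>M I M)"
    unfolding iter_nn_integral_append[symmetric]
    using js G ne by (intro prod.cong refl iter_nn_integral_eq_nn_integral_PiM)
      (auto simp: distinct_removeAll)
  finally show ?thesis .
qed

end

section \<open>The Gagliardo--Nirenberg inequality\<close>

lemma abs_le_nn_integral_deriv:
  fixes g g' :: "real \<Rightarrow> real"
  assumes g: "\<And>t. (g has_real_derivative g' t) (at t)" and c: "continuous_on UNIV g'"
    and z: "g t0 = 0" "t0 \<le> s"
  shows "ennreal \<bar>g s\<bar> \<le> (\<integral>\<^sup>+t. ennreal \<bar>g' t\<bar> \<partial>lborel)"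
proof -
  have b: "has_bochner_integral lborel (\<lambda>x. g' x * indicator {t0..s} x) (g s - g t0)"
    using z(2) g c by (intro has_bochner_integral_FTC_Icc_real)
      (auto simp: has_real_derivative_iff_has_vector_derivative continuous_on_eq_continuous_at)
  then have i: "integrable lborel (\<lambda>x. g' x * indicator {t0..s} x)"
    and e: "(\<integral>x. g' x * indicator {t0..s} x \<partial>lborel) = g s"
    using z by (auto simp: has_bochner_integral_iff)
  have "ennreal \<bar>g s\<bar> \<le> (\<integral>\<^sup>+x. ennreal \<bar>g' x * indicator {t0..s} x\<bar> \<partial>lborel)"
    using integral_norm_bound_ennreal[OF i] by (simp add: e)
  also have "\<dots> \<le> (\<integral>\<^sup>+t. ennreal \<bar>g' t\<bar> \<partial>lborel)"
    by (intro nn_integral_mono) (auto simp: indicator_def)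
  finally show ?thesis .
qed

text \<open>Along each of the Suc k axes the fundamental theorem of calculus bounds |u| by the line
  integral of one partial derivative. Multiplying these bounds controls |u|^(Suc k), the k-th power
  of |u|^(Suc k / k), which is the hypothesis of \<open>Loomis_Whitney\<close>. Only C^1 regularity
  and bounded support are assumed, so that nonlinear functions of test functions are
  covered.\<close>

lemma Gagliardo_Nirenberg:
  fixes u :: "'a::euclidean_space \<Rightarrow> real" and D :: "'a \<Rightarrow> 'a"
  assumes k: "DIM('a) = Suc k" "k > 0"
    and der: "\<And>x. (u has_derivative (\<lambda>h. D x \<bullet> h)) (at x)"
    and cont: "continuous_on UNIV D"
    and supp: "\<And>x. norm x > R \<Longrightarrow> u x = 0"
  shows "(\<integral>\<^sup>+x. ennreal (\<bar>u x\<bar> powr (Suc k / k)) \<partial>lborel) ^ k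
          \<le> (\<integral>\<^sup>+x. ennreal (norm (D x)) \<partial>lborel) ^ Suc k"
proof -
  interpret P: product_sigma_finite "\<lambda>_::'a. lborel :: real measure" ..
  let ?P = "Pi\<^sub>M Basis (\<lambda>_::'a. lborel :: real measure)"
  define e :: "('a \<Rightarrow> real) \<Rightarrow> 'a" where "e c = (\<Sum>b\<in>Basis. c b *\<^sub>R b)" for c
  have em [measurable]: "e \<in> borel_measurable ?P"
    unfolding e_def by measurable
  have contu: "continuous_on UNIV u"
    using der by (meson continuous_at_imp_continuous_on has_derivative_continuous)
  have um [measurable]: "u \<in> borel_measurable borel" and Dm [measurable]: "D \<in> borel_measurable borel"
    using contu cont by (simp_all add: borel_measurable_continuous_onI)
  have nn: "(\<integral>\<^sup>+x. h x \<partial>lborel) = (\<integral>\<^sup>+c. h (e c) \<partial>?P)"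
    if [measurable]: "h \<in> borel_measurable borel" for h :: "'a \<Rightarrow> ennreal"
    by (subst lborel_eq) (simp add: nn_integral_distr e_def[symmetric])
  have e_upd: "e (c(b := t)) = e c + (t - c b) *\<^sub>R b" if "b \<in> Basis" for c b t
  proof -
    have "e (c(b := t)) = t *\<^sub>R b + (\<Sum>i\<in>Basis-{b}. c i *\<^sub>R i)"
      unfolding e_def using that by (subst sum.remove[of _ b]) auto
    moreover have "e c = c b *\<^sub>R b + (\<Sum>i\<in>Basis-{b}. c i *\<^sub>R i)"
      unfolding e_def using that by (subst sum.remove[of _ b]) auto
    ultimately show ?thesis by (simp add: algebra_simps)
  qed
  have slice: "ennreal \<bar>u (e c)\<bar> \<le> (\<integral>\<^sup>+t. ennreal \<bar>D (e (c(b := t))) \<bullet> b\<bar> \<partial>lborel)"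
    if b: "b \<in> Basis" for c b
  proof -
    define g where "g t = u (e (c(b := t)))" for t
    define g' where "g' t = D (e (c(b := t))) \<bullet> b" for t
    have "(g has_real_derivative g' t) (at t)" for t
    proof -
      have "((\<lambda>t. e c + (t - c b) *\<^sub>R b) has_derivative (\<lambda>h. h *\<^sub>R b)) (at t)"
        by (auto intro!: derivative_eq_intros)
      from has_derivative_compose[OF this der]
      show ?thesis unfolding g_def g'_def e_upd[OF b] has_field_derivative_def
        by (simp add: mult.commute[of _ "_ \<bullet> b"])
    qed
    moreover have "continuous_on UNIV g'"
      unfolding g'_def e_upd[OF b]
      by (intro continuous_intros continuous_on_compose2[OF cont]) auto
    \<comment> \<open>This parameter lies to the left of \<open>c b\<close>, and the b-coordinate of
      the corresponding point exceeds \<open>R\<close> in modulus, so the slice starts outside the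
      support.\<close>
    moreover have "g (- (\<bar>R\<bar> + 1 + \<bar>c b\<bar>)) = 0"
    proof -
      have "\<bar>e (c(b := t)) \<bullet> b\<bar> = \<bar>t\<bar>" for t
        unfolding e_def inner_sum_left_Basis[OF b] by simp
      then have "norm (e (c(b := - (\<bar>R\<bar> + 1 + \<bar>c b\<bar>)))) \<ge> \<bar>R\<bar> + 1 + \<bar>c b\<bar>"
        using Basis_le_norm[OF b, of "e (c(b := - (\<bar>R\<bar> + 1 + \<bar>c b\<bar>)))"] by simp
      then show ?thesis unfolding g_def by (intro supp) linarith
    qed
    ultimately have "ennreal \<bar>g (c b)\<bar> \<le> (\<integral>\<^sup>+t. ennreal \<bar>g' t\<bar> \<partial>lborel)"
      by (rule abs_le_nn_integral_deriv) linarith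
    then show ?thesis unfolding g_def g'_def by simp
  qed
  have "(\<integral>\<^sup>+x. ennreal (\<bar>u x\<bar> powr (Suc k / k)) \<partial>lborel) ^ k =
      (\<integral>\<^sup>+c. ennreal (\<bar>u (e c)\<bar> powr (Suc k / k)) \<partial>?P) ^ k"
    by (subst nn) auto
  also have "\<dots> \<le> (\<Prod>b\<in>Basis. \<integral>\<^sup>+c. ennreal \<bar>D (e c) \<bullet> b\<bar> \<partial>?P)"
  proof (rule P.Loomis_Whitney[where x="\<lambda>b\<in>Basis. 0"])
    fix c :: "'a \<Rightarrow> real"
    have "(\<bar>u (e c)\<bar> powr (Suc k / k)) ^ k = \<bar>u (e c)\<bar> ^ Suc k"
    proof (cases "u (e c) = 0")
      case False
      then have "(\<bar>u (e c)\<bar> powr (Suc k / k)) ^ k = \<bar>u (e c)\<bar> powr (real (Suc k))"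
        using k by (simp add: powr_power)
      then show ?thesis using False by (metis powr_realpow zero_less_abs_iff)
    qed (use k in auto)
    then have "(ennreal (\<bar>u (e c)\<bar> powr (Suc k / k))) ^ k = ennreal (\<bar>u (e c)\<bar> ^ Suc k)"
      by (simp only: ennreal_power powr_ge_zero)
    also have "\<dots> = (\<Prod>b\<in>(Basis::'a set). ennreal \<bar>u (e c)\<bar>)"
      using k by (simp add: ennreal_mult ennreal_power)
    also have "\<dots> \<le> (\<Prod>b\<in>Basis. \<integral>\<^sup>+t. ennreal \<bar>D (e (c(b := t))) \<bullet> b\<bar> \<partial>lborel)"
      by (intro prod_mono_ennreal slice)
    finally show "(ennreal (\<bar>u (e c)\<bar> powr (Suc k / k))) ^ k \<le>
      (\<Prod>b\<in>Basis. \<integral>\<^sup>+t. ennreal \<bar>D (e (c(b := t))) \<bullet> b\<bar> \<partial>lborel)" .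
  qed (use k in \<open>auto simp: space_PiM\<close>)
  also have "\<dots> = (\<Prod>b\<in>Basis. \<integral>\<^sup>+x. ennreal \<bar>D x \<bullet> b\<bar> \<partial>lborel)"
    by (intro prod.cong refl nn[symmetric]) auto
  also have "\<dots> \<le> (\<Prod>b\<in>(Basis::'a set). \<integral>\<^sup>+x. ennreal (norm (D x)) \<partial>lborel)"
    by (intro prod_mono_ennreal nn_integral_mono ennreal_leI Basis_le_norm)
  also have "\<dots> = (\<integral>\<^sup>+x. ennreal (norm (D x)) \<partial>lborel) ^ Suc k"
    using k by simp
  finally show ?thesis .
qed

section \<open>Test functions\<close>

lemma Ck_Suc_imp_Ck: "Ck (Suc k) \<phi> \<Longrightarrow> Ck k \<phi>"
proof (induction k arbitrary: \<phi>)
  case 0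
  then show ?case by (simp add: differentiable_imp_continuous_on)
next
  case (Suc k)
  from Suc.prems have "\<phi> differentiable_on UNIV" "\<forall>b\<in>Basis. Ck (Suc k) (partial b \<phi>)"
    using Ck.simps(2)[of "Suc k" \<phi>] by blast+
  then show ?case using Suc.IH by (simp only: Ck.simps(2)[of k]) blast
qed

lemma has_derivative_frechet:
  "\<phi> differentiable_on UNIV \<Longrightarrow> (\<phi> has_derivative frechet_derivative \<phi> (at x)) (at x)"
  by (simp add: differentiable_on_def frechet_derivative_works)

lemma partial_eqI:
  "(\<phi> has_derivative D) (at x) \<Longrightarrow> partial b \<phi> x = D b"
  unfolding partial_def by (metis frechet_derivative_at)

lemma inner_grad: "b \<in> Basis \<Longrightarrow> grad \<phi> x \<bullet> b = partial b \<phi> x"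
  unfolding grad_def by (simp add: inner_sum_left_Basis)

lemma has_derivative_grad:
  assumes "\<phi> differentiable_on UNIV"
  shows "(\<phi> has_derivative (\<lambda>h. grad \<phi> x \<bullet> h)) (at x)"
proof -
  note d = has_derivative_frechet[OF assms, of x]
  interpret bounded_linear "frechet_derivative \<phi> (at x)"
    using d by (rule has_derivative_bounded_linear)
  have "frechet_derivative \<phi> (at x) = (\<lambda>h. grad \<phi> x \<bullet> h)"
  proof
    fix h
    have "frechet_derivative \<phi> (at x) h = frechet_derivative \<phi> (at x) (\<Sum>b\<in>Basis. (h \<bullet> b) *\<^sub>R b)"
      by (simp add: euclidean_representation)
    also have "\<dots> = (\<Sum>b\<in>Basis. (h \<bullet> b) * partial b \<phi> x)"
      by (simp add: sum scaleR partial_def)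
    also have "\<dots> = grad \<phi> x \<bullet> h"
      by (subst (2) euclidean_inner) (simp add: inner_grad mult.commute)
    finally show "frechet_derivative \<phi> (at x) h = grad \<phi> x \<bullet> h" .
  qed
  then show ?thesis using d by simp
qed

lemma grad_eqI:
  assumes "(\<phi> has_derivative (\<lambda>h. D \<bullet> h)) (at x)"
  shows "grad \<phi> x = D"
  by (rule euclidean_eqI) (simp add: inner_grad partial_eqI[OF assms])

lemma grad_add:
  assumes "\<phi> differentiable_on UNIV" "\<psi> differentiable_on UNIV"
  shows "grad (\<lambda>x. \<phi> x + \<psi> x) x = grad \<phi> x + grad \<psi> x"
  by (rule grad_eqI)
    (auto intro!: derivative_eq_intros has_derivative_grad assms simp: inner_add_left)

lemma grad_cmult:
  assumes "\<phi> differentiable_on UNIV"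
  shows "grad (\<lambda>x. c * \<phi> x) x = c *\<^sub>R grad \<phi> x"
  by (rule grad_eqI) (auto intro!: derivative_eq_intros has_derivative_grad assms)

lemma has_derivative_compose_grad:
  assumes "\<phi> differentiable_on UNIV" "(F has_real_derivative F') (at (\<phi> x))"
  shows "((\<lambda>x. F (\<phi> x)) has_derivative (\<lambda>h. (F' *\<^sub>R grad \<phi> x) \<bullet> h)) (at x)"
  using has_derivative_compose[OF has_derivative_grad[OF assms(1)]] assms(2)
  by (auto simp: has_field_derivative_def)

lemma Ck_const: "Ck k (\<lambda>_. c)"
proof (induction k arbitrary: c)
  case (Suc k)
  have "partial b (\<lambda>_. c) = (\<lambda>_. 0)" for b :: 'a
    by (auto intro!: partial_eqI)
  then show ?case using Suc by (simp add: differentiable_on_def)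
qed simp

lemma Ck_add:
  "Ck k \<phi> \<Longrightarrow> Ck k \<psi> \<Longrightarrow> Ck k (\<lambda>x. \<phi> x + \<psi> x)"
proof (induction k arbitrary: \<phi> \<psi>)
  case 0 then show ?case by (simp add: continuous_on_add)
next
  case (Suc k)
  then have d: "\<phi> differentiable_on UNIV" "\<psi> differentiable_on UNIV" by simp_all
  have "partial b (\<lambda>x. \<phi> x + \<psi> x) = (\<lambda>x. partial b \<phi> x + partial b \<psi> x)" for b
    using has_derivative_add[OF d[THEN has_derivative_frechet]]
    by (auto intro!: partial_eqI simp: partial_def[of _ \<phi>] partial_def[of _ \<psi>])
  then show ?case using Suc d by simp
qed

lemma Ck_mult:
  "Ck k \<phi> \<Longrightarrow> Ck k \<psi> \<Longrightarrow> Ck k (\<lambda>x. \<phi> x * \<psi> x)"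
proof (induction k arbitrary: \<phi> \<psi>)
  case 0 then show ?case by (simp add: continuous_on_mult)
next
  case (Suc k)
  then have d: "\<phi> differentiable_on UNIV" "\<psi> differentiable_on UNIV" by simp_all
  have "partial b (\<lambda>x. \<phi> x * \<psi> x) = (\<lambda>x. \<phi> x * partial b \<psi> x + partial b \<phi> x * \<psi> x)" for b
    using has_derivative_mult[OF d[THEN has_derivative_frechet]]
    by (auto intro!: partial_eqI simp: partial_def[of _ \<phi>] partial_def[of _ \<psi>])
  moreover have "(\<lambda>x. \<phi> x * \<psi> x) differentiable_on UNIV"
    using d by (auto simp: differentiable_on_def)
  ultimately show ?case using Suc.prems
    by (auto intro!: Ck_add Suc.IH intro: Ck_Suc_imp_Ck)
qed

text \<open>Polynomials preserve smoothness by closure under sums and products alone, which spares a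
  chain rule of higher order. This is why nonlinear functions of test functions are later replaced
  by polynomials.\<close>

lemma Ck_real_polynomial_function:
  "real_polynomial_function P \<Longrightarrow> Ck k \<phi> \<Longrightarrow> Ck k (\<lambda>x. P (\<phi> x))"
proof (induction P rule: real_polynomial_function.induct)
  case (linear f)
  then obtain c where "f = (\<lambda>s. s * c)" using real_bounded_linear by blast
  then show ?case using linear by (auto intro!: Ck_mult Ck_const)
qed (auto intro: Ck_const Ck_add Ck_mult)

lemma test_functionsI:
  fixes \<Omega> :: "'a::euclidean_space set"
  assumes "\<And>k. Ck k \<phi>" "compact K" "K \<subseteq> \<Omega>" "\<And>x. x \<notin> K \<Longrightarrow> \<phi> x = 0"
  shows "\<phi> \<in> test_functions \<Omega>"
proof -
  have "{x. \<phi> x \<noteq> 0} \<subseteq> K" using assms(4) by blast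
  then have "closure {x. \<phi> x \<noteq> 0} \<subseteq> K" using assms(2) by (simp add: closure_minimal compact_imp_closed)
  then show ?thesis unfolding test_functions_def using assms
    by (auto simp: compact_eq_bounded_closed intro: bounded_subset)
qed

lemma test_functionsE:
  assumes "\<phi> \<in> test_functions \<Omega>"
  obtains K where "\<And>k. Ck k \<phi>" "compact K" "K \<subseteq> \<Omega>" "\<And>x. x \<notin> K \<Longrightarrow> \<phi> x = 0"
proof
  show "\<phi> x = 0" if "x \<notin> closure {x. \<phi> x \<noteq> 0}" for x
    using that closure_subset[of "{x. \<phi> x \<noteq> 0}"] by blast
qed (use assms in \<open>auto simp: test_functions_def\<close>)

lemma test_functions_differentiable: "\<phi> \<in> test_functions \<Omega> \<Longrightarrow> \<phi> differentiable_on UNIV"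
  unfolding test_functions_def by (metis (mono_tags, lifting) Ck.simps(2) mem_Collect_eq)

lemma test_functions_continuous: "\<phi> \<in> test_functions \<Omega> \<Longrightarrow> continuous_on UNIV \<phi>"
  by (simp add: differentiable_imp_continuous_on test_functions_differentiable)

lemma test_functions_grad_continuous:
  assumes "\<phi> \<in> test_functions \<Omega>"
  shows "continuous_on UNIV (grad \<phi>)"
proof -
  have "Ck (Suc 0) \<phi>" using assms by (simp only: test_functions_def mem_Collect_eq)
  then show ?thesis unfolding grad_def by (auto intro!: continuous_intros)
qed

lemma test_functions_0: "(\<lambda>_. 0) \<in> test_functions \<Omega>"
  by (rule test_functionsI[of _ "{}"]) (auto intro: Ck_const)

lemma test_functions_add:
  assumes "\<phi> \<in> test_functions \<Omega>" "\<psi> \<in> test_functions \<Omega>"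
  shows "(\<lambda>x. \<phi> x + \<psi> x) \<in> test_functions \<Omega>"
proof -
  obtain K where "\<And>k. Ck k \<phi>" "compact K" "K \<subseteq> \<Omega>" "\<And>x. x \<notin> K \<Longrightarrow> \<phi> x = 0"
    using test_functionsE[OF assms(1)] by metis
  moreover obtain L where "\<And>k. Ck k \<psi>" "compact L" "L \<subseteq> \<Omega>" "\<And>x. x \<notin> L \<Longrightarrow> \<psi> x = 0"
    using test_functionsE[OF assms(2)] by metis
  ultimately show ?thesis
    by (intro test_functionsI[of _ "K \<union> L"]) (auto intro: Ck_add)
qed

lemma test_functions_real_polynomial_function:
  assumes "\<phi> \<in> test_functions \<Omega>" "real_polynomial_function P" "P 0 = 0"
  shows "(\<lambda>x. P (\<phi> x)) \<in> test_functions \<Omega>"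
proof -
  obtain K where "\<And>k. Ck k \<phi>" "compact K" "K \<subseteq> \<Omega>" "\<And>x. x \<notin> K \<Longrightarrow> \<phi> x = 0"
    using test_functionsE[OF assms(1)] by metis
  then show ?thesis using assms
    by (intro test_functionsI[of _ K]) (auto intro: Ck_real_polynomial_function)
qed

lemma test_functions_cmult:
  assumes "\<phi> \<in> test_functions \<Omega>"
  shows "(\<lambda>x. c * \<phi> x) \<in> test_functions \<Omega>"
  by (rule test_functions_real_polynomial_function[OF assms, of "\<lambda>s. c * s"])
    (auto intro!: real_polynomial_function.intros(1) bounded_linear_mult_right)

text \<open>The support is compact inside \<Omega>, so even a boundary point has a neighbourhood on
  which the function is zero; hence its gradient vanishes there too.\<close>

lemma test_functions_outside:
  assumes "\<phi> \<in> test_functions \<Omega>" "x \<notin> \<Omega>"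
  shows "\<phi> x = 0" "grad \<phi> x = 0"
proof -
  obtain K where K: "compact K" "K \<subseteq> \<Omega>" "\<And>x. x \<notin> K \<Longrightarrow> \<phi> x = 0"
    using test_functionsE[OF assms(1)] by metis
  then show "\<phi> x = 0" using assms by blast
  have "((\<lambda>_. 0::real) has_derivative (\<lambda>h. 0 \<bullet> h)) (at x)" by simp
  then have "(\<phi> has_derivative (\<lambda>h. 0 \<bullet> h)) (at x)"
  proof (rule has_derivative_transform_within_open)
    show "open (- K)" using K(1) by (simp add: compact_imp_closed open_Compl)
    show "x \<in> - K" using K(2) assms(2) by blast
  qed (use K(3) in simp)
  then show "grad \<phi> x = 0" by (rule grad_eqI)
qed

lemma compact_support_bounded:
  fixes g :: "'a::euclidean_space \<Rightarrow> 'b::real_normed_vector"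
  assumes "bounded \<Omega>" "continuous_on UNIV g" "\<And>x. x \<notin> \<Omega> \<Longrightarrow> g x = 0"
  obtains R where "R > 0" "\<And>x. norm (g x) \<le> R"
proof -
  have "compact (g ` closure \<Omega>)"
    using assms by (intro compact_continuous_image) (auto intro: continuous_on_subset simp: compact_closure)
  then obtain R where "R > 0" "\<And>y. y \<in> g ` closure \<Omega> \<Longrightarrow> norm y \<le> R"
    using compact_imp_bounded bounded_pos by metis
  moreover have "norm (g x) \<le> R" for x
    using calculation assms(3)[of x] closure_subset[of \<Omega>] by (cases "x \<in> \<Omega>") auto
  ultimately show ?thesis using that by blast
qed

text \<open>Weierstrass approximation is applied to the derivative and the polynomial is integrated
  from 0, which also yields \<open>P 0 = 0\<close>. The mean value inequality costs a factor
  \<open>R\<close>, so the tolerance \<open>e / (R + 1)\<close> serves both the function and its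
  derivative.\<close>

lemma C1_poly_approx:
  fixes F F' :: "real \<Rightarrow> real"
  assumes "\<And>s. (F has_real_derivative F' s) (at s)" "continuous_on UNIV F'" "F 0 = 0" "e > 0" "R > 0"
  obtains P P' where "real_polynomial_function P" "P 0 = 0"
    "\<And>s. (P has_real_derivative P' s) (at s)"
    "\<And>s. \<bar>s\<bar> \<le> R \<Longrightarrow> \<bar>P s - F s\<bar> \<le> e" "\<And>s. \<bar>s\<bar> \<le> R \<Longrightarrow> \<bar>P' s - F' s\<bar> \<le> e"
proof -
  define d where "d = e / (R + 1)"
  have d: "d > 0" "d \<le> e" "d * R \<le> e" using assms unfolding d_def by (auto simp: field_simps)
  obtain P' where P': "real_polynomial_function P'" "\<And>s. s \<in> {-R..R} \<Longrightarrow> \<bar>F' s - P' s\<bar> < d"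
    using Stone_Weierstrass_real_polynomial_function[of "{-R..R}" F' d] assms(2) d(1)
    by (metis compact_Icc continuous_on_subset subset_UNIV)
  then obtain a n where a: "P' = (\<lambda>x. \<Sum>i\<le>n. a i * x ^ i)"
    using real_polynomial_function_iff_sum by auto
  define P where "P x = (\<Sum>i\<le>n. a i / real (Suc i) * x ^ Suc i)" for x :: real
  have der: "(P has_real_derivative P' s) (at s)" for s
    unfolding P_def a by (auto intro!: derivative_eq_intros sum.cong simp del: power_Suc)
  have "real_polynomial_function P"
  proof -
    have "real_polynomial_function (\<lambda>x::real. x ^ i)" for i
      by (intro real_polynomial_function_power real_polynomial_function.intros(1)) auto
    then show ?thesis unfolding P_def
      by (intro real_polynomial_function_sum real_polynomial_function.intros(4)) (auto simp del: power_Suc)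
  qed
  moreover have P0: "P 0 = 0" by (simp add: P_def)
  moreover have "\<bar>P s - F s\<bar> \<le> e" if s: "\<bar>s\<bar> \<le> R" for s
  proof -
    have "norm ((P s - F s) - (P 0 - F 0)) \<le> d * norm (s - 0)"
    proof (rule field_differentiable_bound)
      show "((\<lambda>s. P s - F s) has_field_derivative (P' z - F' z)) (at z within {-R..R})" for z
        using der assms(1) by (auto intro!: derivative_intros intro: DERIV_subset)
      show "norm (P' z - F' z) \<le> d" if "z \<in> {-R..R}" for z
        using P'(2)[OF that] by simp
    qed (use s in auto)
    also have "\<dots> \<le> d * R" using s d by (intro mult_left_mono) auto
    finally show ?thesis using P0 assms(3) d by simp
  qed
  moreover have "\<bar>P' s - F' s\<bar> \<le> e" if "\<bar>s\<bar> \<le> R" for s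
    using P'(2)[of s] that d by (auto simp: abs_le_iff abs_less_iff)
  ultimately show ?thesis by (intro that[of P P'] der)
qed

text \<open>For F merely C^1, F(\<phi>) is not smooth. As \<phi> has bounded range, a polynomial
  close to F in C^1 on that range yields a genuine test function, and its zero at 0 keeps the
  support compact.\<close>

lemma test_functions_compose_approx:
  fixes F F' :: "real \<Rightarrow> real"
  assumes \<Omega>: "bounded \<Omega>" and \<phi>: "\<phi> \<in> test_functions \<Omega>"
    and F: "\<And>s. (F has_real_derivative F' s) (at s)" "continuous_on UNIV F'" "F 0 = 0" and e: "e > 0"
  obtains \<psi> where "\<psi> \<in> test_functions \<Omega>" "\<And>x. \<bar>\<psi> x - F (\<phi> x)\<bar> \<le> e"
    "\<And>x. norm (grad \<psi> x - F' (\<phi> x) *\<^sub>R grad \<phi> x) \<le> e * norm (grad \<phi> x)"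
proof -
  obtain R where R: "R > 0" "\<And>x. norm (\<phi> x) \<le> R"
    using compact_support_bounded[OF \<Omega> test_functions_continuous[OF \<phi>] test_functions_outside(1)[OF \<phi>]]
    by blast
  obtain P P' where P: "real_polynomial_function P" "P 0 = 0"
    "\<And>s. (P has_real_derivative P' s) (at s)"
    "\<And>s. \<bar>s\<bar> \<le> R \<Longrightarrow> \<bar>P s - F s\<bar> \<le> e" "\<And>s. \<bar>s\<bar> \<le> R \<Longrightarrow> \<bar>P' s - F' s\<bar> \<le> e"
    using C1_poly_approx[OF F e R(1)] by blast
  have "norm (grad (\<lambda>x. P (\<phi> x)) x - F' (\<phi> x) *\<^sub>R grad \<phi> x) \<le> e * norm (grad \<phi> x)" for x
  proof -
    have "grad (\<lambda>x. P (\<phi> x)) x = P' (\<phi> x) *\<^sub>R grad \<phi> x"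
      by (rule grad_eqI[OF has_derivative_compose_grad[OF test_functions_differentiable[OF \<phi>] P(3)]])
    then have "grad (\<lambda>x. P (\<phi> x)) x - F' (\<phi> x) *\<^sub>R grad \<phi> x = (P' (\<phi> x) - F' (\<phi> x)) *\<^sub>R grad \<phi> x"
      by (simp add: scaleR_diff_left)
    then show ?thesis using P(5)[of "\<phi> x"] R(2)[of x] by (simp add: mult_right_mono)
  qed
  then show ?thesis
    using that test_functions_real_polynomial_function[OF \<phi> P(1,2)] P(4) R(2) by simp
qed

section \<open>The Sobolev inequality on a bounded domain\<close>

locale bounded_domain =
  fixes \<Omega> :: "'a::euclidean_space set"
  assumes open_domain: "open \<Omega>" and bounded_domain: "bounded \<Omega>" and dim_gt_2: "DIM('a) > 2"
begin

abbreviation \<mu> :: "'a measure" where "\<mu> \<equiv> lebesgue_on \<Omega>"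

text \<open>The Sobolev conjugate of 1. It is less than 2 precisely when the dimension exceeds 2,
  and the linear gradient estimate lives on that margin.\<close>

definition p :: real where "p = real DIM('a) / (real DIM('a) - 1)"

lemma p_bounds: "1 < p" "p < 2"
  using dim_gt_2 by (auto simp: p_def field_simps)

lemma sets_domain [measurable]: "\<Omega> \<in> sets lebesgue"
  using open_domain by simp

sublocale finite_measure \<mu>
proof
  have "emeasure lebesgue \<Omega> \<noteq> \<infinity>"
    using fmeasurableD2[OF bounded_set_imp_lmeasurable[OF bounded_domain sets_domain]] by simp
  then show "emeasure \<mu> (space \<mu>) \<noteq> \<infinity>"
    by (simp add: emeasure_restrict_space)
qed

lemma measurable_continuous: "continuous_on UNIV g \<Longrightarrow> g \<in> borel_measurable \<mu>"
  by (intro continuous_imp_measurable_on_sets_lebesgue) (auto intro: continuous_on_subset)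

lemma measurable_cont_compose:
  fixes F :: "real \<Rightarrow> real"
  shows "continuous_on UNIV F \<Longrightarrow> g \<in> borel_measurable \<mu> \<Longrightarrow> (\<lambda>x. F (g x)) \<in> borel_measurable \<mu>"
  by (rule measurable_compose[of g \<mu> borel F borel]) (auto intro: borel_measurable_continuous_onI)

lemma integrable_bounded:
  fixes g :: "'a \<Rightarrow> 'b::{banach,second_countable_topology}"
  shows "g \<in> borel_measurable \<mu> \<Longrightarrow> (\<And>x. norm (g x) \<le> B) \<Longrightarrow> integrable \<mu> g"
  by (rule integrable_const_bound[of _ B]) auto

lemma test_measurable [measurable]:
  assumes "\<phi> \<in> test_functions \<Omega>"
  shows "\<phi> \<in> borel_measurable \<mu>" "grad \<phi> \<in> borel_measurable \<mu>"
  using assms by (auto intro!: measurable_continuous test_functions_continuous test_functions_grad_continuous)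

lemma test_bounded:
  assumes "\<phi> \<in> test_functions \<Omega>"
  obtains R where "R > 0" "\<And>x. \<bar>\<phi> x\<bar> \<le> R" "\<And>x. norm (grad \<phi> x) \<le> R"
proof -
  obtain R1 where 1: "R1 > 0" "\<And>x. norm (\<phi> x) \<le> R1"
    using compact_support_bounded[OF bounded_domain test_functions_continuous[OF assms]
      test_functions_outside(1)[OF assms]] by blast
  obtain R2 where 2: "R2 > 0" "\<And>x. norm (grad \<phi> x) \<le> R2"
    using compact_support_bounded[OF bounded_domain test_functions_grad_continuous[OF assms]
      test_functions_outside(2)[OF assms]] by blast
  have "\<bar>\<phi> x\<bar> \<le> max R1 R2" "norm (grad \<phi> x) \<le> max R1 R2" for x
    using 1(2)[of x] 2(2)[of x] by auto
  then show ?thesis using that[of "max R1 R2"] 1 by auto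
qed

lemma compose_bounded:
  fixes F :: "real \<Rightarrow> real"
  assumes "\<phi> \<in> test_functions \<Omega>" "continuous_on UNIV F"
  obtains B where "B > 0" "\<And>x. \<bar>F (\<phi> x)\<bar> \<le> B"
proof -
  obtain R where R: "R > 0" "\<And>x. \<bar>\<phi> x\<bar> \<le> R" using test_bounded[OF assms(1)] by metis
  have "compact (F ` {-R..R})"
    using assms by (intro compact_continuous_image) (auto intro: continuous_on_subset)
  then obtain B where B: "B > 0" "\<And>y. y \<in> F ` {-R..R} \<Longrightarrow> norm y \<le> B"
    using compact_imp_bounded bounded_pos by metis
  have "\<bar>F (\<phi> x)\<bar> \<le> B" for x
    using B(2)[of "F (\<phi> x)"] R(2)[of x] by (auto simp: abs_le_iff)
  then show ?thesis using that B by blast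
qed

lemma test_integrable:
  assumes "\<phi> \<in> test_functions \<Omega>"
  shows "integrable \<mu> \<phi>" "integrable \<mu> (grad \<phi>)"
    "integrable \<mu> (\<lambda>x. (norm (grad \<phi> x))\<^sup>2)" "integrable \<mu> (\<lambda>x. norm (grad \<phi> x))"
proof -
  obtain R where R: "R > 0" "\<And>x. \<bar>\<phi> x\<bar> \<le> R" "\<And>x. norm (grad \<phi> x) \<le> R"
    using test_bounded[OF assms] by metis
  note [measurable] = test_measurable[OF assms]
  show "integrable \<mu> \<phi>" "integrable \<mu> (grad \<phi>)"
    using R by (auto intro!: integrable_bounded[where B=R])
  then show "integrable \<mu> (\<lambda>x. norm (grad \<phi> x))" by auto
  have "norm ((norm (grad \<phi> x))\<^sup>2) \<le> R\<^sup>2" for x using R(3)[of x] by (simp add: power_mono)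
  then show "integrable \<mu> (\<lambda>x. (norm (grad \<phi> x))\<^sup>2)"
    by (intro integrable_bounded) auto
qed

lemma nn_integral_lborel_eq_domain:
  assumes "\<And>x. x \<notin> \<Omega> \<Longrightarrow> h x = (0::ennreal)"
  shows "(\<integral>\<^sup>+x. h x \<partial>lborel) = (\<integral>\<^sup>+x. h x \<partial>\<mu>)"
proof -
  have "(\<integral>\<^sup>+x. h x \<partial>\<mu>) = (\<integral>\<^sup>+x. h x * indicator \<Omega> x \<partial>lebesgue)"
    by (rule nn_integral_restrict_space) simp
  also have "\<dots> = (\<integral>\<^sup>+x. h x \<partial>lebesgue)"
    using assms by (intro nn_integral_cong) (auto simp: indicator_def)
  finally show ?thesis by (simp add: nn_integral_completion)
qed

text \<open>F(\<phi>) is C^1 with bounded support, which is all that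
  \<open>Gagliardo_Nirenberg\<close> asks for, so no approximation is involved. The k-th root is
  taken only once both integrals are known to be finite reals.\<close>

lemma Sobolev_test:
  fixes F F' :: "real \<Rightarrow> real"
  assumes \<phi>: "\<phi> \<in> test_functions \<Omega>"
    and F: "\<And>s. (F has_real_derivative F' s) (at s)" "continuous_on UNIV F'" "F 0 = 0"
  shows "(\<integral>x. \<bar>F (\<phi> x)\<bar> powr p \<partial>\<mu>) \<le> (\<integral>x. \<bar>F' (\<phi> x)\<bar> * norm (grad \<phi> x) \<partial>\<mu>) powr p"
proof -
  define k where "k = DIM('a) - 1"
  have k: "DIM('a) = Suc k" "k > 0" "p = Suc k / k"
    using dim_gt_2 by (auto simp: k_def p_def of_nat_diff)
  define A where "A = (\<integral>x. \<bar>F (\<phi> x)\<bar> powr p \<partial>\<mu>)"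
  define U where "U = (\<integral>x. \<bar>F' (\<phi> x)\<bar> * norm (grad \<phi> x) \<partial>\<mu>)"
  have AU: "A \<ge> 0" "U \<ge> 0" unfolding A_def U_def by (auto intro!: integral_nonneg_AE)
  have cF: "continuous_on UNIV F" using F(1) by (meson DERIV_continuous_on has_field_derivative_at_within)
  obtain B where B: "B > 0" "\<And>x. \<bar>F (\<phi> x)\<bar> \<le> B" using compose_bounded[OF \<phi> cF] by metis
  obtain B' where B': "B' > 0" "\<And>x. \<bar>F' (\<phi> x)\<bar> \<le> B'" using compose_bounded[OF \<phi> F(2)] by metis
  note [measurable] = test_measurable[OF \<phi>] measurable_cont_compose[OF cF test_measurable(1)[OF \<phi>]]
    measurable_cont_compose[OF F(2) test_measurable(1)[OF \<phi>]]
  have iA: "integrable \<mu> (\<lambda>x. \<bar>F (\<phi> x)\<bar> powr p)"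
    using B p_bounds by (intro integrable_bounded[where B="B powr p"]) (auto intro!: powr_mono2)
  obtain R where R: "R > 0" "\<And>x. norm (grad \<phi> x) \<le> R" using test_bounded[OF \<phi>] by metis
  have iU: "integrable \<mu> (\<lambda>x. \<bar>F' (\<phi> x)\<bar> * norm (grad \<phi> x))"
    using B' R by (intro integrable_bounded[where B="B' * R"]) (auto intro!: mult_mono simp: less_imp_le)
  have eA: "(\<integral>\<^sup>+x. ennreal (\<bar>F (\<phi> x)\<bar> powr p) \<partial>lborel) = ennreal A"
    unfolding A_def using iA F(3) test_functions_outside(1)[OF \<phi>] p_bounds
    by (subst nn_integral_lborel_eq_domain) (auto simp: nn_integral_eq_integral)
  have eU: "(\<integral>\<^sup>+x. ennreal (norm (F' (\<phi> x) *\<^sub>R grad \<phi> x)) \<partial>lborel) = ennreal U"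
    unfolding U_def using iU test_functions_outside(2)[OF \<phi>]
    by (subst nn_integral_lborel_eq_domain) (auto simp: nn_integral_eq_integral)
  obtain r where r: "\<And>x. x \<in> \<Omega> \<Longrightarrow> norm x \<le> r" using bounded_domain bounded_pos by metis
  have "(\<integral>\<^sup>+x. ennreal (\<bar>F (\<phi> x)\<bar> powr (Suc k / k)) \<partial>lborel) ^ k
      \<le> (\<integral>\<^sup>+x. ennreal (norm (F' (\<phi> x) *\<^sub>R grad \<phi> x)) \<partial>lborel) ^ Suc k"
  proof (rule Gagliardo_Nirenberg[OF k(1,2)])
    show "((\<lambda>x. F (\<phi> x)) has_derivative (\<lambda>h. (F' (\<phi> x) *\<^sub>R grad \<phi> x) \<bullet> h)) (at x)" for x
      by (rule has_derivative_compose_grad[OF test_functions_differentiable[OF \<phi>] F(1)])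
    show "continuous_on UNIV (\<lambda>x. F' (\<phi> x) *\<^sub>R grad \<phi> x)"
      by (intro continuous_intros continuous_on_compose2[OF F(2)] test_functions_continuous[OF \<phi>]
        test_functions_grad_continuous[OF \<phi>]) auto
    show "F (\<phi> x) = 0" if "norm x > r" for x
      using r[of x] that F(3) test_functions_outside(1)[OF \<phi>, of x] by force
  qed
  then have "ennreal (A ^ k) \<le> ennreal (U ^ Suc k)"
    using eA eU AU k(3) by (simp only: ennreal_power)
  then have "A ^ k \<le> U ^ Suc k" using AU by (simp only: ennreal_le_iff zero_le_power)
  then have "(A ^ k) powr (1 / k) \<le> (U ^ Suc k) powr (1 / k)"
    using AU by (intro powr_mono2) auto
  moreover have "(A ^ k) powr (1 / k) = A"
    using AU k(2) by (cases "A = 0") (auto simp: powr_realpow[symmetric] powr_powr)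
  moreover have "(U ^ Suc k) powr (1 / k) = U powr p"
    using AU k(3) by (cases "U = 0") (auto simp: powr_realpow[symmetric] powr_powr simp del: power_Suc of_nat_Suc)
  ultimately show ?thesis unfolding A_def U_def by simp
qed

text \<open>In place of Hoelder's inequality, |s| is split at a level \<eta>: below it |s| is at
  most \<eta>, above it |s| is at most \<eta>^(1-p) |s|^p. With \<eta> equal to the L^1 norm of the
  gradient, \<open>Sobolev_test\<close> makes both terms linear in that norm.\<close>

lemma Poincare_test:
  assumes \<phi>: "\<phi> \<in> test_functions \<Omega>"
  shows "(\<integral>x. \<bar>\<phi> x\<bar> \<partial>\<mu>) \<le> (measure \<mu> \<Omega> + 1) * (\<integral>x. norm (grad \<phi> x) \<partial>\<mu>)"
proof -
  define U where "U = (\<integral>x. norm (grad \<phi> x) \<partial>\<mu>)"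
  define A where "A = (\<integral>x. \<bar>\<phi> x\<bar> powr p \<partial>\<mu>)"
  have U: "U \<ge> 0" and A: "A \<ge> 0" unfolding U_def A_def by (auto intro!: integral_nonneg_AE)
  have AU: "A \<le> U powr p"
    using Sobolev_test[OF \<phi>, of "\<lambda>s. s" "\<lambda>_. 1"] by (simp add: A_def U_def)
  note [measurable] = test_measurable[OF \<phi>]
  obtain R where R: "R > 0" "\<And>x. \<bar>\<phi> x\<bar> \<le> R" using test_bounded[OF \<phi>] by metis
  have iA: "integrable \<mu> (\<lambda>x. \<bar>\<phi> x\<bar> powr p)"
    using R p_bounds by (intro integrable_bounded[where B="R powr p"]) (auto intro!: powr_mono2)
  have main: "(\<integral>x. \<bar>\<phi> x\<bar> \<partial>\<mu>) \<le> \<eta> * measure \<mu> \<Omega> + \<eta> powr (1 - p) * A" if "\<eta> > 0" for \<eta>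
  proof -
    have pw: "\<bar>s\<bar> \<le> \<eta> + \<eta> powr (1 - p) * \<bar>s\<bar> powr p" for s :: real
    proof (cases "\<bar>s\<bar> \<le> \<eta>")
      case False
      then have "\<bar>s\<bar> = \<bar>s\<bar> powr (1 - p) * \<bar>s\<bar> powr p" using \<open>\<eta> > 0\<close>
        by (simp flip: powr_add)
      also have "\<dots> \<le> \<eta> powr (1 - p) * \<bar>s\<bar> powr p"
        using False p_bounds \<open>\<eta> > 0\<close> by (intro mult_right_mono powr_mono2') auto
      finally show ?thesis using \<open>\<eta> > 0\<close> by simp
    qed (simp add: add_increasing2)
    have "(\<integral>x. \<bar>\<phi> x\<bar> \<partial>\<mu>) \<le> (\<integral>x. \<eta> + \<eta> powr (1 - p) * \<bar>\<phi> x\<bar> powr p \<partial>\<mu>)"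
      using iA test_integrable[OF \<phi>] by (intro integral_mono pw) auto
    also have "\<dots> = \<eta> * measure \<mu> \<Omega> + \<eta> powr (1 - p) * A"
      using iA by (simp add: A_def)
    finally show ?thesis .
  qed
  show ?thesis
  proof (cases "U = 0")
    case True
    then have "A = 0" using AU A by simp
    have "(\<integral>x. \<bar>\<phi> x\<bar> \<partial>\<mu>) \<le> 0 + e" if "e > 0" for e
    proof -
      define \<eta> where "\<eta> = e / (measure \<mu> \<Omega> + 1)"
      have "0 \<le> measure \<mu> \<Omega>" by simp
      then have "0 < measure \<mu> \<Omega> + 1" by linarith
      then have "\<eta> > 0" "\<eta> * measure \<mu> \<Omega> \<le> e" using that unfolding \<eta>_def by (auto simp: field_simps)
      then show ?thesis using main[of \<eta>] \<open>A = 0\<close> by simp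
    qed
    then have "(\<integral>x. \<bar>\<phi> x\<bar> \<partial>\<mu>) \<le> 0" by (rule field_le_epsilon)
    then show ?thesis using True unfolding U_def by simp
  next
    case False
    then have "U > 0" using U by simp
    have "(\<integral>x. \<bar>\<phi> x\<bar> \<partial>\<mu>) \<le> U * measure \<mu> \<Omega> + U powr (1 - p) * A" by (rule main[OF \<open>U > 0\<close>])
    also have "\<dots> \<le> U * measure \<mu> \<Omega> + U powr (1 - p) * U powr p"
      using AU by (intro add_left_mono mult_left_mono) auto
    also have "\<dots> = (measure \<mu> \<Omega> + 1) * U"
      using \<open>U > 0\<close> by (simp add: algebra_simps flip: powr_add)
    finally show ?thesis unfolding U_def .
  qed
qed

end

section \<open>Approximate solutions of the linear equation\<close>

locale elliptic_coefficient = bounded_domain \<Omega> for \<Omega> :: "'a::euclidean_space set" +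
  fixes a :: "'a \<Rightarrow> real" and \<alpha> \<beta> :: real
  assumes a_measurable [measurable]: "a \<in> borel_measurable \<mu>"
    and \<alpha>_pos: "0 < \<alpha>" and \<beta>_pos: "0 < \<beta>"
    and a_bounds: "AE x in \<mu>. \<alpha> \<le> a x \<and> a x \<le> \<beta>"
begin

lemma integrable_coeff:
  fixes g :: "'a \<Rightarrow> 'b::{banach,second_countable_topology}"
  assumes "integrable \<mu> g"
  shows "integrable \<mu> (\<lambda>x. a x *\<^sub>R g x)"
proof (rule Bochner_Integration.integrable_bound)
  show "integrable \<mu> (\<lambda>x. \<beta> *\<^sub>R g x)" using assms by simp
  show "AE x in \<mu>. norm (a x *\<^sub>R g x) \<le> norm (\<beta> *\<^sub>R g x)"
    using a_bounds by eventually_elim (use \<alpha>_pos in \<open>auto intro!: mult_right_mono\<close>)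
qed (use assms in measurable)

lemma integrable_coeff_real: "integrable \<mu> g \<Longrightarrow> integrable \<mu> (\<lambda>x. a x * g x :: real)"
  using integrable_coeff[of g] by simp

lemma integrable_mult_test:
  assumes "integrable \<mu> h" "\<psi> \<in> test_functions \<Omega>"
  shows "integrable \<mu> (\<lambda>x. h x * \<psi> x)"
proof -
  obtain R where R: "R > 0" "\<And>x. \<bar>\<psi> x\<bar> \<le> R" using test_bounded[OF assms(2)] by metis
  note [measurable] = test_measurable[OF assms(2)]
  show ?thesis
  proof (rule Bochner_Integration.integrable_bound)
    show "integrable \<mu> (\<lambda>x. R * h x)" using assms by simp
    show "AE x in \<mu>. norm (h x * \<psi> x) \<le> norm (R * h x)"
      using R by (auto simp: abs_mult mult.commute intro!: mult_right_mono)
  qed (use assms in measurable)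
qed

lemma integrable_inner_test:
  assumes "integrable \<mu> g" "\<psi> \<in> test_functions \<Omega>"
  shows "integrable \<mu> (\<lambda>x. g x \<bullet> grad \<psi> x)"
proof -
  obtain R where R: "R > 0" "\<And>x. norm (grad \<psi> x) \<le> R" using test_bounded[OF assms(2)] by metis
  note [measurable] = test_measurable[OF assms(2)]
  show ?thesis
  proof (rule Bochner_Integration.integrable_bound)
    show "integrable \<mu> (\<lambda>x. R * norm (g x))" using assms by simp
    show "AE x in \<mu>. norm (g x \<bullet> grad \<psi> x) \<le> norm (R * norm (g x))"
    proof (intro AE_I2)
      fix x
      have "\<bar>g x \<bullet> grad \<psi> x\<bar> \<le> norm (g x) * norm (grad \<psi> x)" by (rule Cauchy_Schwarz_ineq2)
      also have "\<dots> \<le> norm (g x) * R" using R by (intro mult_left_mono) auto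
      finally show "norm (g x \<bullet> grad \<psi> x) \<le> norm (R * norm (g x))"
        using R by (simp add: mult.commute)
    qed
  qed (use assms in measurable)
qed

definition residual :: "('a \<Rightarrow> real) \<Rightarrow> ('a \<Rightarrow> real) \<Rightarrow> ('a \<Rightarrow> real) \<Rightarrow> real" where
  "residual h \<phi> \<psi> = (\<integral>x. a x * (grad \<phi> x \<bullet> grad \<psi> x) \<partial>\<mu>) - (\<integral>x. h x * \<psi> x \<partial>\<mu>)"

text \<open>The residual, as a functional of \<psi>, has norm at most the root of \<eta> with
  respect to the L^2 norm of the gradient. An exact weak solution would in general leave the test
  functions; tolerating this error keeps all computations among smooth functions.\<close>

definition approx_sol :: "('a \<Rightarrow> real) \<Rightarrow> real \<Rightarrow> ('a \<Rightarrow> real) \<Rightarrow> bool" where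
  "approx_sol h \<eta> \<phi> \<longleftrightarrow> \<phi> \<in> test_functions \<Omega> \<and>
    (\<forall>\<psi>\<in>test_functions \<Omega>. (residual h \<phi> \<psi>)\<^sup>2 \<le> \<eta> * (\<integral>x. (norm (grad \<psi> x))\<^sup>2 \<partial>\<mu>))"

lemma integrable_coeff_inner:
  assumes "\<phi> \<in> test_functions \<Omega>" "\<psi> \<in> test_functions \<Omega>"
  shows "integrable \<mu> (\<lambda>x. a x * (grad \<phi> x \<bullet> grad \<psi> x))"
  by (intro integrable_coeff_real integrable_inner_test test_integrable assms)

text \<open>The Poincare inequality and completion of the square bound the energy \<open>J\<close>
  below. If \<phi> is within \<delta> of the infimum, moving by t \<psi> gives -\<delta> \<le> t L +
  t^2 A / 2 for all t, and t = - L / A turns this into L^2 \<le> 2 \<delta> A.\<close>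

lemma ex_approx_sol:
  assumes h [measurable]: "h \<in> borel_measurable \<mu>" and K: "\<And>x. \<bar>h x\<bar> \<le> K" and \<eta>: "\<eta> > 0"
  shows "\<exists>\<phi>. approx_sol h \<eta> \<phi>"
proof -
  let ?T = "test_functions \<Omega>"
  define J where "J \<phi> = (1/2) * (\<integral>x. a x * (grad \<phi> x \<bullet> grad \<phi> x) \<partial>\<mu>) - (\<integral>x. h x * \<phi> x \<partial>\<mu>)" for \<phi>
  have ih: "integrable \<mu> h" using K by (auto intro!: integrable_bounded[where B=K])
  have K0: "K \<ge> 0" using K[of 0] by linarith
  define C where "C = K * (measure \<mu> \<Omega> + 1)"
  have lower: "J \<phi> \<ge> - (C\<^sup>2 / (2 * \<alpha>) * measure \<mu> \<Omega>)" if \<phi>: "\<phi> \<in> ?T" for \<phi>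
  proof -
    have "(\<integral>x. h x * \<phi> x \<partial>\<mu>) \<le> (\<integral>x. K * \<bar>\<phi> x\<bar> \<partial>\<mu>)"
    proof (rule integral_mono)
      show "h x * \<phi> x \<le> K * \<bar>\<phi> x\<bar>" for x
        using mult_right_mono[OF K[of x], of "\<bar>\<phi> x\<bar>"] abs_ge_self[of "h x * \<phi> x"] by (simp add: abs_mult)
    qed (use integrable_mult_test[OF ih \<phi>] test_integrable[OF \<phi>] in auto)
    also have "\<dots> \<le> K * ((measure \<mu> \<Omega> + 1) * (\<integral>x. norm (grad \<phi> x) \<partial>\<mu>))"
      using mult_left_mono[OF Poincare_test[OF \<phi>] K0] by simp
    also have "\<dots> = (\<integral>x. C * norm (grad \<phi> x) \<partial>\<mu>)" by (simp add: C_def)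
    also have "\<dots> \<le> (\<integral>x. (1/2) * (a x * (grad \<phi> x \<bullet> grad \<phi> x)) + C\<^sup>2 / (2 * \<alpha>) \<partial>\<mu>)"
    proof (rule integral_mono_AE)
      show "AE x in \<mu>. C * norm (grad \<phi> x) \<le> (1/2) * (a x * (grad \<phi> x \<bullet> grad \<phi> x)) + C\<^sup>2 / (2 * \<alpha>)"
        using a_bounds
      proof eventually_elim
        case (elim x)
        let ?g = "norm (grad \<phi> x)"
        have "0 \<le> (\<alpha> * ?g - C)\<^sup>2 / (2 * \<alpha>)" using \<alpha>_pos by simp
        also have "\<dots> = (1/2) * (\<alpha> * ?g\<^sup>2) + C\<^sup>2 / (2 * \<alpha>) - C * ?g"
          using \<alpha>_pos by (simp add: field_simps power2_eq_square)
        also have "\<dots> \<le> (1/2) * (a x * ?g\<^sup>2) + C\<^sup>2 / (2 * \<alpha>) - C * ?g"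
          using elim by (simp add: mult_right_mono)
        finally show ?case by (simp add: power2_norm_eq_inner)
      qed
    qed (use test_integrable[OF \<phi>] integrable_coeff_inner[OF \<phi> \<phi>] in auto)
    also have "\<dots> = (1/2) * (\<integral>x. a x * (grad \<phi> x \<bullet> grad \<phi> x) \<partial>\<mu>) + C\<^sup>2 / (2 * \<alpha>) * measure \<mu> \<Omega>"
      using integrable_coeff_inner[OF \<phi> \<phi>] by simp
    finally show ?thesis unfolding J_def by simp
  qed
  have expand: "J (\<lambda>x. \<phi> x + t * \<psi> x) = J \<phi> + t * residual h \<phi> \<psi>
      + t\<^sup>2 / 2 * (\<integral>x. a x * (grad \<psi> x \<bullet> grad \<psi> x) \<partial>\<mu>)"
    if \<phi>: "\<phi> \<in> ?T" and \<psi>: "\<psi> \<in> ?T" for \<phi> \<psi> t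
  proof -
    note d = test_functions_differentiable[OF \<phi>] test_functions_differentiable[OF \<psi>]
      test_functions_differentiable[OF test_functions_cmult[OF \<psi>]]
    have g: "grad (\<lambda>x. \<phi> x + t * \<psi> x) x = grad \<phi> x + t *\<^sub>R grad \<psi> x" for x
      using grad_add[OF d(1,3)] grad_cmult[OF d(2)] by simp
    note i = integrable_coeff_inner[OF \<phi> \<phi>] integrable_coeff_inner[OF \<phi> \<psi>] integrable_coeff_inner[OF \<psi> \<psi>]
    have "(\<integral>x. a x * (grad (\<lambda>x. \<phi> x + t * \<psi> x) x \<bullet> grad (\<lambda>x. \<phi> x + t * \<psi> x) x) \<partial>\<mu>) =
      (\<integral>x. a x * (grad \<phi> x \<bullet> grad \<phi> x) + 2 * t * (a x * (grad \<phi> x \<bullet> grad \<psi> x))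
        + t\<^sup>2 * (a x * (grad \<psi> x \<bullet> grad \<psi> x)) \<partial>\<mu>)"
      unfolding g by (intro Bochner_Integration.integral_cong refl)
        (simp add: inner_add_left inner_add_right inner_commute algebra_simps power2_eq_square)
    also have "\<dots> = (\<integral>x. a x * (grad \<phi> x \<bullet> grad \<phi> x) \<partial>\<mu>) + 2 * t * (\<integral>x. a x * (grad \<phi> x \<bullet> grad \<psi> x) \<partial>\<mu>)
        + t\<^sup>2 * (\<integral>x. a x * (grad \<psi> x \<bullet> grad \<psi> x) \<partial>\<mu>)"
      using i by simp
    finally have e1: "(\<integral>x. a x * (grad (\<lambda>x. \<phi> x + t * \<psi> x) x \<bullet> grad (\<lambda>x. \<phi> x + t * \<psi> x) x) \<partial>\<mu>) = \<dots>" .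
    have e2: "(\<integral>x. h x * (\<phi> x + t * \<psi> x) \<partial>\<mu>) = (\<integral>x. h x * \<phi> x \<partial>\<mu>) + t * (\<integral>x. h x * \<psi> x \<partial>\<mu>)"
    proof -
      have "(\<integral>x. h x * (\<phi> x + t * \<psi> x) \<partial>\<mu>) = (\<integral>x. h x * \<phi> x + t * (h x * \<psi> x) \<partial>\<mu>)"
        by (intro Bochner_Integration.integral_cong refl) (simp add: algebra_simps)
      then show ?thesis using integrable_mult_test[OF ih \<phi>] integrable_mult_test[OF ih \<psi>] by simp
    qed
    show ?thesis unfolding J_def e1 e2 residual_def by (simp add: algebra_simps)
  qed
  \<comment> \<open>Chosen so that 2 \<delta> A is \<eta> times the squared L^2 norm of the
    gradient, the factor \<beta> in \<open>A\<close> cancelling.\<close>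
  define \<delta> where "\<delta> = \<eta> / (2 * \<beta>)"
  have \<delta>: "\<delta> > 0" using \<eta> \<beta>_pos by (simp add: \<delta>_def)
  have bdd: "bdd_below (J ` ?T)" using lower by (auto intro!: bdd_belowI2)
  have ne: "J ` ?T \<noteq> {}" using test_functions_0 by auto
  obtain \<phi> where \<phi>: "\<phi> \<in> ?T" "J \<phi> < Inf (J ` ?T) + \<delta>"
    using cInf_lessD[OF ne, of "Inf (J ` ?T) + \<delta>"] \<delta> by auto
  have "(residual h \<phi> \<psi>)\<^sup>2 \<le> \<eta> * (\<integral>x. (norm (grad \<psi> x))\<^sup>2 \<partial>\<mu>)" if \<psi>: "\<psi> \<in> ?T" for \<psi>
  proof -
    define L where "L = residual h \<phi> \<psi>"
    define A where "A = \<beta> * (\<integral>x. (norm (grad \<psi> x))\<^sup>2 \<partial>\<mu>)"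
    have A0: "A \<ge> 0" unfolding A_def using \<beta>_pos by (intro mult_nonneg_nonneg integral_nonneg_AE) auto
    have A: "(\<integral>x. a x * (grad \<psi> x \<bullet> grad \<psi> x) \<partial>\<mu>) \<le> A"
    proof -
      have "(\<integral>x. a x * (grad \<psi> x \<bullet> grad \<psi> x) \<partial>\<mu>) \<le> (\<integral>x. \<beta> * (norm (grad \<psi> x))\<^sup>2 \<partial>\<mu>)"
      proof (rule integral_mono_AE)
        show "AE x in \<mu>. a x * (grad \<psi> x \<bullet> grad \<psi> x) \<le> \<beta> * (norm (grad \<psi> x))\<^sup>2"
          using a_bounds by eventually_elim (auto simp: power2_norm_eq_inner intro!: mult_right_mono)
      qed (use test_integrable[OF \<psi>] integrable_coeff_inner[OF \<psi> \<psi>] in auto)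
      then show ?thesis by (simp add: A_def)
    qed
    have q: "- \<delta> \<le> t * L + t\<^sup>2 / 2 * A" for t
    proof -
      have "(\<lambda>x. \<phi> x + t * \<psi> x) \<in> ?T" by (intro test_functions_add test_functions_cmult \<phi> \<psi>)
      then have "Inf (J ` ?T) \<le> J (\<lambda>x. \<phi> x + t * \<psi> x)" using bdd by (intro cInf_lower) auto
      then have "- \<delta> \<le> t * L + t\<^sup>2 / 2 * (\<integral>x. a x * (grad \<psi> x \<bullet> grad \<psi> x) \<partial>\<mu>)"
        using \<phi>(2) expand[OF \<phi>(1) \<psi>, of t] by (simp add: L_def)
      also have "\<dots> \<le> t * L + t\<^sup>2 / 2 * A" using A by (intro add_left_mono mult_left_mono) auto
      finally show ?thesis .
    qed
    have "L\<^sup>2 \<le> 2 * \<delta> * A"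
    proof (cases "A = 0")
      case True
      have "L = 0"
      proof (rule ccontr)
        assume "L \<noteq> 0"
        \<comment> \<open>Without a quadratic term the bound is linear in t, and this t brings it to
          -2 \<delta>, below the permitted -\<delta>.\<close>
        then show False using q[of "- (2 * \<delta>) / L"] True \<delta> by simp
      qed
      then show ?thesis using True by simp
    next
      case False
      then have "A > 0" using A0 by simp
      have "- \<delta> \<le> - (L\<^sup>2 / (2 * A))"
        using q[of "- L / A"] \<open>A > 0\<close> by (simp add: power2_eq_square field_simps)
      then show ?thesis using \<open>A > 0\<close> by (simp add: field_simps)
    qed
    then show ?thesis using \<beta>_pos by (simp add: L_def A_def \<delta>_def)
  qed
  then show ?thesis using \<phi>(1) unfolding approx_sol_def by blast
qed

text \<open>Linearity of the residual. The factor 2 comes from (x - y)^2 \<le> 2 x^2 + 2 y^2, and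
  the free scale t serves to normalise a small difference to unit size.\<close>

lemma approx_sol_diff:
  assumes 1: "approx_sol h1 \<eta>1 \<phi>1" "integrable \<mu> h1" and 2: "approx_sol h2 \<eta>2 \<phi>2" "integrable \<mu> h2"
  shows "approx_sol (\<lambda>x. t * (h1 x - h2 x)) (t\<^sup>2 * (2 * (\<eta>1 + \<eta>2))) (\<lambda>x. t * (\<phi>1 x + (-1) * \<phi>2 x))"
  unfolding approx_sol_def
proof (intro conjI ballI)
  note T = 1(1)[unfolded approx_sol_def] 2(1)[unfolded approx_sol_def]
  have T1: "\<phi>1 \<in> test_functions \<Omega>" and T2: "\<phi>2 \<in> test_functions \<Omega>"
    using T by auto
  show "(\<lambda>x. t * (\<phi>1 x + (-1) * \<phi>2 x)) \<in> test_functions \<Omega>"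
    by (intro test_functions_add test_functions_cmult T1 T2)
  fix \<psi> assume \<psi>: "\<psi> \<in> test_functions \<Omega>"
  note d = test_functions_differentiable[OF T1] test_functions_differentiable[OF test_functions_cmult[OF T2]]
    test_functions_differentiable[OF T2] test_functions_differentiable[OF test_functions_add[OF T1 test_functions_cmult[OF T2]]]
  have g: "grad (\<lambda>x. t * (\<phi>1 x + (-1) * \<phi>2 x)) x = t *\<^sub>R (grad \<phi>1 x - grad \<phi>2 x)" for x
    unfolding grad_cmult[OF d(4)] grad_add[OF d(1) d(2)] grad_cmult[OF d(3)] by simp
  have "residual (\<lambda>x. t * (h1 x - h2 x)) (\<lambda>x. t * (\<phi>1 x + (-1) * \<phi>2 x)) \<psi>
      = t * (residual h1 \<phi>1 \<psi> - residual h2 \<phi>2 \<psi>)"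
  proof -
    have "(\<integral>x. a x * (grad (\<lambda>x. t * (\<phi>1 x + (-1) * \<phi>2 x)) x \<bullet> grad \<psi> x) \<partial>\<mu>) =
      (\<integral>x. t * (a x * (grad \<phi>1 x \<bullet> grad \<psi> x) - a x * (grad \<phi>2 x \<bullet> grad \<psi> x)) \<partial>\<mu>)"
      unfolding g by (intro Bochner_Integration.integral_cong refl) (simp add: inner_diff_left algebra_simps)
    moreover have "(\<integral>x. t * (h1 x - h2 x) * \<psi> x \<partial>\<mu>) = (\<integral>x. t * (h1 x * \<psi> x - h2 x * \<psi> x) \<partial>\<mu>)"
      by (intro Bochner_Integration.integral_cong refl) (simp add: algebra_simps)
    ultimately show ?thesis
      unfolding residual_def using integrable_coeff_inner[OF T1 \<psi>] integrable_coeff_inner[OF T2 \<psi>]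
        integrable_mult_test[OF 1(2) \<psi>] integrable_mult_test[OF 2(2) \<psi>]
      by (simp add: algebra_simps)
  qed
  moreover have "(residual h1 \<phi>1 \<psi> - residual h2 \<phi>2 \<psi>)\<^sup>2
      \<le> 2 * (residual h1 \<phi>1 \<psi>)\<^sup>2 + 2 * (residual h2 \<phi>2 \<psi>)\<^sup>2"
    using sum_squares_bound[of "residual h1 \<phi>1 \<psi>" "- residual h2 \<phi>2 \<psi>"] by (simp add: power2_diff)
  moreover have "(residual h1 \<phi>1 \<psi>)\<^sup>2 \<le> \<eta>1 * (\<integral>x. (norm (grad \<psi> x))\<^sup>2 \<partial>\<mu>)"
    "(residual h2 \<phi>2 \<psi>)\<^sup>2 \<le> \<eta>2 * (\<integral>x. (norm (grad \<psi> x))\<^sup>2 \<partial>\<mu>)" using T \<psi> by auto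
  ultimately have "(residual (\<lambda>x. t * (h1 x - h2 x)) (\<lambda>x. t * (\<phi>1 x + (-1) * \<phi>2 x)) \<psi>)\<^sup>2
     \<le> t\<^sup>2 * (2 * (\<eta>1 * (\<integral>x. (norm (grad \<psi> x))\<^sup>2 \<partial>\<mu>)) + 2 * (\<eta>2 * (\<integral>x. (norm (grad \<psi> x))\<^sup>2 \<partial>\<mu>)))"
    by (simp add: power_mult_distrib mult_left_mono)
  then show "(residual (\<lambda>x. t * (h1 x - h2 x)) (\<lambda>x. t * (\<phi>1 x + (-1) * \<phi>2 x)) \<psi>)\<^sup>2
     \<le> t\<^sup>2 * (2 * (\<eta>1 + \<eta>2)) * (\<integral>x. (norm (grad \<psi> x))\<^sup>2 \<partial>\<mu>)"
    by (simp add: algebra_simps)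
qed

text \<open>The weak equation tested with F(\<phi>), which is only C^1. The polynomial
  approximations of F(\<phi>) and of its gradient are uniformly bounded and converge pointwise, so
  dominated convergence handles the principal term, the data term and the error term
  separately.\<close>

lemma approx_sol_compose:
  fixes F F' :: "real \<Rightarrow> real"
  assumes sol: "approx_sol h \<eta> \<phi>" and h: "integrable \<mu> h"
    and F: "\<And>s. (F has_real_derivative F' s) (at s)" "continuous_on UNIV F'" "F 0 = 0"
  shows "((\<integral>x. a x * (F' (\<phi> x) * (norm (grad \<phi> x))\<^sup>2) \<partial>\<mu>) - (\<integral>x. h x * F (\<phi> x) \<partial>\<mu>))\<^sup>2
    \<le> \<eta> * (\<integral>x. (F' (\<phi> x) * norm (grad \<phi> x))\<^sup>2 \<partial>\<mu>)"
proof -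
  have \<phi>: "\<phi> \<in> test_functions \<Omega>" using sol by (simp add: approx_sol_def)
  have "\<exists>\<psi>\<in>test_functions \<Omega>. (\<forall>x. \<bar>\<psi> x - F (\<phi> x)\<bar> \<le> 1 / real (Suc n)) \<and>
      (\<forall>x. norm (grad \<psi> x - F' (\<phi> x) *\<^sub>R grad \<phi> x) \<le> 1 / real (Suc n) * norm (grad \<phi> x))" for n
    using test_functions_compose_approx[OF bounded_domain \<phi> F, of "1 / real (Suc n)"] by (metis of_nat_0_less_iff zero_less_Suc zero_less_divide_1_iff)
  then obtain \<psi> where \<psi>: "\<And>n. \<psi> n \<in> test_functions \<Omega>"
    and \<psi>1: "\<And>n x. \<bar>\<psi> n x - F (\<phi> x)\<bar> \<le> 1 / real (Suc n)"
    and \<psi>2: "\<And>n x. norm (grad (\<psi> n) x - F' (\<phi> x) *\<^sub>R grad \<phi> x) \<le> 1 / real (Suc n) * norm (grad \<phi> x)"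
    by metis
  have cF: "continuous_on UNIV F" using F(1) by (meson DERIV_continuous_on has_field_derivative_at_within)
  obtain B where B: "B > 0" "\<And>x. \<bar>F (\<phi> x)\<bar> \<le> B" using compose_bounded[OF \<phi> cF] by metis
  obtain B' where B': "B' > 0" "\<And>x. \<bar>F' (\<phi> x)\<bar> \<le> B'" using compose_bounded[OF \<phi> F(2)] by metis
  obtain R where R: "R > 0" "\<And>x. norm (grad \<phi> x) \<le> R" using test_bounded[OF \<phi>] by metis
  note [measurable] = test_measurable[OF \<phi>] test_measurable[OF \<psi>]
    measurable_cont_compose[OF cF test_measurable(1)[OF \<phi>]]
    measurable_cont_compose[OF F(2) test_measurable(1)[OF \<phi>]]
  have z: "(\<lambda>n. 1 / real (Suc n)) \<longlonglongrightarrow> 0" by (rule lim_1_over_n[THEN LIMSEQ_Suc])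
  have l1: "(\<lambda>n. \<psi> n x) \<longlonglongrightarrow> F (\<phi> x)" for x
    by (rule LIM_zero_cancel, rule Lim_null_comparison[OF _ z])
      (use \<psi>1 in \<open>simp del: of_nat_Suc\<close>)
  have l2: "(\<lambda>n. grad (\<psi> n) x) \<longlonglongrightarrow> F' (\<phi> x) *\<^sub>R grad \<phi> x" for x
  proof (rule LIM_zero_cancel, rule Lim_null_comparison)
    show "(\<lambda>n. 1 / real (Suc n) * norm (grad \<phi> x)) \<longlonglongrightarrow> 0" by (rule tendsto_mult_left_zero[OF z])
  qed (use \<psi>2 in \<open>simp del: of_nat_Suc\<close>)
  have b1: "\<bar>\<psi> n x\<bar> \<le> B + 1" for n x
  proof -
    have "1 / real (Suc n) \<le> 1" by simp
    then show ?thesis using \<psi>1[of n x] B(2)[of x] by linarith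
  qed
  have b2: "norm (grad (\<psi> n) x) \<le> (B' + 1) * R" for n x
  proof -
    have "norm (grad (\<psi> n) x) \<le> norm (F' (\<phi> x) *\<^sub>R grad \<phi> x) + 1 / real (Suc n) * norm (grad \<phi> x)"
      using \<psi>2[of n x] norm_triangle_sub[of "grad (\<psi> n) x" "F' (\<phi> x) *\<^sub>R grad \<phi> x"] by linarith
    also have "\<dots> \<le> B' * R + 1 * R"
      using B' R by (intro add_mono mult_mono) (auto intro!: mult_mono simp: less_imp_le)
    finally show ?thesis by (simp add: algebra_simps)
  qed
  have 1: "(\<lambda>n. \<integral>x. a x * (grad \<phi> x \<bullet> grad (\<psi> n) x) \<partial>\<mu>) \<longlonglongrightarrow> (\<integral>x. a x * (grad \<phi> x \<bullet> (F' (\<phi> x) *\<^sub>R grad \<phi> x)) \<partial>\<mu>)"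
  proof (rule integral_dominated_convergence[where w="\<lambda>_. \<beta> * (R * ((B' + 1) * R))"])
    show "AE x in \<mu>. (\<lambda>n. a x * (grad \<phi> x \<bullet> grad (\<psi> n) x)) \<longlonglongrightarrow> a x * (grad \<phi> x \<bullet> (F' (\<phi> x) *\<^sub>R grad \<phi> x))"
      by (intro AE_I2 tendsto_intros l2)
    show "AE x in \<mu>. norm (a x * (grad \<phi> x \<bullet> grad (\<psi> n) x)) \<le> \<beta> * (R * ((B' + 1) * R))" for n
      using a_bounds
    proof eventually_elim
      case (elim x)
      have "\<bar>grad \<phi> x \<bullet> grad (\<psi> n) x\<bar> \<le> norm (grad \<phi> x) * norm (grad (\<psi> n) x)" by (rule Cauchy_Schwarz_ineq2)
      also have "\<dots> \<le> R * ((B' + 1) * R)" using R b2 by (intro mult_mono) auto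
      finally show ?case using elim \<alpha>_pos \<beta>_pos by (auto simp: abs_mult intro!: mult_mono)
    qed
  qed auto
  have 2: "(\<lambda>n. \<integral>x. h x * \<psi> n x \<partial>\<mu>) \<longlonglongrightarrow> (\<integral>x. h x * F (\<phi> x) \<partial>\<mu>)"
  proof (rule integral_dominated_convergence[where w="\<lambda>x. \<bar>h x\<bar> * (B + 1)"])
    show "AE x in \<mu>. (\<lambda>n. h x * \<psi> n x) \<longlonglongrightarrow> h x * F (\<phi> x)"
      by (intro AE_I2 tendsto_intros l1)
    show "AE x in \<mu>. norm (h x * \<psi> n x) \<le> \<bar>h x\<bar> * (B + 1)" for n
      using b1 by (auto simp: abs_mult intro!: mult_left_mono)
  qed (use h in auto)
  have 3: "(\<lambda>n. \<integral>x. (norm (grad (\<psi> n) x))\<^sup>2 \<partial>\<mu>) \<longlonglongrightarrow> (\<integral>x. (norm (F' (\<phi> x) *\<^sub>R grad \<phi> x))\<^sup>2 \<partial>\<mu>)"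
  proof (rule integral_dominated_convergence[where w="\<lambda>_. ((B' + 1) * R)\<^sup>2"])
    show "AE x in \<mu>. (\<lambda>n. (norm (grad (\<psi> n) x))\<^sup>2) \<longlonglongrightarrow> (norm (F' (\<phi> x) *\<^sub>R grad \<phi> x))\<^sup>2"
      by (intro AE_I2 tendsto_intros l2)
    show "AE x in \<mu>. norm ((norm (grad (\<psi> n) x))\<^sup>2) \<le> ((B' + 1) * R)\<^sup>2" for n
      using b2 by (auto intro!: power_mono)
  qed auto
  have "((\<integral>x. a x * (grad \<phi> x \<bullet> (F' (\<phi> x) *\<^sub>R grad \<phi> x)) \<partial>\<mu>) - (\<integral>x. h x * F (\<phi> x) \<partial>\<mu>))\<^sup>2
    \<le> \<eta> * (\<integral>x. (norm (F' (\<phi> x) *\<^sub>R grad \<phi> x))\<^sup>2 \<partial>\<mu>)"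
  proof (rule LIMSEQ_le)
    show "(\<lambda>n. ((\<integral>x. a x * (grad \<phi> x \<bullet> grad (\<psi> n) x) \<partial>\<mu>) - (\<integral>x. h x * \<psi> n x \<partial>\<mu>))\<^sup>2) \<longlonglongrightarrow>
      ((\<integral>x. a x * (grad \<phi> x \<bullet> (F' (\<phi> x) *\<^sub>R grad \<phi> x)) \<partial>\<mu>) - (\<integral>x. h x * F (\<phi> x) \<partial>\<mu>))\<^sup>2"
      by (intro tendsto_intros 1 2)
    show "(\<lambda>n. \<eta> * (\<integral>x. (norm (grad (\<psi> n) x))\<^sup>2 \<partial>\<mu>)) \<longlonglongrightarrow>
      \<eta> * (\<integral>x. (norm (F' (\<phi> x) *\<^sub>R grad \<phi> x))\<^sup>2 \<partial>\<mu>)"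
      by (intro tendsto_intros 3)
  qed (use sol \<psi> in \<open>auto simp: approx_sol_def residual_def\<close>)
  then show ?thesis by (simp add: power2_norm_eq_inner power_mult_distrib)
qed

end

section \<open>A priori estimates\<close>

text \<open>A power q < 1 of the unknown on the right can be divided away. Working with 1 + U keeps
  the base at least 1, so the case of small U needs no separate treatment.\<close>

lemma sublinear_bound:
  fixes C q U :: real
  assumes "U \<ge> 0" "C \<ge> 0" "q < 1" "U \<le> C * (1 + U) powr q" "0 \<le> q"
  shows "1 + U \<le> (1 + C) powr (1 / (1 - q))"
proof -
  have "1 \<le> (1 + U) powr q" using assms by (intro ge_one_powr_ge_zero) auto
  then have "1 + U \<le> (1 + C) * (1 + U) powr q" using assms by (simp add: algebra_simps)
  then have "(1 + U) powr (1 - q) \<le> 1 + C"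
    using assms by (simp add: powr_diff field_simps)
  then have "((1 + U) powr (1 - q)) powr (1 / (1 - q)) \<le> (1 + C) powr (1 / (1 - q))"
    using assms by (intro powr_mono2) auto
  then show ?thesis using assms by (simp add: powr_powr)
qed

lemma one_plus_powr_le:
  fixes s p :: real
  assumes "s \<ge> 0" "p \<ge> 0"
  shows "(1 + s) powr p \<le> 2 powr p * (1 + s powr p)"
proof (cases "s \<le> 1")
  case True
  have "(1 + s) powr p \<le> 2 powr p" using assms True by (intro powr_mono2) auto
  also have "\<dots> \<le> 2 powr p * (1 + s powr p)" by simp
  finally show ?thesis .
next
  case False
  have "(1 + s) powr p \<le> (2 * s) powr p" using assms False by (intro powr_mono2) auto
  also have "\<dots> = 2 powr p * s powr p" using assms by (simp add: powr_mult)
  also have "\<dots> \<le> 2 powr p * (1 + s powr p)" by simp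
  finally show ?thesis .
qed

text \<open>A pointwise substitute for the Cauchy--Schwarz inequality of integrals: the weight
  \<open>K\<close> stays free and is fixed after integration.\<close>

lemma mult_le_weighted_sum:
  fixes u y z K :: real
  assumes "u\<^sup>2 \<le> y * z" "y \<ge> 0" "z \<ge> 0" "K > 0"
  shows "u \<le> (K * z + y / K) / 2"
proof (rule power2_le_imp_le)
  have "0 \<le> ((K * z - y / K) / 2)\<^sup>2" by simp
  also have "\<dots> = ((K * z + y / K) / 2)\<^sup>2 - y * z"
    using assms(4) by (simp add: field_simps power2_eq_square)
  finally show "u\<^sup>2 \<le> ((K * z + y / K) / 2)\<^sup>2" using assms(1) by linarith
qed (use assms in auto)

context elliptic_coefficient
begin

text \<open>One predicate holds the whole implication so that \<open>C\<close> is fixed before the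
  solution and before F and \<Psi>. In particular \<open>C\<close> is independent of the bound
  \<open>S\<close> on \<Psi>', which blows up with the truncation level. The first conclusion
  controls the gradient of F(\<phi>), the second F(\<phi>) itself.\<close>

definition apriori_bound :: "real \<Rightarrow> real \<Rightarrow> real \<Rightarrow> bool" where
  "apriori_bound r M C \<longleftrightarrow> (\<forall>h \<eta> \<phi> S F F' \<Psi> \<Psi>'.
    approx_sol h \<eta> \<phi> \<longrightarrow>
     integrable \<mu> h \<longrightarrow>
     0 \<le> \<eta> \<longrightarrow>
     \<eta> * S \<le> 1 \<longrightarrow>
     (\<forall>s. (F has_real_derivative F' s) (at s)) \<longrightarrow>
     continuous_on UNIV F' \<longrightarrow>
     F 0 = 0 \<longrightarrow>
     (\<forall>s. (\<Psi> has_real_derivative \<Psi>' s) (at s)) \<longrightarrow>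
     continuous_on UNIV \<Psi>' \<longrightarrow>
     \<Psi> 0 = 0 \<longrightarrow>
     (\<forall>s. 0 \<le> F' s) \<longrightarrow>
     (\<forall>s. 0 \<le> \<Psi>' s) \<longrightarrow>
     (\<forall>s. \<Psi>' s \<le> S) \<longrightarrow>
     (\<forall>s. (F' s)\<^sup>2 \<le> (1 + \<bar>F s\<bar>) powr p * \<Psi>' s) \<longrightarrow>
     (\<integral>x. \<bar>h x * \<Psi> (\<phi> x)\<bar> \<partial>\<mu>) \<le> M * (1 + (\<integral>x. (1 + \<bar>F (\<phi> x)\<bar>) powr p \<partial>\<mu>)) powr r \<longrightarrow>
    (\<integral>x. F' (\<phi> x) * norm (grad \<phi> x) \<partial>\<mu>) \<le> C \<and> (\<integral>x. (1 + \<bar>F (\<phi> x)\<bar>) powr p \<partial>\<mu>) \<le> C)"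

lemmas apriori_boundD = apriori_bound_def[THEN iffD1, rule_format]

text \<open>Three estimates are chained: testing with \<Psi>(\<phi>) bounds the energy
  \<open>E\<close> by B^r, the weighted Cauchy--Schwarz inequality bounds \<open>U\<close> by
  B^((1+r)/2), and the Sobolev inequality bounds \<open>B\<close> by (1 + U)^p. Together U is at
  most a constant times (1 + U)^q with q = p (1 + r) / 2 < 1.\<close>

lemma ex_apriori_bound:
  assumes r: "0 \<le> r" "p * (1 + r) < 2" and M: "0 \<le> M"
  shows "\<exists>C. apriori_bound r M C"
proof -
  define C1 where "C1 = 2 * M / \<alpha> + 1 / \<alpha>\<^sup>2"
  define C2 where "C2 = 1 + 2 powr p * (measure \<mu> \<Omega> + 1)"
  define C3 where "C3 = (C1 + 1) / 2 * C2 powr ((1 + r) / 2)"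
  define q where "q = p * (1 + r) / 2"
  define C4 where "C4 = (1 + C3) powr (1 / (1 - q))"
  have C1: "C1 \<ge> 0" and C2: "C2 \<ge> 1" using M \<alpha>_pos unfolding C1_def C2_def by auto
  have C3: "C3 \<ge> 0" using C1 unfolding C3_def by auto
  have q: "0 \<le> q" "q < 1" using r p_bounds unfolding q_def by auto
  have "apriori_bound r M (max C4 (C2 * C4 powr p))"
    unfolding apriori_bound_def
  proof (intro allI impI)
    fix h \<eta> \<phi> S and F F' \<Psi> \<Psi>' :: "real \<Rightarrow> real"
    assume sol: "approx_sol h \<eta> \<phi>" and h: "integrable \<mu> h" and \<eta>: "0 \<le> \<eta>" "\<eta> * S \<le> 1"
      and F_all: "\<forall>s. (F has_real_derivative F' s) (at s)" "continuous_on UNIV F'" "F 0 = 0"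
      and \<Psi>_all: "\<forall>s. (\<Psi> has_real_derivative \<Psi>' s) (at s)" "continuous_on UNIV \<Psi>'" "\<Psi> 0 = 0"
      and all: "\<forall>s. 0 \<le> F' s" "\<forall>s. 0 \<le> \<Psi>' s" "\<forall>s. \<Psi>' s \<le> S"
        "\<forall>s. (F' s)\<^sup>2 \<le> (1 + \<bar>F s\<bar>) powr p * \<Psi>' s"
      and hM: "(\<integral>x. \<bar>h x * \<Psi> (\<phi> x)\<bar> \<partial>\<mu>) \<le> M * (1 + (\<integral>x. (1 + \<bar>F (\<phi> x)\<bar>) powr p \<partial>\<mu>)) powr r"
    note F = F_all(1)[THEN spec] F_all(2,3) and \<Psi> = \<Psi>_all(1)[THEN spec] \<Psi>_all(2,3)
      and F'0 = all(1)[THEN spec] and \<Psi>'0 = all(2)[THEN spec] and \<Psi>'S = all(3)[THEN spec] and F\<Psi> = all(4)[THEN spec]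
    have \<phi>: "\<phi> \<in> test_functions \<Omega>" using sol by (simp add: approx_sol_def)
    define E where "E = (\<integral>x. \<Psi>' (\<phi> x) * (norm (grad \<phi> x))\<^sup>2 \<partial>\<mu>)"
    define U where "U = (\<integral>x. F' (\<phi> x) * norm (grad \<phi> x) \<partial>\<mu>)"
    define B where "B = 1 + (\<integral>x. (1 + \<bar>F (\<phi> x)\<bar>) powr p \<partial>\<mu>)"
    define A where "A = (\<integral>x. \<bar>F (\<phi> x)\<bar> powr p \<partial>\<mu>)"
    have E0: "E \<ge> 0" and U0: "U \<ge> 0" and B1: "B \<ge> 1"
      unfolding E_def U_def B_def using F'0 \<Psi>'0 by (auto intro!: integral_nonneg_AE)
    have cF: "continuous_on UNIV F" "continuous_on UNIV \<Psi>"
      using F(1) \<Psi>(1) by (meson DERIV_continuous_on has_field_derivative_at_within)+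
    obtain bF where bF: "bF > 0" "\<And>x. \<bar>F (\<phi> x)\<bar> \<le> bF" using compose_bounded[OF \<phi> cF(1)] by metis
    obtain bF' where bF': "bF' > 0" "\<And>x. \<bar>F' (\<phi> x)\<bar> \<le> bF'" using compose_bounded[OF \<phi> F(2)] by metis
    obtain bP where bP: "bP > 0" "\<And>x. \<bar>\<Psi> (\<phi> x)\<bar> \<le> bP" using compose_bounded[OF \<phi> cF(2)] by metis
    obtain bP' where bP': "bP' > 0" "\<And>x. \<bar>\<Psi>' (\<phi> x)\<bar> \<le> bP'" using compose_bounded[OF \<phi> \<Psi>(2)] by metis
    obtain R where R: "R > 0" "\<And>x. norm (grad \<phi> x) \<le> R" using test_bounded[OF \<phi>] by metis
    note [measurable] = test_measurable[OF \<phi>]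
      measurable_cont_compose[OF cF(1) test_measurable(1)[OF \<phi>]]
      measurable_cont_compose[OF cF(2) test_measurable(1)[OF \<phi>]]
      measurable_cont_compose[OF F(2) test_measurable(1)[OF \<phi>]]
      measurable_cont_compose[OF \<Psi>(2) test_measurable(1)[OF \<phi>]]
    have iE: "integrable \<mu> (\<lambda>x. \<Psi>' (\<phi> x) * (norm (grad \<phi> x))\<^sup>2)"
      using bP' R by (intro integrable_bounded[where B="bP' * R\<^sup>2"])
        (auto simp: abs_mult less_imp_le intro!: mult_mono power_mono)
    have iE2: "integrable \<mu> (\<lambda>x. (\<Psi>' (\<phi> x) * norm (grad \<phi> x))\<^sup>2)"
      using bP' R by (intro integrable_bounded[where B="(bP' * R)\<^sup>2"])
        (auto simp: abs_mult less_imp_le power_mult_distrib intro!: mult_mono power_mono abs_le_square_iff[THEN iffD1])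
    have iU: "integrable \<mu> (\<lambda>x. F' (\<phi> x) * norm (grad \<phi> x))"
      using bF' R by (intro integrable_bounded[where B="bF' * R"])
        (auto simp: abs_mult less_imp_le intro!: mult_mono)
    have iB: "integrable \<mu> (\<lambda>x. (1 + \<bar>F (\<phi> x)\<bar>) powr p)"
      using bF p_bounds by (intro integrable_bounded[where B="(1 + bF) powr p"]) (auto intro!: powr_mono2)
    have iA: "integrable \<mu> (\<lambda>x. \<bar>F (\<phi> x)\<bar> powr p)"
      using bF p_bounds by (intro integrable_bounded[where B="bF powr p"]) (auto intro!: powr_mono2)
    have ih: "integrable \<mu> (\<lambda>x. h x * \<Psi> (\<phi> x))"
    proof (rule Bochner_Integration.integrable_bound)
      show "integrable \<mu> (\<lambda>x. bP * h x)" using h by simp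
      show "AE x in \<mu>. norm (h x * \<Psi> (\<phi> x)) \<le> norm (bP * h x)"
        using bP by (intro AE_I2) (simp add: abs_mult mult.commute[of "\<bar>h _\<bar>"] mult_right_mono)
    qed (use h in measurable)
    define X where "X = (\<integral>x. a x * (\<Psi>' (\<phi> x) * (norm (grad \<phi> x))\<^sup>2) \<partial>\<mu>)"
    define Y where "Y = (\<integral>x. h x * \<Psi> (\<phi> x) \<partial>\<mu>)"
    have EX: "\<alpha> * E \<le> X"
    proof -
      have "(\<integral>x. \<alpha> * (\<Psi>' (\<phi> x) * (norm (grad \<phi> x))\<^sup>2) \<partial>\<mu>) \<le> X" unfolding X_def
      proof (rule integral_mono_AE)
        show "AE x in \<mu>. \<alpha> * (\<Psi>' (\<phi> x) * (norm (grad \<phi> x))\<^sup>2) \<le> a x * (\<Psi>' (\<phi> x) * (norm (grad \<phi> x))\<^sup>2)"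
          using a_bounds by eventually_elim (use \<Psi>'0 in \<open>auto intro!: mult_right_mono\<close>)
      qed (use iE integrable_coeff_real[OF iE] in auto)
      then show ?thesis by (simp add: E_def)
    qed
    \<comment> \<open>One factor \<Psi>' is estimated by \<open>S\<close>, the other stays in the
      energy; \<eta> S \<le> 1 then bounds the whole error term by \<open>E\<close>.\<close>
    have "(\<integral>x. (\<Psi>' (\<phi> x) * norm (grad \<phi> x))\<^sup>2 \<partial>\<mu>) \<le> (\<integral>x. S * (\<Psi>' (\<phi> x) * (norm (grad \<phi> x))\<^sup>2) \<partial>\<mu>)"
    proof (rule integral_mono)
      show "(\<Psi>' (\<phi> x) * norm (grad \<phi> x))\<^sup>2 \<le> S * (\<Psi>' (\<phi> x) * (norm (grad \<phi> x))\<^sup>2)" for x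
        using mult_right_mono[OF \<Psi>'S[of "\<phi> x"], of "\<Psi>' (\<phi> x) * (norm (grad \<phi> x))\<^sup>2"] \<Psi>'0[of "\<phi> x"]
        by (simp add: power2_eq_square mult_ac)
    qed (use iE iE2 in auto)
    then have "\<eta> * (\<integral>x. (\<Psi>' (\<phi> x) * norm (grad \<phi> x))\<^sup>2 \<partial>\<mu>) \<le> \<eta> * (S * E)"
      using \<eta> by (intro mult_left_mono) (auto simp: E_def)
    also have "\<dots> \<le> 1 * E" using mult_right_mono[OF \<eta>(2) E0] by simp
    finally have "(X - Y)\<^sup>2 \<le> E"
      using approx_sol_compose[OF sol h \<Psi>] by (simp add: X_def Y_def)
    \<comment> \<open>The weight \<alpha> leaves only half of \<alpha> E on the right, which is
      absorbed because X is at least \<alpha> E.\<close>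
    then have "X - Y \<le> (\<alpha> * E + 1 / \<alpha>) / 2"
      using mult_le_weighted_sum[of "X - Y" 1 E \<alpha>] E0 \<alpha>_pos by simp
    then have "\<alpha> * E \<le> 2 * Y + 1 / \<alpha>" using EX by (simp add: field_simps)
    then have "E \<le> 2 * Y / \<alpha> + 1 / \<alpha>\<^sup>2" using \<alpha>_pos by (simp add: field_simps power2_eq_square)
    also have "Y \<le> M * B powr r"
      using order_trans[OF integral_mono[OF ih integrable_abs[OF ih] abs_ge_self] hM] by (simp add: Y_def B_def)
    then have "2 * Y / \<alpha> + 1 / \<alpha>\<^sup>2 \<le> 2 * (M * B powr r) / \<alpha> + 1 / \<alpha>\<^sup>2 * B powr r"
      using \<alpha>_pos B1 r by (intro add_mono divide_right_mono mult_left_mono) (auto simp: field_simps ge_one_powr_ge_zero)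
    also have "\<dots> = C1 * B powr r" by (simp add: C1_def algebra_simps)
    finally have E_le: "E \<le> C1 * B powr r" .
    \<comment> \<open>This weight balances the two terms: both K B^r and B / K equal
      B^((1+r)/2).\<close>
    define K where "K = B powr ((1 - r) / 2)"
    have K: "K > 0" using B1 by (simp add: K_def)
    have "U \<le> (\<integral>x. (K * (\<Psi>' (\<phi> x) * (norm (grad \<phi> x))\<^sup>2) + (1 + \<bar>F (\<phi> x)\<bar>) powr p / K) / 2 \<partial>\<mu>)"
      unfolding U_def
    proof (rule integral_mono)
      fix x
      have "(F' (\<phi> x) * norm (grad \<phi> x))\<^sup>2 \<le> (1 + \<bar>F (\<phi> x)\<bar>) powr p * (\<Psi>' (\<phi> x) * (norm (grad \<phi> x))\<^sup>2)"
        using mult_right_mono[OF F\<Psi>[of "\<phi> x"], of "(norm (grad \<phi> x))\<^sup>2"] by (simp add: power_mult_distrib mult_ac)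
      then show "F' (\<phi> x) * norm (grad \<phi> x)
          \<le> (K * (\<Psi>' (\<phi> x) * (norm (grad \<phi> x))\<^sup>2) + (1 + \<bar>F (\<phi> x)\<bar>) powr p / K) / 2"
        using K \<Psi>'0 by (intro mult_le_weighted_sum) auto
    qed (use iU iE iB in auto)
    also have "\<dots> = (K * E + (B - 1) / K) / 2"
      using iE iB by (simp add: E_def B_def)
    also have "\<dots> \<le> (K * (C1 * B powr r) + B / K) / 2"
      using E_le K by (intro divide_right_mono add_mono mult_left_mono) auto
    also have "\<dots> = (C1 + 1) / 2 * B powr ((1 + r) / 2)"
    proof -
      have "K * B powr r = B powr ((1 + r) / 2)" unfolding K_def powr_add[symmetric]
        by (intro arg_cong2[of _ _ _ _ "(powr)"]) (auto simp: field_simps)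
      moreover have "B / K = B powr (1 - (1 - r) / 2)"
        using B1 by (simp only: K_def powr_diff powr_one)
      moreover have "1 - (1 - r) / 2 = (1 + r) / 2" by (simp add: field_simps)
      ultimately show ?thesis by (simp add: algebra_simps)
    qed
    finally have U_le: "U \<le> (C1 + 1) / 2 * B powr ((1 + r) / 2)" .
    have A_le: "A \<le> U powr p"
      using Sobolev_test[OF \<phi> F] F'0 by (simp add: A_def U_def)
    have "B \<le> 1 + (\<integral>x. 2 powr p * (1 + \<bar>F (\<phi> x)\<bar> powr p) \<partial>\<mu>)"
      unfolding B_def using iB iA p_bounds by (intro add_left_mono integral_mono one_plus_powr_le) auto
    also have "\<dots> = 1 + 2 powr p * (measure \<mu> \<Omega> + A)" using iA by (simp add: A_def)
    also have "\<dots> \<le> 1 + 2 powr p * (measure \<mu> \<Omega> + U powr p)" using A_le by simp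
    also have "\<dots> \<le> C2 * (1 + U) powr p"
    proof -
      have 1: "1 \<le> (1 + U) powr p" using U0 p_bounds by (intro ge_one_powr_ge_zero) auto
      have 2: "U powr p \<le> (1 + U) powr p" using U0 p_bounds by (intro powr_mono2) auto
      have "measure \<mu> \<Omega> * 1 \<le> measure \<mu> \<Omega> * (1 + U) powr p" using 1 by (intro mult_left_mono) auto
      then have "1 + 2 powr p * (measure \<mu> \<Omega> + U powr p)
          \<le> (1 + U) powr p + 2 powr p * (measure \<mu> \<Omega> * (1 + U) powr p + (1 + U) powr p)"
        using 1 2 by (intro add_mono mult_left_mono) auto
      then show ?thesis by (simp add: C2_def algebra_simps)
    qed
    finally have B_le: "B \<le> C2 * (1 + U) powr p" .
    have "B powr ((1 + r) / 2) \<le> (C2 * (1 + U) powr p) powr ((1 + r) / 2)"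
      using B_le B1 r by (intro powr_mono2) auto
    also have "\<dots> = C2 powr ((1 + r) / 2) * (1 + U) powr q"
      using C2 U0 by (simp add: powr_mult powr_powr q_def)
    finally have "(C1 + 1) / 2 * B powr ((1 + r) / 2) \<le> (C1 + 1) / 2 * (C2 powr ((1 + r) / 2) * (1 + U) powr q)"
      using C1 by (intro mult_left_mono) auto
    then have "U \<le> C3 * (1 + U) powr q" using U_le by (simp add: C3_def mult_ac)
    then have U4: "1 + U \<le> C4" unfolding C4_def by (intro sublinear_bound U0 C3 q)
    have "B \<le> C2 * C4 powr p"
      using B_le U4 U0 C2 p_bounds by (elim order_trans) (intro mult_left_mono powr_mono2, auto)
    then show "(\<integral>x. F' (\<phi> x) * norm (grad \<phi> x) \<partial>\<mu>) \<le> max C4 (C2 * C4 powr p) \<and>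
        (\<integral>x. (1 + \<bar>F (\<phi> x)\<bar>) powr p \<partial>\<mu>) \<le> max C4 (C2 * C4 powr p)"
      using U4 unfolding U_def B_def by (auto simp: le_max_iff_disj)
  qed
  then show ?thesis by blast
qed

end

section \<open>Auxiliary real functions: odd powers, the change of unknown and smooth
  truncation\<close>

definition spow :: "real \<Rightarrow> real \<Rightarrow> real" where
  "spow e y = sgn y * ((1 + \<bar>y\<bar>) powr e - 1) / e"

lemma spow_0 [simp]: "spow e 0 = 0"
  by (simp add: spow_def)

text \<open>\<open>spow e\<close> is the odd primitive of (1 + |y|)^(e-1) that vanishes at 0. For e
  > 0 it supplies a test nonlinearity of prescribed growth, for e < 0 a bounded one.\<close>

lemma DERIV_spow:
  assumes "e \<noteq> 0"
  shows "(spow e has_real_derivative (1 + \<bar>y\<bar>) powr (e - 1)) (at y)"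
proof -
  have pos: "((\<lambda>y. ((1 + y) powr e - 1) / e) has_real_derivative (1 + \<bar>y\<bar>) powr (e - 1)) (at y)"
    if "y \<ge> 0" for y
    using assms that by (auto intro!: derivative_eq_intros simp: field_simps)
  have neg: "((\<lambda>y. (1 - (1 - y) powr e) / e) has_real_derivative (1 + \<bar>y\<bar>) powr (e - 1)) (at y)"
    if "y \<le> 0" for y
    using assms that by (auto intro!: derivative_eq_intros simp: field_simps)
  have eqp: "((1 + y) powr e - 1) / e = spow e y" if "y \<ge> 0" for y
    using that by (cases "y = 0") (auto simp: spow_def)
  have eqn: "(1 - (1 - y) powr e) / e = spow e y" if "y \<le> 0" for y
    using that by (cases "y = 0") (auto simp: spow_def)
  consider "y > 0" | "y < 0" | "y = 0" by linarith
  then show ?thesis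
  proof cases
    case 1
    then show ?thesis
      by (intro has_field_derivative_transform_within_open[OF pos, of y "{0<..}"]) (auto simp: eqp)
  next
    case 2
    then show ?thesis
      by (intro has_field_derivative_transform_within_open[OF neg, of y "{..<0}"]) (auto simp: eqn)
  next
    case 3
    \<comment> \<open>At 0 the two one-sided formulas have the same derivative, and the half-lines
      cover a neighbourhood.\<close>
    have "(spow e has_real_derivative (1 + \<bar>y\<bar>) powr (e - 1)) (at y within {0..})"
      using 3 by (intro has_field_derivative_transform_within[OF has_field_derivative_at_within[OF pos], of _ 1]) (auto simp: eqp)
    moreover have "(spow e has_real_derivative (1 + \<bar>y\<bar>) powr (e - 1)) (at y within {..0})"
      using 3 by (intro has_field_derivative_transform_within[OF has_field_derivative_at_within[OF neg], of _ 1]) (auto simp: eqn)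
    moreover have "{0..} \<union> {..0} = (UNIV :: real set)" by auto
    ultimately show ?thesis
      unfolding has_field_derivative_iff by (rule Lim_Un_univ)
  qed
qed

lemma abs_spow_le:
  assumes "e > 0"
  shows "\<bar>spow e y\<bar> \<le> (1 + \<bar>y\<bar>) powr e / e"
proof -
  have "1 \<le> (1 + \<bar>y\<bar>) powr e" using assms by (intro ge_one_powr_ge_zero) auto
  then show ?thesis using assms by (auto simp: spow_def abs_mult abs_sgn_eq divide_right_mono)
qed

lemma abs_spow_neg_le:
  assumes "e < 0"
  shows "\<bar>spow e y\<bar> \<le> 1 / - e"
proof -
  have "(1 + \<bar>y\<bar>) powr e \<le> (1 + \<bar>y\<bar>) powr 0" using assms by (intro powr_mono) auto
  also have "(1 + \<bar>y\<bar>) powr 0 = 1" by (simp add: add_nonneg_eq_0_iff)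
  finally have "\<bar>(1 + \<bar>y\<bar>) powr e - 1\<bar> \<le> 1" by (simp add: abs_le_iff)
  then have "\<bar>(1 + \<bar>y\<bar>) powr e - 1\<bar> / \<bar>e\<bar> \<le> 1 / \<bar>e\<bar>" by (intro divide_right_mono) auto
  then show ?thesis using assms by (auto simp: spow_def abs_mult abs_sgn_eq)
qed

lemma continuous_on_one_plus_abs_powr:
  "continuous_on S g \<Longrightarrow> continuous_on S (\<lambda>s. (1 + \<bar>g s :: real\<bar>) powr e)"
  by (intro continuous_intros) auto

text \<open>The inverse of \<open>s \<mapsto> \<integral>\<^sub>0\<^sup>s (1 + \<bar>t\<bar>) powr - \<theta> dt\<close>, which turns the linear equation into
  the degenerate one.\<close>

definition Gfun :: "real \<Rightarrow> real \<Rightarrow> real" where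
  "Gfun \<theta> s = spow (1 / (1 - \<theta>)) ((1 - \<theta>) * s) / (1 - \<theta>)"

lemma Gfun_0 [simp]: "Gfun \<theta> 0 = 0"
  by (simp add: Gfun_def)

lemma abs_Gfun:
  assumes "\<theta> < 1" "0 \<le> \<theta>"
  shows "1 + \<bar>Gfun \<theta> s\<bar> = (1 + (1 - \<theta>) * \<bar>s\<bar>) powr (1 / (1 - \<theta>))"
proof -
  have 1: "1 \<le> (1 + (1 - \<theta>) * \<bar>s\<bar>) powr (1 / (1 - \<theta>))"
    using assms by (intro ge_one_powr_ge_zero) auto
  show ?thesis using assms 1 by (cases "s = 0") (auto simp: Gfun_def spow_def abs_mult abs_sgn_eq)
qed

text \<open>By \<open>abs_Gfun\<close> the claim reduces to an identity of exponents, 1 / (1 -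
  \<theta>) - 1 = \<theta> / (1 - \<theta>).\<close>

lemma DERIV_Gfun:
  assumes "\<theta> < 1" "0 \<le> \<theta>"
  shows "(Gfun \<theta> has_real_derivative (1 + \<bar>Gfun \<theta> s\<bar>) powr \<theta>) (at s)"
proof -
  have "((\<lambda>s. spow (1 / (1 - \<theta>)) ((1 - \<theta>) * s)) has_real_derivative
      (1 + \<bar>(1 - \<theta>) * s\<bar>) powr (1 / (1 - \<theta>) - 1) * (1 - \<theta>)) (at s)"
    using assms by (intro DERIV_chain2[OF DERIV_spow]) (auto intro!: derivative_eq_intros)
  from DERIV_cdivide[OF this, of "1 - \<theta>"]
  have "(Gfun \<theta> has_real_derivative (1 + \<bar>(1 - \<theta>) * s\<bar>) powr (1 / (1 - \<theta>) - 1)) (at s)"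
    using assms by (simp add: Gfun_def[abs_def])
  moreover have "(1 + \<bar>(1 - \<theta>) * s\<bar>) powr (1 / (1 - \<theta>) - 1) = (1 + \<bar>Gfun \<theta> s\<bar>) powr \<theta>"
    unfolding abs_Gfun[OF assms] powr_powr using assms
    by (auto simp: abs_mult diff_divide_distrib[symmetric] divide_eq_eq intro!: arg_cong2[of _ _ _ _ "(powr)"])
      (simp add: field_simps)
  ultimately show ?thesis by simp
qed

lemma abs_Gfun_mono:
  assumes "\<theta> < 1" "0 \<le> \<theta>" "\<bar>s\<bar> \<le> \<bar>t\<bar>"
  shows "\<bar>Gfun \<theta> s\<bar> \<le> \<bar>Gfun \<theta> t\<bar>"
proof -
  have "(1 + (1 - \<theta>) * \<bar>s\<bar>) powr (1 / (1 - \<theta>)) \<le> (1 + (1 - \<theta>) * \<bar>t\<bar>) powr (1 / (1 - \<theta>))"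
    using assms by (intro powr_mono2 add_left_mono mult_left_mono) auto
  then show ?thesis using abs_Gfun[OF assms(1,2)] by (metis add_le_cancel_left)
qed

text \<open>A smooth substitute for truncation at level \<open>k\<close>.\<close>

definition trunc :: "real \<Rightarrow> real \<Rightarrow> real" where
  "trunc k s = k * arctan (s / k)"

definition trunc' :: "real \<Rightarrow> real \<Rightarrow> real" where
  "trunc' k s = 1 / (1 + (s / k)\<^sup>2)"

lemma trunc_0 [simp]: "trunc k 0 = 0"
  by (simp add: trunc_def)

lemma DERIV_trunc: "k > 0 \<Longrightarrow> (trunc k has_real_derivative trunc' k s) (at s)"
proof -
  assume k: "k > 0"
  have "((\<lambda>s. k * arctan (s / k)) has_real_derivative k * (inverse (1 + (s / k)\<^sup>2) * (1 / k))) (at s)"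
    by (intro DERIV_cmult DERIV_chain2[OF DERIV_arctan]) (use k in \<open>auto intro!: derivative_eq_intros\<close>)
  then show ?thesis using k by (simp add: trunc_def[abs_def] trunc'_def inverse_eq_divide)
qed

lemma trunc'_bounds: "0 \<le> trunc' k s" "trunc' k s \<le> 1"
proof -
  have "1 \<le> 1 + (s / k)\<^sup>2" by simp
  then show "0 \<le> trunc' k s" "trunc' k s \<le> 1" unfolding trunc'_def by (auto simp only: divide_le_eq_1 zero_le_divide_iff)
qed

lemma continuous_on_trunc': "continuous_on UNIV (trunc' k)"
proof -
  have "1 + (s * inverse k)\<^sup>2 \<noteq> 0" for s by (metis add_pos_nonneg less_numeral_extra(1,3) zero_le_power2)
  then show ?thesis unfolding trunc'_def[abs_def] divide_inverse[of _ k]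
    by (intro continuous_intros) auto
qed

lemma abs_trunc_le: "k > 0 \<Longrightarrow> \<bar>trunc k s\<bar> \<le> \<bar>s\<bar>"
  using abs_arctan_le[of "s / k"] by (simp add: trunc_def abs_mult field_simps)

lemma abs_trunc_bound: "k > 0 \<Longrightarrow> \<bar>trunc k s\<bar> \<le> 2 * k"
  using arctan_bounded[of "s / k"] pi_less_4 by (simp add: trunc_def abs_mult abs_le_iff)

lemma tendsto_trunc': "(\<lambda>n. trunc' (real (Suc n)) s) \<longlonglongrightarrow> 1"
proof -
  have "(\<lambda>n. 1 / (1 + (s * (1 / real (Suc n)))\<^sup>2)) \<longlonglongrightarrow> 1 / (1 + (s * 0)\<^sup>2)"
    by (intro tendsto_intros lim_1_over_n[THEN LIMSEQ_Suc]) auto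
  then show ?thesis by (simp add: trunc'_def)
qed

lemma tendsto_trunc: "(\<lambda>n. trunc (real (Suc n)) s) \<longlonglongrightarrow> s"
proof (cases "s = 0")
  case False
  have z: "(\<lambda>n. s / real (Suc n)) \<longlonglongrightarrow> 0"
    using tendsto_mult_right_zero[OF lim_1_over_n[THEN LIMSEQ_Suc], of s] by simp
  have "((\<lambda>y. (arctan (0 + y) - arctan 0) / y) \<longlongrightarrow> inverse (1 + 0\<^sup>2)) (at 0)"
    using DERIV_arctan[of 0] unfolding DERIV_def .
  then have "((\<lambda>y. arctan y / y) \<longlongrightarrow> 1) (at 0)" by simp
  moreover have "filterlim (\<lambda>n. s / real (Suc n)) (at 0) sequentially"
    using z False by (auto simp: filterlim_at)
  ultimately have "(\<lambda>n. arctan (s / real (Suc n)) / (s / real (Suc n))) \<longlonglongrightarrow> 1"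
    by (rule filterlim_compose)
  from tendsto_mult[OF tendsto_const[of s] this]
  show ?thesis using False by (simp add: trunc_def mult.commute)
qed simp

section \<open>The two uses of the a priori estimate: linear differences and the nonlinear
  bound\<close>

context elliptic_coefficient
begin

text \<open>Taking F = id and \<Psi>' = (1 + |s|)^(-p) gives equality in the structural condition on
  F' and \<Psi>'. Then |\<Psi>| is at most 1 / (p - 1), so data in L^1 suffice and r = 0. The a
  priori estimate is not homogeneous; dividing the difference by d brings data and error to unit
  size, and multiplying back makes the bound linear in d.\<close>

lemma gradient_diff_bound:
  "\<exists>C>0. \<forall>h1 h2 \<eta>1 \<eta>2 \<phi>1 \<phi>2 d. approx_sol h1 \<eta>1 \<phi>1 \<longrightarrow> integrable \<mu> h1 \<longrightarrow>
     approx_sol h2 \<eta>2 \<phi>2 \<longrightarrow> integrable \<mu> h2 \<longrightarrow> 0 \<le> \<eta>1 \<longrightarrow> 0 \<le> \<eta>2 \<longrightarrow> 0 < d \<longrightarrow>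
     (\<integral>x. \<bar>h1 x - h2 x\<bar> \<partial>\<mu>) \<le> d \<longrightarrow> 2 * (\<eta>1 + \<eta>2) \<le> d\<^sup>2 \<longrightarrow>
     (\<integral>x. norm (grad \<phi>1 x - grad \<phi>2 x) \<partial>\<mu>) \<le> C * d"
proof -
  have M: "0 \<le> 1 / (p - 1)" using p_bounds by simp
  obtain C where "apriori_bound 0 (1 / (p - 1)) C"
    using ex_apriori_bound[OF _ _ M, of 0] p_bounds by auto
  note C = apriori_boundD[OF this]
  show ?thesis
  proof (intro exI[of _ "max C 1"] conjI allI impI)
    fix h1 h2 \<eta>1 \<eta>2 \<phi>1 \<phi>2 and d :: real
    assume 1: "approx_sol h1 \<eta>1 \<phi>1" "integrable \<mu> h1" and 2: "approx_sol h2 \<eta>2 \<phi>2" "integrable \<mu> h2"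
      and \<eta>: "0 \<le> \<eta>1" "0 \<le> \<eta>2" and d: "0 < d" and hd: "(\<integral>x. \<bar>h1 x - h2 x\<bar> \<partial>\<mu>) \<le> d"
      and \<eta>d: "2 * (\<eta>1 + \<eta>2) \<le> d\<^sup>2"
    define w where "w x = 1/d * (\<phi>1 x + (-1) * \<phi>2 x)" for x
    define h where "h x = 1/d * (h1 x - h2 x)" for x
    have T: "\<phi>1 \<in> test_functions \<Omega>" "\<phi>2 \<in> test_functions \<Omega>" using 1 2 by (auto simp: approx_sol_def)
    have sol: "approx_sol h ((1/d)\<^sup>2 * (2 * (\<eta>1 + \<eta>2))) w"
      using approx_sol_diff[OF 1 2, of "1/d"] unfolding w_def[abs_def] h_def[abs_def] .
    have ih: "integrable \<mu> h" unfolding h_def using 1 2 by simp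
    have wT: "w \<in> test_functions \<Omega>" using sol by (simp add: approx_sol_def)
    note [measurable] = test_measurable[OF wT]
    have cs: "continuous_on UNIV (spow (1 - p))"
      using p_bounds by (intro DERIV_continuous_on[OF has_field_derivative_at_within[OF DERIV_spow]]) auto
    note [measurable] = measurable_cont_compose[OF cs test_measurable(1)[OF wT]]
    have "(\<integral>x. 1 * norm (grad w x) \<partial>\<mu>) \<le> C \<and> (\<integral>x. (1 + \<bar>w x\<bar>) powr p \<partial>\<mu>) \<le> C"
    proof (rule C[where S=1 and \<Psi>="spow (1 - p)" and \<Psi>'="\<lambda>s. (1 + \<bar>s\<bar>) powr (1 - p - 1)" and F="\<lambda>s. s" and F'="\<lambda>_. 1",
          OF sol ih])
      show "(spow (1 - p) has_real_derivative (1 + \<bar>s\<bar>) powr (1 - p - 1)) (at s)" for s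
        using p_bounds by (intro DERIV_spow) auto
      show "continuous_on UNIV (\<lambda>s::real. (1 + \<bar>s\<bar>) powr (1 - p - 1))"
        by (intro continuous_on_one_plus_abs_powr continuous_intros)
      show "1\<^sup>2 \<le> (1 + \<bar>s\<bar>) powr p * (1 + \<bar>s\<bar>) powr (1 - p - 1)" for s :: real
        unfolding powr_add[symmetric] by simp
      show "(1 + \<bar>s\<bar>) powr (1 - p - 1) \<le> 1" for s :: real
        using powr_mono[of "1 - p - 1" 0 "1 + \<bar>s\<bar>"] p_bounds by (simp add: add_nonneg_eq_0_iff)
      have "(1/d)\<^sup>2 * (2 * (\<eta>1 + \<eta>2)) \<le> (1/d)\<^sup>2 * d\<^sup>2" using \<eta>d by (intro mult_left_mono) auto
      then show "(1/d)\<^sup>2 * (2 * (\<eta>1 + \<eta>2)) * 1 \<le> 1" using d by (simp add: power_divide)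
      have b: "\<bar>h x * spow (1 - p) (w x)\<bar> \<le> 1 / (p - 1) * \<bar>h x\<bar>" for x
        using mult_left_mono[OF abs_spow_neg_le[of "1 - p" "w x"], of "\<bar>h x\<bar>"] p_bounds by (simp add: abs_mult)
      have ib: "integrable \<mu> (\<lambda>x. 1 / (p - 1) * \<bar>h x\<bar>)" using ih by simp
      have "(\<integral>x. \<bar>h x * spow (1 - p) (w x)\<bar> \<partial>\<mu>) \<le> (\<integral>x. 1 / (p - 1) * \<bar>h x\<bar> \<partial>\<mu>)"
      proof (rule integral_mono[OF _ ib b])
        show "integrable \<mu> (\<lambda>x. \<bar>h x * spow (1 - p) (w x)\<bar>)"
          using ih p_bounds b by (intro Bochner_Integration.integrable_bound[OF ib]) auto
      qed
      also have "\<dots> = 1 / (p - 1) * (1/d * (\<integral>x. \<bar>h1 x - h2 x\<bar> \<partial>\<mu>))"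
        using d by (simp add: h_def abs_mult)
      also have "\<dots> \<le> 1 / (p - 1) * 1"
        using hd d p_bounds by (intro mult_left_mono) auto
      finally have "(\<integral>x. \<bar>h x * spow (1 - p) (w x)\<bar> \<partial>\<mu>) \<le> 1 / (p - 1)" by simp
      moreover have "(1 + (\<integral>x. (1 + \<bar>w x\<bar>) powr p \<partial>\<mu>)) powr 0 = 1"
        using integral_nonneg_AE[of "\<lambda>x. (1 + \<bar>w x\<bar>) powr p" \<mu>] by (simp add: add_nonneg_eq_0_iff)
      ultimately show "(\<integral>x. \<bar>h x * spow (1 - p) (w x)\<bar> \<partial>\<mu>)
          \<le> 1 / (p - 1) * (1 + (\<integral>x. (1 + \<bar>w x\<bar>) powr p \<partial>\<mu>)) powr 0" by simp
    qed (use \<eta> d in auto)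
    moreover have "grad w x = (1/d) *\<^sub>R (grad \<phi>1 x - grad \<phi>2 x)" for x
    proof -
      note d = test_functions_differentiable[OF T(1)] test_functions_differentiable[OF test_functions_cmult[OF T(2)]]
        test_functions_differentiable[OF T(2)] test_functions_differentiable[OF test_functions_add[OF T(1) test_functions_cmult[OF T(2)]]]
      show ?thesis unfolding w_def[abs_def] grad_cmult[OF d(4)] grad_add[OF d(1) d(2)] grad_cmult[OF d(3)] by simp
    qed
    ultimately have "1/d * (\<integral>x. norm (grad \<phi>1 x - grad \<phi>2 x) \<partial>\<mu>) \<le> C" using d by simp
    then have "(\<integral>x. norm (grad \<phi>1 x - grad \<phi>2 x) \<partial>\<mu>) \<le> C * d" using d by (simp add: field_simps)
    also have "\<dots> \<le> max C 1 * d" using d by (intro mult_right_mono) auto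
    finally show "(\<integral>x. norm (grad \<phi>1 x - grad \<phi>2 x) \<partial>\<mu>) \<le> max C 1 * d" .
  qed simp
qed

text \<open>Young's inequality with the weight \<open>B powr (r / m)\<close>, chosen to reproduce Hoelder's inequality.\<close>

lemma integral_mult_powr_le:
  fixes f y :: "'a \<Rightarrow> real"
  assumes m: "m > 1" "r = 1 - 1 / m"
    and f: "integrable \<mu> (\<lambda>x. \<bar>f x\<bar> powr m)" "f \<in> borel_measurable \<mu>"
    and y: "y \<in> borel_measurable \<mu>" "\<And>x. 1 \<le> y x" "integrable \<mu> (\<lambda>x. y x powr p)"
    and B: "B = 1 + (\<integral>x. y x powr p \<partial>\<mu>)"
  shows "integrable \<mu> (\<lambda>x. \<bar>f x\<bar> * y x powr (p * r))"
    and "(\<integral>x. \<bar>f x\<bar> * y x powr (p * r) \<partial>\<mu>) \<le> ((\<integral>x. \<bar>f x\<bar> powr m \<partial>\<mu>) + 1) * B powr r"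
proof -
  have r: "0 < r" "r < 1" using m by auto
  have B1: "B \<ge> 1" unfolding B by (auto intro!: integral_nonneg_AE)
  define K where "K = B powr (r / m)"
  have K: "K > 0" using B1 by (simp add: K_def)
  have pw: "\<bar>f x\<bar> * y x powr (p * r) \<le> B powr r * \<bar>f x\<bar> powr m + B powr (r - 1) * y x powr p" for x
  proof -
    have "(K * \<bar>f x\<bar>) * (y x powr (p * r) / K)
        \<le> (K * \<bar>f x\<bar>) powr m / m + (y x powr (p * r) / K) powr (1 / r) / (1 / r)"
      using m r K by (intro Youngs_inequality) auto
    also have "\<dots> \<le> (K * \<bar>f x\<bar>) powr m + (y x powr (p * r) / K) powr (1 / r)"
    proof (rule add_mono)
      show "(K * \<bar>f x\<bar>) powr m / m \<le> (K * \<bar>f x\<bar>) powr m"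
        using m by (simp add: divide_le_eq mult_le_cancel_left1)
      have "(y x powr (p * r) / K) powr (1 / r) * r \<le> (y x powr (p * r) / K) powr (1 / r) * 1"
        using r by (intro mult_left_mono) auto
      then show "(y x powr (p * r) / K) powr (1 / r) / (1 / r) \<le> (y x powr (p * r) / K) powr (1 / r)" by simp
    qed
    also have "(K * \<bar>f x\<bar>) powr m = B powr r * \<bar>f x\<bar> powr m"
      using K m by (simp add: powr_mult powr_powr K_def)
    also have "(y x powr (p * r) / K) powr (1 / r) = B powr (r - 1) * y x powr p"
    proof -
      have "(y x powr (p * r) / K) powr (1 / r) = (y x powr (p * r)) powr (1 / r) / K powr (1 / r)"
        using K by (simp add: powr_divide)
      also have "\<dots> = y x powr p / B powr (1 / m)" using r by (simp add: powr_powr K_def)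
      also have "\<dots> = B powr (r - 1) * y x powr p" using m by (simp add: powr_minus_divide)
      finally show ?thesis .
    qed
    finally show ?thesis using K by simp
  qed
  have i: "integrable \<mu> (\<lambda>x. B powr r * \<bar>f x\<bar> powr m + B powr (r - 1) * y x powr p)"
    using f y by simp
  show i2: "integrable \<mu> (\<lambda>x. \<bar>f x\<bar> * y x powr (p * r))"
  proof (rule Bochner_Integration.integrable_bound[OF i])
    show "AE x in \<mu>. norm (\<bar>f x\<bar> * y x powr (p * r)) \<le> norm (B powr r * \<bar>f x\<bar> powr m + B powr (r - 1) * y x powr p)"
      using pw by (intro AE_I2) (auto intro: order_trans[OF _ abs_ge_self])
  qed (use f y in measurable)
  have "(\<integral>x. \<bar>f x\<bar> * y x powr (p * r) \<partial>\<mu>) \<le> (\<integral>x. B powr r * \<bar>f x\<bar> powr m + B powr (r - 1) * y x powr p \<partial>\<mu>)"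
    using i i2 pw by (intro integral_mono) auto
  also have "\<dots> = B powr r * (\<integral>x. \<bar>f x\<bar> powr m \<partial>\<mu>) + B powr (r - 1) * (B - 1)"
    using f y by (simp add: B)
  also have "\<dots> \<le> B powr r * (\<integral>x. \<bar>f x\<bar> powr m \<partial>\<mu>) + B powr (r - 1) * B"
    by (intro add_left_mono mult_left_mono) auto
  also have "B powr (r - 1) * B = B powr r" using B1 by (simp add: powr_diff)
  finally show "(\<integral>x. \<bar>f x\<bar> * y x powr (p * r) \<partial>\<mu>) \<le> ((\<integral>x. \<bar>f x\<bar> powr m \<partial>\<mu>) + 1) * B powr r"
    by (simp add: algebra_simps)
qed

text \<open>Truncating before applying G bounds both this function and its derivative, and hence the
  test nonlinearity built from it.\<close>

definition trunc_sol :: "real \<Rightarrow> real \<Rightarrow> real \<Rightarrow> real" where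
  "trunc_sol \<theta> k s = Gfun \<theta> (trunc k s)"

definition trunc_sol' :: "real \<Rightarrow> real \<Rightarrow> real \<Rightarrow> real" where
  "trunc_sol' \<theta> k s = (1 + \<bar>trunc_sol \<theta> k s\<bar>) powr \<theta> * trunc' k s"

lemma trunc_sol_0 [simp]: "trunc_sol \<theta> k 0 = 0"
  by (simp add: trunc_sol_def)

lemma DERIV_trunc_sol:
  assumes "\<theta> < 1" "0 \<le> \<theta>" "k > 0"
  shows "(trunc_sol \<theta> k has_real_derivative trunc_sol' \<theta> k s) (at s)"
  unfolding trunc_sol_def[abs_def] trunc_sol'_def
  by (rule DERIV_chain2[OF DERIV_Gfun[OF assms(1,2)] DERIV_trunc[OF assms(3)]])

lemma continuous_on_trunc_sol:
  assumes "\<theta> < 1" "0 \<le> \<theta>" "k > 0"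
  shows "continuous_on UNIV (trunc_sol \<theta> k)" "continuous_on UNIV (trunc_sol' \<theta> k)"
proof -
  show 1: "continuous_on UNIV (trunc_sol \<theta> k)"
    by (rule DERIV_continuous_on[OF has_field_derivative_at_within[OF DERIV_trunc_sol[OF assms]]])
  show "continuous_on UNIV (trunc_sol' \<theta> k)"
    unfolding trunc_sol'_def[abs_def]
    by (intro continuous_on_mult continuous_on_one_plus_abs_powr 1 continuous_on_trunc')
qed

text \<open>With F the truncated G, take \<Psi> = spow \<sigma>' (F) for \<sigma>' = \<theta> - p +
  1, so that \<Psi>' = (1 + |F|)^(2\<theta>-p) trunc'. As trunc' \<le> 1, this dominates F'^2 / (1 +
  |F|)^p. Since \<Psi> grows like (1 + |F|)^\<sigma>' and \<sigma>' = p (1 - 1/m), Hoelder's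
  inequality pairs f in L^m exactly with the integral of (1 + |F|)^p.\<close>

lemma nonlinear_bound:
  fixes f :: "'a \<Rightarrow> real"
  assumes \<theta>: "0 \<le> \<theta>" "\<theta> < 1" and m: "m > 1" and \<sigma>: "\<theta> - p + 1 = p * (1 - 1 / m)"
    and f: "integrable \<mu> (\<lambda>x. \<bar>f x\<bar> powr m)" "f \<in> borel_measurable \<mu>"
  shows "\<exists>C. \<forall>h \<eta> \<phi> k. approx_sol h \<eta> \<phi> \<longrightarrow> integrable \<mu> h \<longrightarrow> (\<forall>x. \<bar>h x\<bar> \<le> \<bar>f x\<bar>) \<longrightarrow>
      0 \<le> \<eta> \<longrightarrow> 0 < k \<longrightarrow> \<eta> * (1 + \<bar>Gfun \<theta> (2 * k)\<bar>) powr 2 \<le> 1 \<longrightarrow>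
      (\<integral>x. trunc_sol' \<theta> k (\<phi> x) * norm (grad \<phi> x) \<partial>\<mu>) \<le> C \<and>
      (\<integral>x. (1 + \<bar>trunc_sol \<theta> k (\<phi> x)\<bar>) powr p \<partial>\<mu>) \<le> C"
proof -
  define r where "r = 1 - 1 / m"
  define \<sigma>' where "\<sigma>' = \<theta> - p + 1"
  have r: "0 \<le> r" "0 < r" using m by (auto simp: r_def)
  have \<sigma>'r: "\<sigma>' = p * r" and \<sigma>'0: "\<sigma>' > 0" using \<sigma> r p_bounds by (auto simp: \<sigma>'_def r_def)
  \<comment> \<open>Here p (1 + r) = p + \<sigma>' = 1 + \<theta>.\<close>
  have pr: "p * (1 + r) < 2" using \<sigma>'r \<theta> by (simp add: \<sigma>'_def algebra_simps)
  define M where "M = ((\<integral>x. \<bar>f x\<bar> powr m \<partial>\<mu>) + 1) / \<sigma>'"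
  have M: "M \<ge> 0" unfolding M_def using \<sigma>'0 by (auto intro!: divide_nonneg_pos add_nonneg_nonneg integral_nonneg_AE)
  obtain C where "apriori_bound r M C"
    using ex_apriori_bound[OF r(1) pr M] by blast
  note C = apriori_boundD[OF this]
  show ?thesis
  proof (intro exI[of _ C] allI impI)
    fix h \<eta> \<phi> and k :: real
    assume sol: "approx_sol h \<eta> \<phi>" and ih: "integrable \<mu> h" and hf: "\<forall>x. \<bar>h x\<bar> \<le> \<bar>f x\<bar>" and \<eta>: "0 \<le> \<eta>" and k: "0 < k"
      and \<eta>S: "\<eta> * (1 + \<bar>Gfun \<theta> (2 * k)\<bar>) powr 2 \<le> 1"
    note h = ih hf[THEN spec]
    let ?F = "trunc_sol \<theta> k" and ?F' = "trunc_sol' \<theta> k"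
    let ?P = "\<lambda>s. spow \<sigma>' (?F s)" and ?P' = "\<lambda>s. (1 + \<bar>?F s\<bar>) powr (2 * \<theta> - p) * trunc' k s"
    have \<phi>: "\<phi> \<in> test_functions \<Omega>" using sol by (simp add: approx_sol_def)
    note cF = continuous_on_trunc_sol[OF \<theta>(2,1) k]
    have cP': "continuous_on UNIV ?P'"
      by (intro continuous_on_mult continuous_on_one_plus_abs_powr cF continuous_on_trunc')
    have dP: "(?P has_real_derivative ?P' s) (at s)" for s
    proof -
      have "(?P has_real_derivative (1 + \<bar>?F s\<bar>) powr (\<sigma>' - 1) * ?F' s) (at s)"
        using \<sigma>'0 by (intro DERIV_chain2[OF DERIV_spow] DERIV_trunc_sol[OF \<theta>(2,1) k]) auto
      moreover have "(1 + \<bar>?F s\<bar>) powr (\<sigma>' - 1) * ?F' s = ?P' s"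
        by (simp add: trunc_sol'_def \<sigma>'_def flip: powr_add mult.assoc)
      ultimately show ?thesis by simp
    qed
    have cP: "continuous_on UNIV ?P" by (rule DERIV_continuous_on[OF has_field_derivative_at_within[OF dP]])
    note [measurable] = measurable_cont_compose[OF cF(1) test_measurable(1)[OF \<phi>]]
      measurable_cont_compose[OF cP test_measurable(1)[OF \<phi>]]
    show "(\<integral>x. ?F' (\<phi> x) * norm (grad \<phi> x) \<partial>\<mu>) \<le> C \<and> (\<integral>x. (1 + \<bar>?F (\<phi> x)\<bar>) powr p \<partial>\<mu>) \<le> C"
    proof (rule C[OF sol h(1) \<eta> \<eta>S DERIV_trunc_sol[OF \<theta>(2,1) k] cF(2) _ dP cP'])
      show "0 \<le> ?F' s" "0 \<le> ?P' s" for s using trunc'_bounds[of k s] by (auto simp: trunc_sol'_def)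
      \<comment> \<open>The truncation takes values of modulus at most 2 k, and the exponent 2
        \<theta> - p is below 2; the resulting bound on \<Psi>' depends on k but not on s.\<close>
      show "?P' s \<le> (1 + \<bar>Gfun \<theta> (2 * k)\<bar>) powr 2" for s
      proof -
        have "?P' s \<le> (1 + \<bar>?F s\<bar>) powr (2 * \<theta> - p) * 1"
          using trunc'_bounds by (intro mult_left_mono) auto
        also have "\<dots> \<le> (1 + \<bar>?F s\<bar>) powr 2"
          unfolding mult_1_right using \<theta> p_bounds by (intro powr_mono) auto
        also have "\<dots> \<le> (1 + \<bar>Gfun \<theta> (2 * k)\<bar>) powr 2"
          using abs_Gfun_mono[OF \<theta>(2,1), of "trunc k s" "2 * k"] abs_trunc_bound[OF k, of s] k
          by (intro powr_mono2) (auto simp: trunc_sol_def)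
        finally show ?thesis .
      qed
      show "(?F' s)\<^sup>2 \<le> (1 + \<bar>?F s\<bar>) powr p * ?P' s" for s
      proof -
        have "(?F' s)\<^sup>2 = (1 + \<bar>?F s\<bar>) powr (\<theta> + \<theta>) * (trunc' k s * trunc' k s)"
          unfolding trunc_sol'_def power2_eq_square powr_add by (simp only: mult_ac)
        also have "\<dots> \<le> (1 + \<bar>?F s\<bar>) powr (\<theta> + \<theta>) * (trunc' k s * 1)"
          using trunc'_bounds by (intro mult_left_mono) auto
        also have "\<dots> = (1 + \<bar>?F s\<bar>) powr p * ?P' s"
          by (simp flip: powr_add mult.assoc)
        finally show ?thesis .
      qed
      define y where "y x = 1 + \<bar>?F (\<phi> x)\<bar>" for x
      obtain bF where bF: "bF > 0" "\<And>x. \<bar>?F (\<phi> x)\<bar> \<le> bF" using compose_bounded[OF \<phi> cF(1)] by metis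
      have y: "y \<in> borel_measurable \<mu>" "\<And>x. 1 \<le> y x" "integrable \<mu> (\<lambda>x. y x powr p)"
        unfolding y_def using bF p_bounds
        by (auto intro!: integrable_bounded[where B="(1 + bF) powr p"] powr_mono2)
      note I = integral_mult_powr_le[OF m r_def f y refl]
      have b: "\<bar>h x * ?P (\<phi> x)\<bar> \<le> 1 / \<sigma>' * (\<bar>f x\<bar> * y x powr (p * r))" for x
      proof -
        have "\<bar>h x * ?P (\<phi> x)\<bar> \<le> \<bar>f x\<bar> * (y x powr \<sigma>' / \<sigma>')"
          unfolding abs_mult y_def using h(2) abs_spow_le[OF \<sigma>'0] by (intro mult_mono) auto
        then show ?thesis by (simp add: \<sigma>'r)
      qed
      have "(\<integral>x. \<bar>h x * ?P (\<phi> x)\<bar> \<partial>\<mu>) \<le> (\<integral>x. 1 / \<sigma>' * (\<bar>f x\<bar> * y x powr (p * r)) \<partial>\<mu>)"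
      proof (rule integral_mono[OF _ _ b])
        show i: "integrable \<mu> (\<lambda>x. 1 / \<sigma>' * (\<bar>f x\<bar> * y x powr (p * r)))" using I(1) by simp
        show "integrable \<mu> (\<lambda>x. \<bar>h x * ?P (\<phi> x)\<bar>)"
          using h b by (intro Bochner_Integration.integrable_bound[OF i]) (use \<sigma>'0 in auto)
      qed
      also have "\<dots> \<le> 1 / \<sigma>' * (((\<integral>x. \<bar>f x\<bar> powr m \<partial>\<mu>) + 1) * (1 + (\<integral>x. y x powr p \<partial>\<mu>)) powr r)"
        using mult_left_mono[OF I(2), of "1 / \<sigma>'"] \<sigma>'0 by simp
      finally show "(\<integral>x. \<bar>h x * ?P (\<phi> x)\<bar> \<partial>\<mu>) \<le> M * (1 + (\<integral>x. (1 + \<bar>?F (\<phi> x)\<bar>) powr p \<partial>\<mu>)) powr r"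
        by (simp add: M_def y_def)
    qed auto
  qed
qed

end

section \<open>Limits\<close>

text \<open>The sum of the norms of the increments has finite integral, so the telescoping series
  converges absolutely almost everywhere, and that same sum serves as dominating function.
  Summability makes the whole sequence converge pointwise, without passing to a subsequence.\<close>

lemma summable_increments_L1_limit:
  fixes g :: "nat \<Rightarrow> 'a \<Rightarrow> 'b::{banach,second_countable_topology}"
  assumes g: "\<And>n. integrable M (g n)"
    and sum: "summable (\<lambda>n. \<integral>x. norm (g (Suc n) x - g n x) \<partial>M)"
  obtains l where "integrable M l" "AE x in M. (\<lambda>n. g n x) \<longlonglongrightarrow> l x"
    "(\<lambda>n. \<integral>x. norm (g n x - l x) \<partial>M) \<longlonglongrightarrow> 0"
proof -
  define f where "f n x = g (Suc n) x - g n x" for n x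
  have f: "integrable M (f n)" for n unfolding f_def using g by simp
  have [measurable]: "f n \<in> borel_measurable M" "g n \<in> borel_measurable M" for n using f g by auto
  have sf: "summable (\<lambda>n. \<integral>x. norm (f n x) \<partial>M)" using sum by (simp add: f_def)
  have ae: "AE x in M. summable (\<lambda>n. norm (f n x))"
  proof -
    have "(\<integral>\<^sup>+x. (\<Sum>n. ennreal (norm (f n x))) \<partial>M) = (\<Sum>n. \<integral>\<^sup>+x. ennreal (norm (f n x)) \<partial>M)"
      by (rule nn_integral_suminf) measurable
    also have "\<dots> = (\<Sum>n. ennreal (\<integral>x. norm (f n x) \<partial>M))"
      using f by (simp add: nn_integral_eq_integral)
    also have "\<dots> \<noteq> top" using sf by (intro ennreal_suminf_neq_top) auto
    finally have "AE x in M. (\<Sum>n. ennreal (norm (f n x))) \<noteq> \<infinity>"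
      by (intro nn_integral_PInf_AE) auto
    then show ?thesis by eventually_elim (auto intro: summable_suminf_not_top)
  qed
  define l where "l x = g 0 x + (\<Sum>n. f n x)" for x
  have il: "integrable M l" unfolding l_def using g integrable_suminf[OF f ae sf] by simp
  have iw: "integrable M (\<lambda>x. \<Sum>n. norm (f n x))"
    using f ae sf by (intro integrable_suminf) auto
  have gf: "g n x = g 0 x + (\<Sum>i<n. f i x)" for n x
    by (induction n) (auto simp: f_def)
  have lim: "AE x in M. (\<lambda>n. g n x) \<longlonglongrightarrow> l x"
    using ae
  proof eventually_elim
    case (elim x)
    note summable_LIMSEQ[OF summable_norm_cancel[OF elim]]
    from tendsto_add[OF tendsto_const[of "g 0 x"] this]
    have "(\<lambda>n. g 0 x + (\<Sum>i<n. f i x)) \<longlonglongrightarrow> l x" by (simp only: l_def)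
    moreover have "(\<lambda>n. g n x) = (\<lambda>n. g 0 x + (\<Sum>i<n. f i x))" by (rule ext) (rule gf)
    ultimately show ?case by (simp only:)
  qed
  have "(\<lambda>n. \<integral>x. norm (g n x - l x) \<partial>M) \<longlonglongrightarrow> (\<integral>x. 0 \<partial>M)"
  proof (rule integral_dominated_convergence[where w="\<lambda>x. 2 * (\<Sum>n. norm (f n x))"])
    show "AE x in M. (\<lambda>n. norm (g n x - l x)) \<longlonglongrightarrow> 0"
      using lim by eventually_elim (rule tendsto_norm_zero, rule LIM_zero)
    show "AE x in M. norm (norm (g n x - l x)) \<le> 2 * (\<Sum>n. norm (f n x))" for n
      using ae
    proof eventually_elim
      case (elim x)
      have "norm (\<Sum>i<n. f i x) \<le> (\<Sum>n. norm (f n x))"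
        by (rule order_trans[OF norm_sum sum_le_suminf[OF elim]]) auto
      moreover have "norm (\<Sum>n. f n x) \<le> (\<Sum>n. norm (f n x))" by (rule summable_norm[OF elim])
      moreover have "norm (g n x - l x) \<le> norm (\<Sum>i<n. f i x) + norm (\<Sum>n. f n x)"
        unfolding l_def gf[of n x] by (simp add: norm_triangle_ineq4)
      ultimately show ?case by simp
    qed
  qed (use iw il in auto)
  then show ?thesis using that il lim by simp
qed

text \<open>The bound is only required eventually, because the a priori estimate at a given
  truncation level holds only once \<eta> is small enough.\<close>

lemma Fatou_bounded:
  fixes g :: "nat \<Rightarrow> 'a \<Rightarrow> real"
  assumes g: "\<And>n. integrable M (g n)" "\<And>n x. 0 \<le> g n x"
    and l: "l \<in> borel_measurable M" "\<And>x. 0 \<le> l x" "AE x in M. (\<lambda>n. g n x) \<longlonglongrightarrow> l x"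
    and C: "eventually (\<lambda>n. (\<integral>x. g n x \<partial>M) \<le> C) sequentially"
  shows "integrable M l" "(\<integral>x. l x \<partial>M) \<le> C"
proof -
  have [measurable]: "g n \<in> borel_measurable M" "l \<in> borel_measurable M" for n using g l by auto
  obtain n where "(\<integral>x. g n x \<partial>M) \<le> C" using eventually_happens[OF C] by auto
  moreover have "0 \<le> (\<integral>x. g n x \<partial>M)" using g by (intro integral_nonneg_AE) auto
  ultimately have C0: "C \<ge> 0" by linarith
  have "(\<integral>\<^sup>+x. ennreal (l x) \<partial>M) = (\<integral>\<^sup>+x. liminf (\<lambda>n. ennreal (g n x)) \<partial>M)"
  proof (rule nn_integral_cong_AE)
    show "AE x in M. ennreal (l x) = liminf (\<lambda>n. ennreal (g n x))"
      using l(3)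
    proof eventually_elim
      case (elim x)
      then have "(\<lambda>n. ennreal (g n x)) \<longlonglongrightarrow> ennreal (l x)" by (rule tendsto_ennrealI)
      then show ?case by (simp add: lim_imp_Liminf)
    qed
  qed
  also have "\<dots> \<le> liminf (\<lambda>n. \<integral>\<^sup>+x. ennreal (g n x) \<partial>M)" by (rule nn_integral_liminf) simp
  also have "\<dots> = liminf (\<lambda>n. ennreal (\<integral>x. g n x \<partial>M))"
    using g by (simp add: nn_integral_eq_integral)
  also have "\<dots> \<le> liminf (\<lambda>n. ennreal C)"
    by (rule Liminf_mono) (use C in \<open>eventually_elim, simp add: ennreal_leI\<close>)
  also have "\<dots> = ennreal C" by (simp add: Liminf_const)
  finally have b: "(\<integral>\<^sup>+x. ennreal (l x) \<partial>M) \<le> ennreal C" .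
  show i: "integrable M l"
    using b l by (intro integrableI_nonneg) (auto simp: less_top[symmetric] top_unique intro: le_less_trans)
  show "(\<integral>x. l x \<partial>M) \<le> C"
    using b C0 l i by (simp add: nn_integral_eq_integral)
qed

section \<open>Translation invariance and vanishing integrals of derivatives\<close>

lemma integral_lborel_translate:
  fixes f :: "'a::euclidean_space \<Rightarrow> real"
  assumes "f \<in> borel_measurable borel"
  shows "(\<integral>x. f (c + x) \<partial>lborel) = (\<integral>x. f x \<partial>lborel)"
proof -
  have "(\<integral>x. f x \<partial>lborel) = (\<integral>x. f x \<partial>distr lborel borel ((+) c))"
    by (simp add: lborel_distr_plus)
  also have "\<dots> = (\<integral>x. f (c + x) \<partial>lborel)"
    using assms by (intro integral_distr) auto
  finally show ?thesis by simp
qed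

context bounded_domain
begin

lemma integral_lborel_eq_domain:
  fixes h :: "'a \<Rightarrow> real"
  assumes "h \<in> borel_measurable borel" "\<And>x. x \<notin> \<Omega> \<Longrightarrow> h x = 0"
  shows "(\<integral>x. h x \<partial>\<mu>) = (\<integral>x. h x \<partial>lborel)"
proof -
  have "(\<integral>x. h x \<partial>\<mu>) = (\<integral>x. indicator \<Omega> x *\<^sub>R h x \<partial>lebesgue)"
    by (rule integral_restrict_space) simp
  also have "\<dots> = (\<integral>x. h x \<partial>lebesgue)"
    using assms(2) by (intro Bochner_Integration.integral_cong) (auto simp: indicator_def)
  also have "\<dots> = (\<integral>x. h x \<partial>lborel)"
    using assms(1) by (intro integral_completion) auto
  finally show ?thesis .
qed

text \<open>By translation invariance every difference quotient of \<rho> has integral zero. The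
  quotients are bounded by the Lipschitz constant \<open>R\<close>, and since the steps are at most
  1 they vanish outside the ball of radius r + 1; dominated convergence passes this on to the
  derivative.\<close>

lemma integral_partial_test:
  assumes \<rho>: "\<rho> \<in> test_functions \<Omega>" and b: "b \<in> Basis"
  shows "(\<integral>x. partial b \<rho> x \<partial>\<mu>) = 0"
proof -
  have cg: "continuous_on UNIV (partial b \<rho>)"
    using test_functions_grad_continuous[OF \<rho>] inner_grad[OF b, of \<rho>]
    by (metis (no_types, lifting) continuous_on_cong continuous_on_const continuous_on_inner)
  have [measurable]: "\<rho> \<in> borel_measurable borel" "partial b \<rho> \<in> borel_measurable borel"
    using test_functions_continuous[OF \<rho>] cg by (auto intro: borel_measurable_continuous_onI)
  obtain R where R: "R > 0" "\<And>x. norm (grad \<rho> x) \<le> R" using test_bounded[OF \<rho>] by metis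
  obtain r where r: "\<And>x. x \<in> \<Omega> \<Longrightarrow> norm x \<le> r" using bounded_domain bounded_pos by metis
  define q where "q n x = real (Suc n) * (\<rho> ((1 / real (Suc n)) *\<^sub>R b + x) - \<rho> x)" for n x
  have ii: "integrable lborel (indicat_real (cball (0::'a) s))" for s
    by (intro integrable_real_indicator emeasure_lborel_cball_finite) auto
  have i\<rho>: "integrable lborel \<rho>"
  proof -
    obtain R' where R': "\<And>x. \<bar>\<rho> x\<bar> \<le> R'" using test_bounded[OF \<rho>] by metis
    have "integrable lborel (\<lambda>x::'a. R' * indicator (cball 0 r) x)"
      using ii by (intro integrable_mult_right)
    then show ?thesis
    proof (rule Bochner_Integration.integrable_bound)
      show "AE x in lborel. norm (\<rho> x) \<le> norm (R' * indicator (cball 0 r) x)"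
        using R' r test_functions_outside(1)[OF \<rho>]
        by (intro AE_I2) (auto simp: indicator_def intro: order_trans[OF _ abs_ge_self])
    qed simp
  qed
  have i\<rho>c: "integrable lborel (\<lambda>x. \<rho> (c + x))" for c
  proof -
    have "integrable (distr lborel borel ((+) c)) \<rho>" using i\<rho> by (simp add: lborel_distr_plus)
    then show ?thesis by (simp add: integrable_distr_eq)
  qed
  have "(\<integral>x. q n x \<partial>lborel) = 0" for n
    unfolding q_def using i\<rho> i\<rho>c integral_lborel_translate[of \<rho>] by simp
  moreover have "(\<lambda>n. \<integral>x. q n x \<partial>lborel) \<longlonglongrightarrow> (\<integral>x. partial b \<rho> x \<partial>lborel)"
  proof (rule integral_dominated_convergence[where w="\<lambda>x. R * indicator (cball 0 (r + 1)) x"])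
    show "integrable lborel (\<lambda>x::'a. R * indicator (cball 0 (r + 1)) x)"
      using ii by (intro integrable_mult_right)
    show "AE x in lborel. (\<lambda>n. q n x) \<longlonglongrightarrow> partial b \<rho> x"
    proof (intro AE_I2)
      fix x
      have "((\<lambda>t. \<rho> (x + t *\<^sub>R b)) has_derivative (\<lambda>t. grad \<rho> (x + 0 *\<^sub>R b) \<bullet> (t *\<^sub>R b))) (at 0)"
        by (rule has_derivative_compose[OF _ has_derivative_grad[OF test_functions_differentiable[OF \<rho>]]])
          (auto intro!: derivative_eq_intros)
      then have "((\<lambda>t. \<rho> (x + t *\<^sub>R b)) has_real_derivative partial b \<rho> x) (at 0)"
        by (simp add: has_field_derivative_def inner_grad[OF b] mult.commute[of _ "partial b \<rho> x"])
      then have "((\<lambda>t. (\<rho> (x + t *\<^sub>R b) - \<rho> x) / t) \<longlongrightarrow> partial b \<rho> x) (at 0)"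
        by (simp add: DERIV_def)
      moreover have "filterlim (\<lambda>n. 1 / real (Suc n)) (at 0) sequentially"
        using lim_1_over_n[THEN LIMSEQ_Suc] by (auto simp: filterlim_at)
      ultimately have "(\<lambda>n. (\<rho> (x + (1 / real (Suc n)) *\<^sub>R b) - \<rho> x) / (1 / real (Suc n))) \<longlonglongrightarrow> partial b \<rho> x"
        by (rule filterlim_compose)
      then show "(\<lambda>n. q n x) \<longlonglongrightarrow> partial b \<rho> x" by (simp add: q_def add.commute mult.commute)
    qed
    show "AE x in lborel. norm (q n x) \<le> R * indicator (cball 0 (r + 1)) x" for n
    proof (intro AE_I2)
      fix x
      let ?t = "1 / real (Suc n)"
      have t: "0 < ?t" "?t \<le> 1" by auto
      show "norm (q n x) \<le> R * indicator (cball 0 (r + 1)) x"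
      proof (cases "norm x \<le> r + 1")
        case True
        have "norm (\<rho> (?t *\<^sub>R b + x) - \<rho> x) \<le> R * norm ((?t *\<^sub>R b + x) - x)"
        proof (rule differentiable_bound[of UNIV])
          show "(\<rho> has_derivative (\<lambda>h. grad \<rho> y \<bullet> h)) (at y within UNIV)" for y
            using has_derivative_grad[OF test_functions_differentiable[OF \<rho>]] by simp
          show "onorm (\<lambda>h. grad \<rho> y \<bullet> h) \<le> R" for y
          proof (rule onorm_le)
            show "norm (grad \<rho> y \<bullet> h) \<le> R * norm h" for h
              using Cauchy_Schwarz_ineq2[of "grad \<rho> y" h] mult_right_mono[OF R(2)[of y], of "norm h"] by simp
          qed
        qed auto
        also have "\<dots> = R * ?t" using b t by simp
        finally have "real (Suc n) * norm (\<rho> (?t *\<^sub>R b + x) - \<rho> x) \<le> real (Suc n) * (R * ?t)"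
          by (intro mult_left_mono) auto
        then show ?thesis using True by (simp add: q_def abs_mult)
      next
        case False
        have "norm x \<le> norm (?t *\<^sub>R b + x) + norm (?t *\<^sub>R b)"
          using norm_triangle_ineq4[of "?t *\<^sub>R b + x" "?t *\<^sub>R b"] by simp
        moreover have "norm (?t *\<^sub>R b) = ?t" using b by simp
        ultimately have "norm (?t *\<^sub>R b + x) > r" using False t(2) by linarith
        then have "\<rho> (?t *\<^sub>R b + x) = 0" "\<rho> x = 0"
          using False r test_functions_outside(1)[OF \<rho>] by (meson add_increasing2 not_le order_trans zero_le_one)+
        then show ?thesis using False by (simp add: q_def)
      qed
    qed
  qed (auto simp: q_def[abs_def])
  ultimately have "(\<integral>x. partial b \<rho> x \<partial>lborel) = 0" by (simp add: LIMSEQ_const_iff)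
  moreover have "partial b \<rho> x = 0" if "x \<notin> \<Omega>" for x
    using test_functions_outside(2)[OF \<rho> that] inner_grad[OF b, of \<rho> x] by simp
  ultimately show ?thesis by (simp add: integral_lborel_eq_domain)
qed

end

section \<open>The closure of the test functions\<close>

context bounded_domain
begin

text \<open>Closure of the pairs of a test function and its gradient. Unlike in \<open>W11_0\<close>
  the gradient is an explicit component, so limits and the chain rule act on the pair, and the
  weak-gradient identity becomes a consequence.\<close>

definition test_closure :: "('a \<Rightarrow> real) \<Rightarrow> ('a \<Rightarrow> 'a) \<Rightarrow> bool" where
  "test_closure u g \<longleftrightarrow> integrable \<mu> u \<and> integrable \<mu> g \<and>
    (\<forall>\<epsilon>>0. \<exists>\<phi>\<in>test_functions \<Omega>.
      (\<integral>x. \<bar>u x - \<phi> x\<bar> \<partial>\<mu>) + (\<integral>x. norm (g x - grad \<phi> x) \<partial>\<mu>) < \<epsilon>)"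

lemma integral_by_parts_test:
  assumes \<phi>: "\<phi> \<in> test_functions \<Omega>" and \<psi>: "\<psi> \<in> test_functions \<Omega>" and b: "b \<in> Basis"
  shows "(\<integral>x. \<phi> x * partial b \<psi> x \<partial>\<mu>) + (\<integral>x. partial b \<phi> x * \<psi> x \<partial>\<mu>) = 0"
proof -
  note d = test_functions_differentiable[OF \<phi>] test_functions_differentiable[OF \<psi>]
  have T: "(\<lambda>x. \<phi> x * \<psi> x) \<in> test_functions \<Omega>"
  proof -
    obtain K where "\<And>k. Ck k \<phi>" "compact K" "K \<subseteq> \<Omega>" "\<And>x. x \<notin> K \<Longrightarrow> \<phi> x = 0"
      using test_functionsE[OF \<phi>] by metis
    moreover have "Ck k \<psi>" for k using \<psi> by (simp add: test_functions_def)
    ultimately show ?thesis by (intro test_functionsI[of _ K]) (auto intro: Ck_mult)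
  qed
  have "partial b (\<lambda>x. \<phi> x * \<psi> x) x = \<phi> x * partial b \<psi> x + partial b \<phi> x * \<psi> x" for x
    using partial_eqI[OF has_derivative_mult[OF has_derivative_frechet[OF d(1)] has_derivative_frechet[OF d(2)]], of b x]
    by (simp add: partial_def)
  then have "(\<integral>x. \<phi> x * partial b \<psi> x + partial b \<phi> x * \<psi> x \<partial>\<mu>) = 0"
    using integral_partial_test[OF T b] by simp
  moreover obtain R where R: "R > 0" "\<And>x. \<bar>\<phi> x\<bar> \<le> R" "\<And>x. norm (grad \<phi> x) \<le> R" using test_bounded[OF \<phi>] by metis
  obtain S where S: "S > 0" "\<And>x. \<bar>\<psi> x\<bar> \<le> S" "\<And>x. norm (grad \<psi> x) \<le> S" using test_bounded[OF \<psi>] by metis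
  note [measurable] = test_measurable[OF \<phi>] test_measurable[OF \<psi>]
  have "integrable \<mu> (\<lambda>x. \<phi> x * (grad \<psi> x \<bullet> b))"
  proof (rule integrable_bounded[where B="R * S"])
    show "norm (\<phi> x * (grad \<psi> x \<bullet> b)) \<le> R * S" for x
      using R S Basis_le_norm[OF b, of "grad \<psi> x"]
      by (auto simp: abs_mult intro!: mult_mono intro: order_trans)
  qed measurable
  moreover have "integrable \<mu> (\<lambda>x. (grad \<phi> x \<bullet> b) * \<psi> x)"
  proof (rule integrable_bounded[where B="R * S"])
    show "norm ((grad \<phi> x \<bullet> b) * \<psi> x) \<le> R * S" for x
      using R S Basis_le_norm[OF b, of "grad \<phi> x"]
      by (auto simp: abs_mult intro!: mult_mono intro: order_trans)
  qed measurable
  ultimately show ?thesis using inner_grad[OF b] by simp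
qed

text \<open>For a fixed \<psi> with values and gradient bounded by S, both sides of the integration
  by parts formula are continuous in L^1. Approximation within \<epsilon> / S leaves a defect of at
  most \<epsilon>.\<close>

lemma test_closure_W11_gradient:
  assumes "test_closure u g"
  shows "W11_gradient \<Omega> u g"
  unfolding W11_gradient_def
proof (intro conjI ballI)
  show iu: "integrable \<mu> u" and ig: "integrable \<mu> g" using assms by (auto simp: test_closure_def)
  fix \<psi> b :: _
  assume \<psi>: "\<psi> \<in> test_functions \<Omega>" and b: "(b::'a) \<in> Basis"
  obtain S where S: "S > 0" "\<And>x. \<bar>\<psi> x\<bar> \<le> S" "\<And>x. norm (grad \<psi> x) \<le> S" using test_bounded[OF \<psi>] by metis
  note [measurable] = test_measurable[OF \<psi>]
  have pb: "\<bar>partial b \<psi> x\<bar> \<le> S" for x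
    using order_trans[OF Basis_le_norm[OF b] S(3)[of x]] by (simp add: inner_grad[OF b])
  have pm [measurable]: "partial b \<psi> \<in> borel_measurable \<mu>"
  proof -
    have "(\<lambda>x. grad \<psi> x \<bullet> b) \<in> borel_measurable \<mu>" by measurable
    then show ?thesis by (simp add: inner_grad[OF b])
  qed
  have i1: "integrable \<mu> (\<lambda>x. w x * partial b \<psi> x)" if "integrable \<mu> w" for w :: "'a \<Rightarrow> real"
    by (rule Bochner_Integration.integrable_bound[where f="\<lambda>x. S * w x"])
      (use that pb S in \<open>auto simp: abs_mult mult.commute[of "\<bar>w _\<bar>"] intro!: mult_right_mono\<close>)
  have i2: "integrable \<mu> (\<lambda>x. (w x \<bullet> b) * \<psi> x)" if "integrable \<mu> w" for w :: "'a \<Rightarrow> 'a"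
  proof (rule Bochner_Integration.integrable_bound[where f="\<lambda>x. S *\<^sub>R w x"])
    show "AE x in \<mu>. norm ((w x \<bullet> b) * \<psi> x) \<le> norm (S *\<^sub>R w x)"
    proof (intro AE_I2)
      fix x
      have "\<bar>w x \<bullet> b\<bar> * \<bar>\<psi> x\<bar> \<le> norm (w x) * S"
        using S Basis_le_norm[OF b, of "w x"] by (intro mult_mono) auto
      then show "norm ((w x \<bullet> b) * \<psi> x) \<le> norm (S *\<^sub>R w x)" using S by (simp add: abs_mult mult.commute)
    qed
  qed (use that in auto)
  let ?e = "(\<integral>x. u x * partial b \<psi> x \<partial>\<mu>) + (\<integral>x. (g x \<bullet> b) * \<psi> x \<partial>\<mu>)"
  have "\<bar>?e\<bar> \<le> 0 + \<epsilon>" if "\<epsilon> > 0" for \<epsilon>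
  proof -
    obtain \<phi> where \<phi>: "\<phi> \<in> test_functions \<Omega>"
      "(\<integral>x. \<bar>u x - \<phi> x\<bar> \<partial>\<mu>) + (\<integral>x. norm (g x - grad \<phi> x) \<partial>\<mu>) < \<epsilon> / S"
      using assms \<open>\<epsilon> > 0\<close> S(1) unfolding test_closure_def by (meson divide_pos_pos)
    have iu\<phi>: "integrable \<mu> (\<lambda>x. u x - \<phi> x)" and ig\<phi>: "integrable \<mu> (\<lambda>x. g x - grad \<phi> x)"
      using iu ig test_integrable[OF \<phi>(1)] by auto
    have "?e = (\<integral>x. (u x - \<phi> x) * partial b \<psi> x \<partial>\<mu>) + (\<integral>x. ((g x - grad \<phi> x) \<bullet> b) * \<psi> x \<partial>\<mu>)"
    proof -
      have "(\<integral>x. (u x - \<phi> x) * partial b \<psi> x \<partial>\<mu>) = (\<integral>x. u x * partial b \<psi> x \<partial>\<mu>) - (\<integral>x. \<phi> x * partial b \<psi> x \<partial>\<mu>)"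
        using i1[OF iu] i1[OF test_integrable(1)[OF \<phi>(1)]] by (simp add: left_diff_distrib)
      moreover have "(\<integral>x. ((g x - grad \<phi> x) \<bullet> b) * \<psi> x \<partial>\<mu>) = (\<integral>x. (g x \<bullet> b) * \<psi> x \<partial>\<mu>) - (\<integral>x. (grad \<phi> x \<bullet> b) * \<psi> x \<partial>\<mu>)"
        using i2[OF ig] i2[OF test_integrable(2)[OF \<phi>(1)]] by (simp add: left_diff_distrib inner_diff_left)
      ultimately show ?thesis using integral_by_parts_test[OF \<phi>(1) \<psi> b] by (simp add: inner_grad[OF b])
    qed
    also have "\<bar>\<dots>\<bar> \<le> (\<integral>x. S * \<bar>u x - \<phi> x\<bar> \<partial>\<mu>) + (\<integral>x. S * norm (g x - grad \<phi> x) \<partial>\<mu>)"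
    proof (rule order_trans[OF abs_triangle_ineq add_mono])
      show "\<bar>\<integral>x. (u x - \<phi> x) * partial b \<psi> x \<partial>\<mu>\<bar> \<le> (\<integral>x. S * \<bar>u x - \<phi> x\<bar> \<partial>\<mu>)"
      proof (rule order_trans[OF integral_abs_bound integral_mono])
        show "\<bar>(u x - \<phi> x) * partial b \<psi> x\<bar> \<le> S * \<bar>u x - \<phi> x\<bar>" for x
          using mult_right_mono[OF pb[of x], of "\<bar>u x - \<phi> x\<bar>"] by (simp add: abs_mult mult.commute)
      qed (use i1[OF iu\<phi>] iu\<phi> in auto)
      show "\<bar>\<integral>x. ((g x - grad \<phi> x) \<bullet> b) * \<psi> x \<partial>\<mu>\<bar> \<le> (\<integral>x. S * norm (g x - grad \<phi> x) \<partial>\<mu>)"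
      proof (rule order_trans[OF integral_abs_bound integral_mono])
        show "\<bar>((g x - grad \<phi> x) \<bullet> b) * \<psi> x\<bar> \<le> S * norm (g x - grad \<phi> x)" for x
          using mult_mono[OF Basis_le_norm[OF b, of "g x - grad \<phi> x"] S(2)[of x]] by (simp add: abs_mult mult.commute)
      qed (use i2[OF ig\<phi>] ig\<phi> in auto)
    qed
    also have "\<dots> = S * ((\<integral>x. \<bar>u x - \<phi> x\<bar> \<partial>\<mu>) + (\<integral>x. norm (g x - grad \<phi> x) \<partial>\<mu>))"
      by (simp add: algebra_simps)
    also have "\<dots> \<le> S * (\<epsilon> / S)" using \<phi>(2) S by (intro mult_left_mono) auto
    finally show ?thesis using S by simp
  qed
  then have "\<bar>?e\<bar> \<le> 0" by (rule field_le_epsilon)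
  then show "(\<integral>x. u x * partial b \<psi> x \<partial>\<mu>) = - (\<integral>x. (g x \<bullet> b) * \<psi> x \<partial>\<mu>)" by simp
qed

lemma test_closure_W11_0: "test_closure u g \<Longrightarrow> u \<in> W11_0 \<Omega>"
  using test_closure_W11_gradient unfolding W11_0_def test_closure_def by blast

lemma test_closure_limit:
  assumes u: "integrable \<mu> u" "integrable \<mu> g"
    and n: "\<And>n. test_closure (us n) (gs n)"
    and lim: "(\<lambda>n. \<integral>x. \<bar>us n x - u x\<bar> \<partial>\<mu>) \<longlonglongrightarrow> 0" "(\<lambda>n. \<integral>x. norm (gs n x - g x) \<partial>\<mu>) \<longlonglongrightarrow> 0"
  shows "test_closure u g"
  unfolding test_closure_def
proof (intro conjI allI impI u)
  fix \<epsilon> :: real assume \<epsilon>: "\<epsilon> > 0"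
  have "(\<lambda>n. (\<integral>x. \<bar>us n x - u x\<bar> \<partial>\<mu>) + (\<integral>x. norm (gs n x - g x) \<partial>\<mu>)) \<longlonglongrightarrow> 0 + 0"
    by (intro tendsto_add lim)
  then have "eventually (\<lambda>n. (\<integral>x. \<bar>us n x - u x\<bar> \<partial>\<mu>) + (\<integral>x. norm (gs n x - g x) \<partial>\<mu>) < \<epsilon> / 2) sequentially"
    using \<epsilon> by (intro order_tendstoD(2)) auto
  then obtain N where N: "(\<integral>x. \<bar>us N x - u x\<bar> \<partial>\<mu>) + (\<integral>x. norm (gs N x - g x) \<partial>\<mu>) < \<epsilon> / 2"
    using eventually_happens by force
  have iN: "integrable \<mu> (us N)" "integrable \<mu> (gs N)" using n[of N] by (auto simp: test_closure_def)
  obtain \<phi> where \<phi>: "\<phi> \<in> test_functions \<Omega>"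
    "(\<integral>x. \<bar>us N x - \<phi> x\<bar> \<partial>\<mu>) + (\<integral>x. norm (gs N x - grad \<phi> x) \<partial>\<mu>) < \<epsilon> / 2"
    using n[of N] \<epsilon> unfolding test_closure_def by (meson half_gt_zero)
  have "(\<integral>x. \<bar>u x - \<phi> x\<bar> \<partial>\<mu>) \<le> (\<integral>x. \<bar>us N x - u x\<bar> + \<bar>us N x - \<phi> x\<bar> \<partial>\<mu>)"
    using u iN test_integrable[OF \<phi>(1)] by (intro integral_mono) auto
  moreover have "(\<integral>x. norm (g x - grad \<phi> x) \<partial>\<mu>) \<le> (\<integral>x. norm (gs N x - g x) + norm (gs N x - grad \<phi> x) \<partial>\<mu>)"
  proof (rule integral_mono)
    show "norm (g x - grad \<phi> x) \<le> norm (gs N x - g x) + norm (gs N x - grad \<phi> x)" for x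
      using norm_triangle_ineq4[of "gs N x - grad \<phi> x" "gs N x - g x"] by (simp add: add.commute)
  qed (use u iN test_integrable[OF \<phi>(1)] in auto)
  ultimately have "(\<integral>x. \<bar>u x - \<phi> x\<bar> \<partial>\<mu>) + (\<integral>x. norm (g x - grad \<phi> x) \<partial>\<mu>) < \<epsilon>"
    using N \<phi>(2) u iN test_integrable[OF \<phi>(1)] by simp
  then show "\<exists>\<phi>\<in>test_functions \<Omega>. (\<integral>x. \<bar>u x - \<phi> x\<bar> \<partial>\<mu>) + (\<integral>x. norm (g x - grad \<phi> x) \<partial>\<mu>) < \<epsilon>"
    using \<phi>(1) by blast
qed

text \<open>F(\<phi>) is only C^1 and so enters through the closure, by means of its polynomial
  approximations.\<close>

lemma test_closure_compose_test:
  fixes F F' :: "real \<Rightarrow> real"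
  assumes \<phi>: "\<phi> \<in> test_functions \<Omega>"
    and F: "\<And>s. (F has_real_derivative F' s) (at s)" "continuous_on UNIV F'" "F 0 = 0"
  shows "test_closure (\<lambda>x. F (\<phi> x)) (\<lambda>x. F' (\<phi> x) *\<^sub>R grad \<phi> x)"
  unfolding test_closure_def
proof (intro conjI allI impI)
  have cF: "continuous_on UNIV F" by (rule DERIV_continuous_on[OF has_field_derivative_at_within[OF F(1)]])
  obtain B where B: "B > 0" "\<And>x. \<bar>F (\<phi> x)\<bar> \<le> B" using compose_bounded[OF \<phi> cF] by metis
  obtain B' where B': "B' > 0" "\<And>x. \<bar>F' (\<phi> x)\<bar> \<le> B'" using compose_bounded[OF \<phi> F(2)] by metis
  obtain R where R: "R > 0" "\<And>x. norm (grad \<phi> x) \<le> R" using test_bounded[OF \<phi>] by metis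
  note [measurable] = test_measurable[OF \<phi>]
    measurable_cont_compose[OF cF test_measurable(1)[OF \<phi>]]
    measurable_cont_compose[OF F(2) test_measurable(1)[OF \<phi>]]
  show 1: "integrable \<mu> (\<lambda>x. F (\<phi> x))" using B by (intro integrable_bounded[where B=B]) auto
  show 2: "integrable \<mu> (\<lambda>x. F' (\<phi> x) *\<^sub>R grad \<phi> x)"
    using B' R by (intro integrable_bounded[where B="B' * R"]) (auto intro!: mult_mono simp: less_imp_le)
  fix \<epsilon> :: real assume \<epsilon>: "\<epsilon> > 0"
  define G where "G = (\<integral>x. norm (grad \<phi> x) \<partial>\<mu>)"
  have G: "G \<ge> 0" unfolding G_def by (auto intro!: integral_nonneg_AE)
  define e where "e = \<epsilon> / 2 / (measure \<mu> \<Omega> + G + 1)"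
  have D: "0 < measure \<mu> \<Omega> + G + 1" using G measure_nonneg[of \<mu> \<Omega>] by linarith
  then have e: "e > 0" using \<epsilon> by (simp add: e_def)
  have eD: "e * (measure \<mu> \<Omega> + G + 1) = \<epsilon> / 2"
    using D e_def by (metis less_irrefl nonzero_eq_divide_eq)
  obtain \<psi> where \<psi>: "\<psi> \<in> test_functions \<Omega>" "\<And>x. \<bar>\<psi> x - F (\<phi> x)\<bar> \<le> e"
    "\<And>x. norm (grad \<psi> x - F' (\<phi> x) *\<^sub>R grad \<phi> x) \<le> e * norm (grad \<phi> x)"
    using test_functions_compose_approx[OF bounded_domain \<phi> F e] by metis
  have "(\<integral>x. \<bar>F (\<phi> x) - \<psi> x\<bar> \<partial>\<mu>) \<le> (\<integral>x. e \<partial>\<mu>)"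
    using 1 test_integrable[OF \<psi>(1)] \<psi>(2) by (intro integral_mono) (auto simp: abs_minus_commute)
  moreover have "(\<integral>x. norm (F' (\<phi> x) *\<^sub>R grad \<phi> x - grad \<psi> x) \<partial>\<mu>) \<le> (\<integral>x. e * norm (grad \<phi> x) \<partial>\<mu>)"
    using 2 test_integrable[OF \<psi>(1)] test_integrable[OF \<phi>] \<psi>(3)
    by (intro integral_mono) (auto simp: norm_minus_commute)
  ultimately have "(\<integral>x. \<bar>F (\<phi> x) - \<psi> x\<bar> \<partial>\<mu>) + (\<integral>x. norm (F' (\<phi> x) *\<^sub>R grad \<phi> x - grad \<psi> x) \<partial>\<mu>)
      \<le> e * (measure \<mu> \<Omega> + G)" by (simp add: G_def algebra_simps)
  also have "\<dots> \<le> \<epsilon> / 2" using e eD by (simp add: algebra_simps)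
  also have "\<dots> < \<epsilon>" using \<epsilon> by simp
  finally show "\<exists>\<psi>\<in>test_functions \<Omega>.
      (\<integral>x. \<bar>F (\<phi> x) - \<psi> x\<bar> \<partial>\<mu>) + (\<integral>x. norm (F' (\<phi> x) *\<^sub>R grad \<phi> x - grad \<psi> x) \<partial>\<mu>) < \<epsilon>"
    using \<psi>(1) by blast
qed

text \<open>Chain rule for the limit v, for F with bounded derivative. The difference of gradients
  splits into F'(\<phi>) applied to the difference of \<nabla>\<phi> and V, small in L^1, and the
  difference of F'(\<phi>) and F'(v) applied to V. The latter needs the almost everywhere
  convergence of \<phi>, with 2 L |V| as majorant.\<close>

lemma test_closure_compose:
  fixes F F' :: "real \<Rightarrow> real"
  assumes \<phi>: "\<And>n. \<phi> n \<in> test_functions \<Omega>" and v: "integrable \<mu> v" "integrable \<mu> V"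
    and ae: "AE x in \<mu>. (\<lambda>n. \<phi> n x) \<longlonglongrightarrow> v x"
    and L1: "(\<lambda>n. \<integral>x. norm (\<phi> n x - v x) \<partial>\<mu>) \<longlonglongrightarrow> 0" "(\<lambda>n. \<integral>x. norm (grad (\<phi> n) x - V x) \<partial>\<mu>) \<longlonglongrightarrow> 0"
    and F: "\<And>s. (F has_real_derivative F' s) (at s)" "continuous_on UNIV F'" "F 0 = 0"
    and L: "\<And>s. \<bar>F' s\<bar> \<le> L"
  shows "test_closure (\<lambda>x. F (v x)) (\<lambda>x. F' (v x) *\<^sub>R V x)"
proof (rule test_closure_limit[OF _ _ test_closure_compose_test[OF \<phi> F]])
  have lip: "\<bar>F s - F t\<bar> \<le> L * \<bar>s - t\<bar>" for s t
    using field_differentiable_bound[of UNIV F F' L s t] F(1) L by simp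
  have L0: "L \<ge> 0" using L[of 0] by linarith
  have cF: "continuous_on UNIV F" by (rule DERIV_continuous_on[OF has_field_derivative_at_within[OF F(1)]])
  have vm: "v \<in> borel_measurable \<mu>" using v by auto
  note [measurable] = test_measurable[OF \<phi>] vm
    measurable_cont_compose[OF cF vm] measurable_cont_compose[OF F(2) vm]
    measurable_cont_compose[OF cF test_measurable(1)[OF \<phi>]]
    measurable_cont_compose[OF F(2) test_measurable(1)[OF \<phi>]]
  show iF: "integrable \<mu> (\<lambda>x. F (v x))"
    by (rule Bochner_Integration.integrable_bound[where f="\<lambda>x. L * v x"])
      (use v lip[of _ 0] F(3) L0 in \<open>auto simp: abs_mult\<close>)
  have b: "norm (F' s *\<^sub>R w) \<le> L * norm w" for s and w :: 'a
    using mult_right_mono[OF L, of "norm w" s] by simp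
  show iV: "integrable \<mu> (\<lambda>x. F' (v x) *\<^sub>R V x)"
    by (rule Bochner_Integration.integrable_bound[where f="\<lambda>x. L *\<^sub>R V x"])
      (use v b L0 in auto)
  have i1: "integrable \<mu> (\<lambda>x. norm (\<phi> n x - v x))" "integrable \<mu> (\<lambda>x. norm (grad (\<phi> n) x - V x))" for n
    using v test_integrable[OF \<phi>] by auto
  have iFn: "integrable \<mu> (\<lambda>x. F (\<phi> n x))" "integrable \<mu> (\<lambda>x. F' (\<phi> n x) *\<^sub>R grad (\<phi> n) x)" for n
    using test_closure_compose_test[OF \<phi> F] by (auto simp: test_closure_def)
  show "(\<lambda>n. \<integral>x. \<bar>F (\<phi> n x) - F (v x)\<bar> \<partial>\<mu>) \<longlonglongrightarrow> 0"
  proof (rule Lim_null_comparison)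
    show "eventually (\<lambda>n. norm (\<integral>x. \<bar>F (\<phi> n x) - F (v x)\<bar> \<partial>\<mu>) \<le> L * (\<integral>x. norm (\<phi> n x - v x) \<partial>\<mu>)) sequentially"
    proof (intro always_eventually allI)
      fix n
      have "(\<integral>x. \<bar>F (\<phi> n x) - F (v x)\<bar> \<partial>\<mu>) \<le> (\<integral>x. L * norm (\<phi> n x - v x) \<partial>\<mu>)"
        using iF iFn i1 lip by (intro integral_mono) auto
      then show "norm (\<integral>x. \<bar>F (\<phi> n x) - F (v x)\<bar> \<partial>\<mu>) \<le> L * (\<integral>x. norm (\<phi> n x - v x) \<partial>\<mu>)" by simp
    qed
    show "(\<lambda>n. L * (\<integral>x. norm (\<phi> n x - v x) \<partial>\<mu>)) \<longlonglongrightarrow> 0" by (rule tendsto_mult_right_zero[OF L1(1)])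
  qed
  have iD: "integrable \<mu> (\<lambda>x. \<bar>F' (\<phi> n x) - F' (v x)\<bar> * norm (V x))" for n
  proof (rule Bochner_Integration.integrable_bound[where f="\<lambda>x. (2 * L) *\<^sub>R V x"])
    show "AE x in \<mu>. norm (\<bar>F' (\<phi> n x) - F' (v x)\<bar> * norm (V x)) \<le> norm ((2 * L) *\<^sub>R V x)"
    proof (intro AE_I2)
      fix x
      have "\<bar>F' (\<phi> n x) - F' (v x)\<bar> \<le> 2 * L" using L[of "\<phi> n x"] L[of "v x"] by linarith
      then show "norm (\<bar>F' (\<phi> n x) - F' (v x)\<bar> * norm (V x)) \<le> norm ((2 * L) *\<^sub>R V x)"
        using L0 by (simp add: abs_mult mult_right_mono)
    qed
  qed (use v in auto)
  have D0: "(\<lambda>n. \<integral>x. \<bar>F' (\<phi> n x) - F' (v x)\<bar> * norm (V x) \<partial>\<mu>) \<longlonglongrightarrow> (\<integral>x. 0 \<partial>\<mu>)"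
  proof (rule integral_dominated_convergence[where w="\<lambda>x. 2 * L * norm (V x)"])
    show "AE x in \<mu>. (\<lambda>n. \<bar>F' (\<phi> n x) - F' (v x)\<bar> * norm (V x)) \<longlonglongrightarrow> 0"
      using ae
    proof eventually_elim
      case (elim x)
      have "isCont F' (v x)" using F(2) by (simp add: continuous_on_eq_continuous_at)
      then have "(\<lambda>n. F' (\<phi> n x)) \<longlonglongrightarrow> F' (v x)" using elim by (rule isCont_tendsto_compose)
      from tendsto_rabs_zero[OF LIM_zero[OF this]] show ?case by (rule tendsto_mult_left_zero)
    qed
    show "AE x in \<mu>. norm (\<bar>F' (\<phi> n x) - F' (v x)\<bar> * norm (V x)) \<le> 2 * L * norm (V x)" for n
    proof (intro AE_I2)
      fix x
      have "\<bar>F' (\<phi> n x) - F' (v x)\<bar> \<le> 2 * L" using L[of "\<phi> n x"] L[of "v x"] by linarith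
      then show "norm (\<bar>F' (\<phi> n x) - F' (v x)\<bar> * norm (V x)) \<le> 2 * L * norm (V x)"
        by (simp add: abs_mult mult_right_mono)
    qed
  qed (use v iD in auto)
  show "(\<lambda>n. \<integral>x. norm (F' (\<phi> n x) *\<^sub>R grad (\<phi> n) x - F' (v x) *\<^sub>R V x) \<partial>\<mu>) \<longlonglongrightarrow> 0"
  proof (rule Lim_null_comparison)
    let ?r = "\<lambda>n. L * (\<integral>x. norm (grad (\<phi> n) x - V x) \<partial>\<mu>) + (\<integral>x. \<bar>F' (\<phi> n x) - F' (v x)\<bar> * norm (V x) \<partial>\<mu>)"
    show "eventually (\<lambda>n. norm (\<integral>x. norm (F' (\<phi> n x) *\<^sub>R grad (\<phi> n) x - F' (v x) *\<^sub>R V x) \<partial>\<mu>) \<le> ?r n) sequentially"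
    proof (intro always_eventually allI)
      fix n
      have "(\<integral>x. norm (F' (\<phi> n x) *\<^sub>R grad (\<phi> n) x - F' (v x) *\<^sub>R V x) \<partial>\<mu>)
          \<le> (\<integral>x. L * norm (grad (\<phi> n) x - V x) + \<bar>F' (\<phi> n x) - F' (v x)\<bar> * norm (V x) \<partial>\<mu>)"
      proof (rule integral_mono)
        fix x
        have "F' (\<phi> n x) *\<^sub>R grad (\<phi> n) x - F' (v x) *\<^sub>R V x
            = F' (\<phi> n x) *\<^sub>R (grad (\<phi> n) x - V x) + (F' (\<phi> n x) - F' (v x)) *\<^sub>R V x"
          by (simp add: algebra_simps)
        also have "norm \<dots> \<le> norm (F' (\<phi> n x) *\<^sub>R (grad (\<phi> n) x - V x)) + norm ((F' (\<phi> n x) - F' (v x)) *\<^sub>R V x)"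
          by (rule norm_triangle_ineq)
        also have "\<dots> \<le> L * norm (grad (\<phi> n) x - V x) + \<bar>F' (\<phi> n x) - F' (v x)\<bar> * norm (V x)"
          using b[of "\<phi> n x" "grad (\<phi> n) x - V x"] by simp
        finally show "norm (F' (\<phi> n x) *\<^sub>R grad (\<phi> n) x - F' (v x) *\<^sub>R V x)
          \<le> L * norm (grad (\<phi> n) x - V x) + \<bar>F' (\<phi> n x) - F' (v x)\<bar> * norm (V x)" .
      qed (use i1 iD iV iFn in auto)
      also have "\<dots> = ?r n" using i1 iD by simp
      finally show "norm (\<integral>x. norm (F' (\<phi> n x) *\<^sub>R grad (\<phi> n) x - F' (v x) *\<^sub>R V x) \<partial>\<mu>) \<le> ?r n" by simp
    qed
    show "?r \<longlonglongrightarrow> 0"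
      using tendsto_add[OF tendsto_mult_right_zero[OF L1(2), of L] D0] by simp
  qed
qed

end

section \<open>Existence\<close>

context elliptic_coefficient
begin

text \<open>The data are truncations of f whose level is chosen so that the L^1 error is below
  2^(-n). With this rate and errors 4^(-n), the increments of the gradients are bounded by a
  geometric series, and the Poincare inequality gives the same for the functions.\<close>

lemma linear_limit:
  fixes f :: "'a \<Rightarrow> real"
  assumes f: "integrable \<mu> f"
  shows "\<exists>h \<phi> v V. (\<forall>n. approx_sol (h n) ((1/4) ^ n) (\<phi> n)) \<and> (\<forall>n. integrable \<mu> (h n)) \<and>
    (\<forall>n x. \<bar>h n x\<bar> \<le> \<bar>f x\<bar>) \<and> integrable \<mu> v \<and> integrable \<mu> V \<and>
    (AE x in \<mu>. (\<lambda>n. \<phi> n x) \<longlonglongrightarrow> v x) \<and> (AE x in \<mu>. (\<lambda>n. grad (\<phi> n) x) \<longlonglongrightarrow> V x) \<and>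
    (\<lambda>n. \<integral>x. norm (\<phi> n x - v x) \<partial>\<mu>) \<longlonglongrightarrow> 0 \<and> (\<lambda>n. \<integral>x. norm (grad (\<phi> n) x - V x) \<partial>\<mu>) \<longlonglongrightarrow> 0 \<and>
    (\<lambda>n. \<integral>x. \<bar>h n x - f x\<bar> \<partial>\<mu>) \<longlonglongrightarrow> 0"
proof -
  define T where "T N x = max (- real N) (min (f x) (real N))" for N x
  have fm [measurable]: "f \<in> borel_measurable \<mu>" using f by auto
  have Tm [measurable]: "T N \<in> borel_measurable \<mu>" for N unfolding T_def by measurable
  have Tf: "\<bar>T N x\<bar> \<le> \<bar>f x\<bar>" and TN: "\<bar>T N x\<bar> \<le> real N" for N x unfolding T_def by auto
  have iT: "integrable \<mu> (T N)" for N
    using f Tf by (intro Bochner_Integration.integrable_bound[OF f]) auto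
  have "(\<lambda>N. \<integral>x. \<bar>T N x - f x\<bar> \<partial>\<mu>) \<longlonglongrightarrow> (\<integral>x. 0 \<partial>\<mu>)"
  proof (rule integral_dominated_convergence[where w="\<lambda>x. 2 * \<bar>f x\<bar>"])
    show "AE x in \<mu>. (\<lambda>N. \<bar>T N x - f x\<bar>) \<longlonglongrightarrow> 0"
    proof (intro AE_I2 tendsto_eventually)
      fix x
      obtain n0 where "\<bar>f x\<bar> \<le> real n0" using real_arch_simple by blast
      then show "eventually (\<lambda>N. \<bar>T N x - f x\<bar> = 0) sequentially"
        by (intro eventually_sequentiallyI[of n0]) (auto simp: T_def)
    qed
    show "AE x in \<mu>. norm \<bar>T N x - f x\<bar> \<le> 2 * \<bar>f x\<bar>" for N
    proof (intro AE_I2)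
      show "norm \<bar>T N x - f x\<bar> \<le> 2 * \<bar>f x\<bar>" for x using Tf[of N x] by simp
    qed
  qed (use f in auto)
  then have T0: "(\<lambda>N. \<integral>x. \<bar>T N x - f x\<bar> \<partial>\<mu>) \<longlonglongrightarrow> 0" by simp
  have "\<exists>N. (\<integral>x. \<bar>T N x - f x\<bar> \<partial>\<mu>) < (1/2) ^ n" for n
  proof -
    have "eventually (\<lambda>N. (\<integral>x. \<bar>T N x - f x\<bar> \<partial>\<mu>) < (1/2) ^ n) sequentially"
      using T0 by (rule order_tendstoD) simp
    then show ?thesis using eventually_happens by force
  qed
  then obtain N where N: "\<And>n. (\<integral>x. \<bar>T (N n) x - f x\<bar> \<partial>\<mu>) < (1/2) ^ n" by metis
  define h where "h n = T (N n)" for n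
  have ih: "integrable \<mu> (h n)" for n unfolding h_def by (rule iT)
  have "\<exists>\<phi>. approx_sol (h n) ((1/4) ^ n) \<phi>" for n
    unfolding h_def using TN by (intro ex_approx_sol) auto
  then obtain \<phi> where sol: "\<And>n. approx_sol (h n) ((1/4) ^ n) (\<phi> n)" by metis
  have \<phi>: "\<phi> n \<in> test_functions \<Omega>" for n using sol[of n] by (simp add: approx_sol_def)
  obtain C where C: "\<And>h1 h2 \<eta>1 \<eta>2 \<phi>1 \<phi>2 d. approx_sol h1 \<eta>1 \<phi>1 \<longrightarrow> integrable \<mu> h1 \<longrightarrow>
     approx_sol h2 \<eta>2 \<phi>2 \<longrightarrow> integrable \<mu> h2 \<longrightarrow> 0 \<le> \<eta>1 \<longrightarrow> 0 \<le> \<eta>2 \<longrightarrow> 0 < d \<longrightarrow>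
     (\<integral>x. \<bar>h1 x - h2 x\<bar> \<partial>\<mu>) \<le> d \<longrightarrow> 2 * (\<eta>1 + \<eta>2) \<le> d\<^sup>2 \<longrightarrow>
     (\<integral>x. norm (grad \<phi>1 x - grad \<phi>2 x) \<partial>\<mu>) \<le> C * d"
    using gradient_diff_bound by blast
  \<comment> \<open>Here d = 2 * 2^(-n): the data differ by at most 2^(-n-1) + 2^(-n), and twice the
    sum of the two errors is 2.5 * 4^(-n), less than d^2 = 4 * 4^(-n).\<close>
  have gd: "(\<integral>x. norm (grad (\<phi> (Suc n)) x - grad (\<phi> n) x) \<partial>\<mu>) \<le> C * (2 * (1/2) ^ n)" for n
  proof (rule C[rule_format, OF sol ih sol ih])
    have "(\<integral>x. \<bar>h (Suc n) x - h n x\<bar> \<partial>\<mu>) \<le> (\<integral>x. \<bar>h (Suc n) x - f x\<bar> + \<bar>h n x - f x\<bar> \<partial>\<mu>)"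
      using ih f by (intro integral_mono) auto
    also have "\<dots> = (\<integral>x. \<bar>h (Suc n) x - f x\<bar> \<partial>\<mu>) + (\<integral>x. \<bar>h n x - f x\<bar> \<partial>\<mu>)" using ih f by simp
    also have "\<dots> \<le> (1/2) ^ Suc n + (1/2) ^ n"
      using N[of "Suc n"] N[of n] by (simp only: h_def)
    also have "\<dots> \<le> 2 * (1/2) ^ n" by simp
    finally show "(\<integral>x. \<bar>h (Suc n) x - h n x\<bar> \<partial>\<mu>) \<le> 2 * (1/2) ^ n" .
    have "((1/2::real) ^ n)\<^sup>2 = (1/4) ^ n" by (simp add: power2_eq_square flip: power_mult_distrib)
    then show "2 * ((1/4) ^ Suc n + (1/4) ^ n) \<le> (2 * (1/2::real) ^ n)\<^sup>2"
      by (simp add: power_mult_distrib)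
  qed auto
  have sg: "summable (\<lambda>n. \<integral>x. norm (grad (\<phi> (Suc n)) x - grad (\<phi> n) x) \<partial>\<mu>)"
  proof (rule summable_comparison_test'[where N=0])
    show "summable (\<lambda>n. C * (2 * (1/2::real) ^ n))" by (intro summable_mult summable_geometric) simp
  qed (use gd in auto)
  have pd: "(\<integral>x. norm (\<phi> (Suc n) x - \<phi> n x) \<partial>\<mu>)
      \<le> (measure \<mu> \<Omega> + 1) * (\<integral>x. norm (grad (\<phi> (Suc n)) x - grad (\<phi> n) x) \<partial>\<mu>)" for n
  proof -
    note d = test_functions_differentiable[OF \<phi>] test_functions_differentiable[OF test_functions_cmult[OF \<phi>]]
    have "grad (\<lambda>x. \<phi> (Suc n) x + (-1) * \<phi> n x) x = grad (\<phi> (Suc n)) x - grad (\<phi> n) x" for x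
      unfolding grad_add[OF d(1) d(2)] grad_cmult[OF d(1)] by simp
    then show ?thesis
      using Poincare_test[OF test_functions_add[OF \<phi>[of "Suc n"] test_functions_cmult[OF \<phi>[of n], of "-1"]]] by simp
  qed
  have sp: "summable (\<lambda>n. \<integral>x. norm (\<phi> (Suc n) x - \<phi> n x) \<partial>\<mu>)"
    by (rule summable_comparison_test'[where N=0, OF summable_mult[OF sg]]) (use pd in auto)
  obtain v where v: "integrable \<mu> v" "AE x in \<mu>. (\<lambda>n. \<phi> n x) \<longlonglongrightarrow> v x"
    "(\<lambda>n. \<integral>x. norm (\<phi> n x - v x) \<partial>\<mu>) \<longlonglongrightarrow> 0"
    by (rule summable_increments_L1_limit[OF test_integrable(1)[OF \<phi>] sp])
  obtain V where V: "integrable \<mu> V" "AE x in \<mu>. (\<lambda>n. grad (\<phi> n) x) \<longlonglongrightarrow> V x"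
    "(\<lambda>n. \<integral>x. norm (grad (\<phi> n) x - V x) \<partial>\<mu>) \<longlonglongrightarrow> 0"
    by (rule summable_increments_L1_limit[OF test_integrable(2)[OF \<phi>] sg])
  have "(\<lambda>n. \<integral>x. \<bar>h n x - f x\<bar> \<partial>\<mu>) \<longlonglongrightarrow> 0"
  proof (rule Lim_null_comparison)
    show "(\<lambda>n. (1/2::real) ^ n) \<longlonglongrightarrow> 0" by (rule LIMSEQ_power_zero) simp
  qed (use N in \<open>auto simp: h_def intro!: always_eventually less_imp_le\<close>)
  moreover have "\<forall>n x. \<bar>h n x\<bar> \<le> \<bar>f x\<bar>" using Tf by (simp add: h_def)
  ultimately show ?thesis using sol ih v V by (intro exI[of _ h] exI[of _ \<phi>] exI[of _ v] exI[of _ V]) simp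
qed

text \<open>For fixed \<psi>, the bound \<eta> times the squared norm of \<nabla>\<psi> tends to 0,
  while L^1 convergence of gradients and data identifies the limit of the residual.\<close>

lemma linear_limit_equation:
  assumes sol: "\<And>n. approx_sol (h n) (\<eta> n) (\<phi> n)" and \<eta>: "\<eta> \<longlonglongrightarrow> 0"
    and h: "\<And>n. integrable \<mu> (h n)" "integrable \<mu> f" "(\<lambda>n. \<integral>x. \<bar>h n x - f x\<bar> \<partial>\<mu>) \<longlonglongrightarrow> 0"
    and V: "integrable \<mu> V" "(\<lambda>n. \<integral>x. norm (grad (\<phi> n) x - V x) \<partial>\<mu>) \<longlonglongrightarrow> 0"
    and \<psi>: "\<psi> \<in> test_functions \<Omega>"
  shows "(\<integral>x. a x * (V x \<bullet> grad \<psi> x) \<partial>\<mu>) = (\<integral>x. f x * \<psi> x \<partial>\<mu>)"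
proof -
  have \<phi>: "\<phi> n \<in> test_functions \<Omega>" for n using sol[of n] by (simp add: approx_sol_def)
  obtain R where R: "R > 0" "\<And>x. \<bar>\<psi> x\<bar> \<le> R" "\<And>x. norm (grad \<psi> x) \<le> R" using test_bounded[OF \<psi>] by metis
  have iV: "integrable \<mu> (\<lambda>x. a x * (V x \<bullet> grad \<psi> x))"
    by (intro integrable_coeff_real integrable_inner_test V \<psi>)
  have 1: "(\<lambda>n. \<integral>x. a x * (grad (\<phi> n) x \<bullet> grad \<psi> x) \<partial>\<mu>) \<longlonglongrightarrow> (\<integral>x. a x * (V x \<bullet> grad \<psi> x) \<partial>\<mu>)"
  proof (rule LIM_zero_cancel, rule Lim_null_comparison)
    show "(\<lambda>n. (\<beta> * R) * (\<integral>x. norm (grad (\<phi> n) x - V x) \<partial>\<mu>)) \<longlonglongrightarrow> 0"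
      by (rule tendsto_mult_right_zero[OF V(2)])
    show "eventually (\<lambda>n. norm ((\<integral>x. a x * (grad (\<phi> n) x \<bullet> grad \<psi> x) \<partial>\<mu>) - (\<integral>x. a x * (V x \<bullet> grad \<psi> x) \<partial>\<mu>))
        \<le> (\<beta> * R) * (\<integral>x. norm (grad (\<phi> n) x - V x) \<partial>\<mu>)) sequentially"
    proof (intro always_eventually allI)
      fix n
      have i: "integrable \<mu> (\<lambda>x. a x * ((grad (\<phi> n) x - V x) \<bullet> grad \<psi> x))"
        using V test_integrable[OF \<phi>] by (intro integrable_coeff_real integrable_inner_test \<psi>) auto
      have "(\<integral>x. a x * (grad (\<phi> n) x \<bullet> grad \<psi> x) \<partial>\<mu>) - (\<integral>x. a x * (V x \<bullet> grad \<psi> x) \<partial>\<mu>)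
          = (\<integral>x. a x * ((grad (\<phi> n) x - V x) \<bullet> grad \<psi> x) \<partial>\<mu>)"
        using iV integrable_coeff_inner[OF \<phi> \<psi>] by (simp add: inner_diff_left right_diff_distrib)
      also have "norm \<dots> \<le> (\<integral>x. (\<beta> * R) * norm (grad (\<phi> n) x - V x) \<partial>\<mu>)"
        unfolding real_norm_def
      proof (rule order_trans[OF integral_abs_bound integral_mono_AE])
        show "AE x in \<mu>. \<bar>a x * ((grad (\<phi> n) x - V x) \<bullet> grad \<psi> x)\<bar> \<le> \<beta> * R * norm (grad (\<phi> n) x - V x)"
          using a_bounds
        proof eventually_elim
          case (elim x)
          have "\<bar>(grad (\<phi> n) x - V x) \<bullet> grad \<psi> x\<bar> \<le> norm (grad (\<phi> n) x - V x) * R"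
            by (rule order_trans[OF Cauchy_Schwarz_ineq2 mult_left_mono]) (use R in auto)
          then have "\<bar>a x\<bar> * \<bar>(grad (\<phi> n) x - V x) \<bullet> grad \<psi> x\<bar> \<le> \<beta> * (norm (grad (\<phi> n) x - V x) * R)"
            using elim \<alpha>_pos \<beta>_pos by (intro mult_mono) auto
          then show ?case by (simp add: abs_mult mult_ac)
        qed
      qed (use i V test_integrable[OF \<phi>] in auto)
      finally show "norm ((\<integral>x. a x * (grad (\<phi> n) x \<bullet> grad \<psi> x) \<partial>\<mu>) - (\<integral>x. a x * (V x \<bullet> grad \<psi> x) \<partial>\<mu>))
        \<le> (\<beta> * R) * (\<integral>x. norm (grad (\<phi> n) x - V x) \<partial>\<mu>)" by simp
    qed
  qed
  have 2: "(\<lambda>n. \<integral>x. h n x * \<psi> x \<partial>\<mu>) \<longlonglongrightarrow> (\<integral>x. f x * \<psi> x \<partial>\<mu>)"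
  proof (rule LIM_zero_cancel, rule Lim_null_comparison)
    show "(\<lambda>n. R * (\<integral>x. \<bar>h n x - f x\<bar> \<partial>\<mu>)) \<longlonglongrightarrow> 0"
      by (rule tendsto_mult_right_zero[OF h(3)])
    show "eventually (\<lambda>n. norm ((\<integral>x. h n x * \<psi> x \<partial>\<mu>) - (\<integral>x. f x * \<psi> x \<partial>\<mu>))
        \<le> R * (\<integral>x. \<bar>h n x - f x\<bar> \<partial>\<mu>)) sequentially"
    proof (intro always_eventually allI)
      fix n
      have i: "integrable \<mu> (\<lambda>x. (h n x - f x) * \<psi> x)"
        using h by (intro integrable_mult_test \<psi>) auto
      have "(\<integral>x. h n x * \<psi> x \<partial>\<mu>) - (\<integral>x. f x * \<psi> x \<partial>\<mu>) = (\<integral>x. (h n x - f x) * \<psi> x \<partial>\<mu>)"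
        using integrable_mult_test[OF h(1) \<psi>] integrable_mult_test[OF h(2) \<psi>] by (simp add: left_diff_distrib)
      also have "norm \<dots> \<le> (\<integral>x. R * \<bar>h n x - f x\<bar> \<partial>\<mu>)"
        unfolding real_norm_def
      proof (rule order_trans[OF integral_abs_bound integral_mono])
        show "\<bar>(h n x - f x) * \<psi> x\<bar> \<le> R * \<bar>h n x - f x\<bar>" for x
          using mult_right_mono[OF R(2)[of x], of "\<bar>h n x - f x\<bar>"] by (simp add: abs_mult mult.commute)
      qed (use i h in auto)
      finally show "norm ((\<integral>x. h n x * \<psi> x \<partial>\<mu>) - (\<integral>x. f x * \<psi> x \<partial>\<mu>)) \<le> R * (\<integral>x. \<bar>h n x - f x\<bar> \<partial>\<mu>)" by simp
    qed
  qed
  have 3: "(\<lambda>n. (residual (h n) (\<phi> n) \<psi>)\<^sup>2) \<longlonglongrightarrow>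
      ((\<integral>x. a x * (V x \<bullet> grad \<psi> x) \<partial>\<mu>) - (\<integral>x. f x * \<psi> x \<partial>\<mu>))\<^sup>2"
    unfolding residual_def by (intro tendsto_intros 1 2)
  have 4: "(\<lambda>n. \<eta> n * (\<integral>x. (norm (grad \<psi> x))\<^sup>2 \<partial>\<mu>)) \<longlonglongrightarrow> 0" by (rule tendsto_mult_left_zero[OF \<eta>])
  have "((\<integral>x. a x * (V x \<bullet> grad \<psi> x) \<partial>\<mu>) - (\<integral>x. f x * \<psi> x \<partial>\<mu>))\<^sup>2 \<le> 0"
    by (rule LIMSEQ_le[OF 3 4]) (use sol \<psi> in \<open>auto simp: approx_sol_def\<close>)
  then show ?thesis by simp
qed

text \<open>The solution is u = G(v) with gradient G'(v) V. Its equation is that of v, because G'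
  cancels the degenerate weight; the real task is membership in \<open>W11_0\<close>, since G' is
  unbounded when \<theta> > 0. Truncations of G, which have bounded derivative, bridge the
  gap.\<close>

lemma ex_distributional_solution:
  fixes f :: "'a \<Rightarrow> real"
  assumes \<theta>: "0 \<le> \<theta>" "\<theta> < 1" and m: "m > 1" and \<sigma>: "\<theta> - p + 1 = p * (1 - 1 / m)"
    and fm: "f \<in> borel_measurable \<mu>" and fi: "integrable \<mu> (\<lambda>x. \<bar>f x\<bar> powr m)"
  shows "\<exists>u. distributional_solution \<Omega> a \<theta> f u"
proof -
  have f: "integrable \<mu> f"
  proof (rule Bochner_Integration.integrable_bound)
    show "integrable \<mu> (\<lambda>x. 1 + \<bar>f x\<bar> powr m)" using fi by simp
    show "AE x in \<mu>. norm (f x) \<le> norm (1 + \<bar>f x\<bar> powr m)"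
    proof (intro AE_I2)
      fix x
      have "\<bar>f x\<bar> \<le> 1 + \<bar>f x\<bar> powr m"
      proof (cases "\<bar>f x\<bar> \<le> 1")
        case False
        then have "\<bar>f x\<bar> powr 1 \<le> \<bar>f x\<bar> powr m" using m by (intro powr_mono) auto
        then show ?thesis by simp
      qed (simp add: add_increasing2)
      then show "norm (f x) \<le> norm (1 + \<bar>f x\<bar> powr m)" by simp
    qed
  qed (use fm in auto)
  obtain h \<phi> v V where sol_all: "\<forall>n. approx_sol (h n) ((1/4) ^ n) (\<phi> n)"
    and ih_all: "\<forall>n. integrable \<mu> (h n)"
    and hf_all: "\<forall>n x. \<bar>h n x\<bar> \<le> \<bar>f x\<bar>" and v: "integrable \<mu> v" and V: "integrable \<mu> V"
    and aev: "AE x in \<mu>. (\<lambda>n. \<phi> n x) \<longlonglongrightarrow> v x" and aeV: "AE x in \<mu>. (\<lambda>n. grad (\<phi> n) x) \<longlonglongrightarrow> V x"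
    and L1v: "(\<lambda>n. \<integral>x. norm (\<phi> n x - v x) \<partial>\<mu>) \<longlonglongrightarrow> 0"
    and L1V: "(\<lambda>n. \<integral>x. norm (grad (\<phi> n) x - V x) \<partial>\<mu>) \<longlonglongrightarrow> 0"
    and hL1: "(\<lambda>n. \<integral>x. \<bar>h n x - f x\<bar> \<partial>\<mu>) \<longlonglongrightarrow> 0"
    using linear_limit[OF f] by (elim exE conjE) (rule that)
  note sol = sol_all[rule_format] and ih = ih_all[rule_format] and hf = hf_all[rule_format]
  have \<phi>: "\<phi> n \<in> test_functions \<Omega>" for n using sol[of n] by (simp add: approx_sol_def)
  have \<eta>0: "(\<lambda>n. (1/4::real) ^ n) \<longlonglongrightarrow> 0" by (rule LIMSEQ_power_zero) simp
  obtain C where C_all: "\<forall>h \<eta> \<phi> k. approx_sol h \<eta> \<phi> \<longrightarrow> integrable \<mu> h \<longrightarrow> (\<forall>x. \<bar>h x\<bar> \<le> \<bar>f x\<bar>) \<longrightarrow>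
      0 \<le> \<eta> \<longrightarrow> 0 < k \<longrightarrow> \<eta> * (1 + \<bar>Gfun \<theta> (2 * k)\<bar>) powr 2 \<le> 1 \<longrightarrow>
      (\<integral>x. trunc_sol' \<theta> k (\<phi> x) * norm (grad \<phi> x) \<partial>\<mu>) \<le> C \<and>
      (\<integral>x. (1 + \<bar>trunc_sol \<theta> k (\<phi> x)\<bar>) powr p \<partial>\<mu>) \<le> C"
    using nonlinear_bound[OF \<theta> m \<sigma> fi fm] by (rule exE)
  note C = C_all[rule_format]
  have vm: "v \<in> borel_measurable \<mu>" and Vm [measurable]: "V \<in> borel_measurable \<mu>" using v V by auto
  define G where "G = Gfun \<theta>"
  define G' where "G' s = (1 + \<bar>G s\<bar>) powr \<theta>" for s
  have cG: "continuous_on UNIV G"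
    unfolding G_def by (rule DERIV_continuous_on[OF has_field_derivative_at_within[OF DERIV_Gfun[OF \<theta>(2,1)]]])
  have cG': "continuous_on UNIV G'" unfolding G'_def[abs_def] by (rule continuous_on_one_plus_abs_powr[OF cG])
  note [measurable] = vm measurable_cont_compose[OF cG vm] measurable_cont_compose[OF cG' vm] test_measurable[OF \<phi>]
  define k where "k j = real (Suc j)" for j
  have k: "k j > 0" for j by (simp add: k_def)
  let ?F = "\<lambda>j. trunc_sol \<theta> (k j)" and ?F' = "\<lambda>j. trunc_sol' \<theta> (k j)"
  note cF = continuous_on_trunc_sol[OF \<theta>(2,1) k]
  have FG: "\<bar>?F j s\<bar> \<le> \<bar>G s\<bar>" for j s
    unfolding trunc_sol_def G_def by (intro abs_Gfun_mono \<theta> abs_trunc_le k)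
  have F'0: "0 \<le> ?F' j s" for j s using trunc'_bounds by (simp add: trunc_sol'_def)
  have F'G: "?F' j s \<le> G' s" for j s
  proof -
    have "?F' j s \<le> (1 + \<bar>?F j s\<bar>) powr \<theta> * 1"
      unfolding trunc_sol'_def using trunc'_bounds by (intro mult_left_mono) auto
    also have "\<dots> \<le> G' s" unfolding G'_def using FG[of j s] \<theta> by (simp add: powr_mono2)
    finally show ?thesis .
  qed
  have limF: "(\<lambda>j. ?F j s) \<longlonglongrightarrow> G s" for s
  proof -
    have "isCont G s" using cG by (simp add: continuous_on_eq_continuous_at)
    from isCont_tendsto_compose[OF this tendsto_trunc[of s]]
    show ?thesis unfolding trunc_sol_def G_def k_def .
  qed
  have limF': "(\<lambda>j. ?F' j s) \<longlonglongrightarrow> G' s" for s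
  proof -
    have "(\<lambda>j. (1 + \<bar>?F j s\<bar>) powr \<theta>) \<longlonglongrightarrow> (1 + \<bar>G s\<bar>) powr \<theta>"
      by (intro tendsto_intros limF) auto
    from tendsto_mult[OF this tendsto_trunc'[of s]]
    show ?thesis by (simp add: trunc_sol'_def G'_def k_def)
  qed
  \<comment> \<open>For fixed j the factor depending on the truncation level is a constant, so
    4^(-n) eventually makes the product less than 1. The bound \<open>C\<close> itself does not
    depend on j.\<close>
  have bound: "eventually (\<lambda>n. (\<integral>x. ?F' j (\<phi> n x) * norm (grad (\<phi> n) x) \<partial>\<mu>) \<le> C \<and>
      (\<integral>x. (1 + \<bar>?F j (\<phi> n x)\<bar>) powr p \<partial>\<mu>) \<le> C) sequentially" for j
  proof -
    have "(\<lambda>n. (1/4) ^ n * (1 + \<bar>Gfun \<theta> (2 * k j)\<bar>) powr 2) \<longlonglongrightarrow> 0" by (rule tendsto_mult_left_zero[OF \<eta>0])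
    then have "eventually (\<lambda>n. (1/4) ^ n * (1 + \<bar>Gfun \<theta> (2 * k j)\<bar>) powr 2 < 1) sequentially"
      by (rule order_tendstoD) simp
    then show ?thesis by eventually_elim (intro C[OF sol ih hf _ k], auto)
  qed
  have cont_lim: "AE x in \<mu>. (\<lambda>n. H (\<phi> n x)) \<longlonglongrightarrow> H (v x)" if "continuous_on UNIV H" for H :: "real \<Rightarrow> real"
    using aev
  proof eventually_elim
    case (elim x)
    have "isCont H (v x)" using that by (simp add: continuous_on_eq_continuous_at)
    then show ?case using elim by (rule isCont_tendsto_compose)
  qed
  have j1: "integrable \<mu> (\<lambda>x. ?F' j (v x) * norm (V x))" "(\<integral>x. ?F' j (v x) * norm (V x) \<partial>\<mu>) \<le> C" for j
  proof -
    have *: "integrable \<mu> (\<lambda>x. ?F' j (\<phi> n x) * norm (grad (\<phi> n) x))" for n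
    proof -
      have "integrable \<mu> (\<lambda>x. ?F' j (\<phi> n x) *\<^sub>R grad (\<phi> n) x)"
        using test_closure_compose_test[OF \<phi> DERIV_trunc_sol[OF \<theta>(2,1) k] cF(2)] by (simp add: test_closure_def)
      from integrable_norm[OF this] show ?thesis using F'0 by simp
    qed
    have lim: "AE x in \<mu>. (\<lambda>n. ?F' j (\<phi> n x) * norm (grad (\<phi> n) x)) \<longlonglongrightarrow> ?F' j (v x) * norm (V x)"
      using cont_lim[OF cF(2)] aeV by eventually_elim (intro tendsto_intros)
    have m: "(\<lambda>x. ?F' j (v x) * norm (V x)) \<in> borel_measurable \<mu>"
      using measurable_cont_compose[OF cF(2) vm] by measurable
    have b: "eventually (\<lambda>n. (\<integral>x. ?F' j (\<phi> n x) * norm (grad (\<phi> n) x) \<partial>\<mu>) \<le> C) sequentially"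
      using bound[of j] by eventually_elim simp
    show "integrable \<mu> (\<lambda>x. ?F' j (v x) * norm (V x))" "(\<integral>x. ?F' j (v x) * norm (V x) \<partial>\<mu>) \<le> C"
      using Fatou_bounded[OF * _ m _ lim b] F'0 by auto
  qed
  have j2: "integrable \<mu> (\<lambda>x. (1 + \<bar>?F j (v x)\<bar>) powr p)" "(\<integral>x. (1 + \<bar>?F j (v x)\<bar>) powr p \<partial>\<mu>) \<le> C" for j
  proof -
    have c: "continuous_on UNIV (\<lambda>s. (1 + \<bar>?F j s\<bar>) powr p)" by (rule continuous_on_one_plus_abs_powr[OF cF(1)])
    have *: "integrable \<mu> (\<lambda>x. (1 + \<bar>?F j (\<phi> n x)\<bar>) powr p)" for n
    proof -
      obtain B where "B > 0" "\<And>x. \<bar>(1 + \<bar>?F j (\<phi> n x)\<bar>) powr p\<bar> \<le> B" using compose_bounded[OF \<phi> c] by metis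
      then show ?thesis
        using measurable_cont_compose[OF c test_measurable(1)[OF \<phi>]] by (intro integrable_bounded[where B=B]) auto
    qed
    have b: "eventually (\<lambda>n. (\<integral>x. (1 + \<bar>?F j (\<phi> n x)\<bar>) powr p \<partial>\<mu>) \<le> C) sequentially"
      using bound[of j] by eventually_elim simp
    show "integrable \<mu> (\<lambda>x. (1 + \<bar>?F j (v x)\<bar>) powr p)" "(\<integral>x. (1 + \<bar>?F j (v x)\<bar>) powr p \<partial>\<mu>) \<le> C"
      using Fatou_bounded[OF * _ measurable_cont_compose[OF c vm] _ cont_lim[OF c] b] by auto
  qed
  \<comment> \<open>Second use of Fatou's lemma, now in the truncation level; the first one, in n,
    produced \<open>j1\<close>.\<close>
  have iGV: "integrable \<mu> (\<lambda>x. G' (v x) * norm (V x))"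
  proof (rule Fatou_bounded[OF j1(1)])
    show "AE x in \<mu>. (\<lambda>j. ?F' j (v x) * norm (V x)) \<longlonglongrightarrow> G' (v x) * norm (V x)"
      by (intro AE_I2 tendsto_intros limF')
    show "eventually (\<lambda>j. (\<integral>x. ?F' j (v x) * norm (V x) \<partial>\<mu>) \<le> C) sequentially"
      using j1(2) by (intro always_eventually allI)
  qed (use F'0 in \<open>auto simp: G'_def\<close>)
  have iGp: "integrable \<mu> (\<lambda>x. (1 + \<bar>G (v x)\<bar>) powr p)"
  proof (rule Fatou_bounded[OF j2(1)])
    show "AE x in \<mu>. (\<lambda>j. (1 + \<bar>?F j (v x)\<bar>) powr p) \<longlonglongrightarrow> (1 + \<bar>G (v x)\<bar>) powr p"
      by (intro AE_I2 tendsto_intros limF) auto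
    show "eventually (\<lambda>j. (\<integral>x. (1 + \<bar>?F j (v x)\<bar>) powr p \<partial>\<mu>) \<le> C) sequentially"
      using j2(2) by (intro always_eventually allI)
  qed auto
  have iG: "integrable \<mu> (\<lambda>x. G (v x))"
  proof (rule Bochner_Integration.integrable_bound[OF iGp])
    show "AE x in \<mu>. norm (G (v x)) \<le> norm ((1 + \<bar>G (v x)\<bar>) powr p)"
    proof (intro AE_I2)
      fix x
      have "(1 + \<bar>G (v x)\<bar>) powr 1 \<le> (1 + \<bar>G (v x)\<bar>) powr p" using p_bounds by (intro powr_mono) auto
      then show "norm (G (v x)) \<le> norm ((1 + \<bar>G (v x)\<bar>) powr p)" by simp
    qed
  qed measurable
  have iGV': "integrable \<mu> (\<lambda>x. G' (v x) *\<^sub>R V x)"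
    by (rule Bochner_Integration.integrable_bound[OF iGV]) (auto simp: G'_def)
  have bF': "\<bar>?F' j s\<bar> \<le> (1 + \<bar>Gfun \<theta> (2 * k j)\<bar>) powr \<theta>" for j s
  proof -
    have "?F' j s \<le> (1 + \<bar>?F j s\<bar>) powr \<theta> * 1"
      unfolding trunc_sol'_def using trunc'_bounds by (intro mult_left_mono) auto
    also have "\<dots> \<le> (1 + \<bar>Gfun \<theta> (2 * k j)\<bar>) powr \<theta>"
      using abs_Gfun_mono[OF \<theta>(2,1), of "trunc (k j) s" "2 * k j"] abs_trunc_bound[OF k, of j s] k[of j] \<theta>
      by (simp add: trunc_sol_def powr_mono2)
    finally show ?thesis using F'0[of j s] by simp
  qed
  \<comment> \<open>Each truncated composition lies in the closure by
    \<open>test_closure_compose\<close>. The integrability just gained provides the majorants 2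
    |G(v)| and 2 G'(v) |V| for removing the truncation.\<close>
  have closure: "test_closure (\<lambda>x. G (v x)) (\<lambda>x. G' (v x) *\<^sub>R V x)"
  proof (rule test_closure_limit[OF iG iGV'])
    show tc: "test_closure (\<lambda>x. ?F j (v x)) (\<lambda>x. ?F' j (v x) *\<^sub>R V x)" for j
      by (rule test_closure_compose[OF \<phi> v V aev L1v L1V DERIV_trunc_sol[OF \<theta>(2,1) k] cF(2) trunc_sol_0 bF'])
    have it: "integrable \<mu> (\<lambda>x. ?F j (v x))" "integrable \<mu> (\<lambda>x. ?F' j (v x) *\<^sub>R V x)" for j
      using tc[of j] by (auto simp: test_closure_def)
    have "(\<lambda>j. \<integral>x. \<bar>?F j (v x) - G (v x)\<bar> \<partial>\<mu>) \<longlonglongrightarrow> (\<integral>x. 0 \<partial>\<mu>)"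
    proof (rule integral_dominated_convergence[where w="\<lambda>x. 2 * \<bar>G (v x)\<bar>"])
      show "AE x in \<mu>. (\<lambda>j. \<bar>?F j (v x) - G (v x)\<bar>) \<longlonglongrightarrow> 0"
        by (intro AE_I2 tendsto_rabs_zero LIM_zero limF)
      show "AE x in \<mu>. norm \<bar>?F j (v x) - G (v x)\<bar> \<le> 2 * \<bar>G (v x)\<bar>" for j
      proof (intro AE_I2)
        show "norm \<bar>?F j (v x) - G (v x)\<bar> \<le> 2 * \<bar>G (v x)\<bar>" for x using FG[of j "v x"] by simp
      qed
    qed (use iG it in auto)
    then show "(\<lambda>j. \<integral>x. \<bar>?F j (v x) - G (v x)\<bar> \<partial>\<mu>) \<longlonglongrightarrow> 0" by simp
    have "(\<lambda>j. \<integral>x. norm (?F' j (v x) *\<^sub>R V x - G' (v x) *\<^sub>R V x) \<partial>\<mu>) \<longlonglongrightarrow> (\<integral>x. 0 \<partial>\<mu>)"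
    proof (rule integral_dominated_convergence[where w="\<lambda>x. 2 * (G' (v x) * norm (V x))"])
      show "AE x in \<mu>. (\<lambda>j. norm (?F' j (v x) *\<^sub>R V x - G' (v x) *\<^sub>R V x)) \<longlonglongrightarrow> 0"
      proof (intro AE_I2)
        fix x
        have "(\<lambda>j. ?F' j (v x) *\<^sub>R V x) \<longlonglongrightarrow> G' (v x) *\<^sub>R V x" by (intro tendsto_intros limF')
        from tendsto_norm_zero[OF LIM_zero[OF this]]
        show "(\<lambda>j. norm (?F' j (v x) *\<^sub>R V x - G' (v x) *\<^sub>R V x)) \<longlonglongrightarrow> 0" .
      qed
      show "AE x in \<mu>. norm (norm (?F' j (v x) *\<^sub>R V x - G' (v x) *\<^sub>R V x)) \<le> 2 * (G' (v x) * norm (V x))" for j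
      proof (intro AE_I2)
        fix x
        have "norm (?F' j (v x) *\<^sub>R V x - G' (v x) *\<^sub>R V x) = \<bar>?F' j (v x) - G' (v x)\<bar> * norm (V x)"
          by (simp flip: scaleR_diff_left)
        also have "\<dots> \<le> (2 * G' (v x)) * norm (V x)"
          using F'0[of j "v x"] F'G[of j "v x"] by (intro mult_right_mono) auto
        finally show "norm (norm (?F' j (v x) *\<^sub>R V x - G' (v x) *\<^sub>R V x)) \<le> 2 * (G' (v x) * norm (V x))" by simp
      qed
    qed (use iGV iGV' it in auto)
    then show "(\<lambda>j. \<integral>x. norm (?F' j (v x) *\<^sub>R V x - G' (v x) *\<^sub>R V x) \<partial>\<mu>) \<longlonglongrightarrow> 0" by simp
  qed
  have "(\<integral>x. ((a x / (1 + \<bar>G (v x)\<bar>) powr \<theta>) *\<^sub>R (G' (v x) *\<^sub>R V x)) \<bullet> grad \<psi> x \<partial>\<mu>) = (\<integral>x. f x * \<psi> x \<partial>\<mu>)"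
    if \<psi>: "\<psi> \<in> test_functions \<Omega>" for \<psi>
  proof -
    \<comment> \<open>By construction \<open>G'\<close> is the positive power in the denominator, so
      the integrand is that of the linear equation.\<close>
    have "(\<lambda>x. ((a x / (1 + \<bar>G (v x)\<bar>) powr \<theta>) *\<^sub>R (G' (v x) *\<^sub>R V x)) \<bullet> grad \<psi> x) = (\<lambda>x. a x * (V x \<bullet> grad \<psi> x))"
      by (auto simp: G'_def add_nonneg_eq_0_iff)
    then show ?thesis using linear_limit_equation[OF sol \<eta>0 ih f hL1 V L1V \<psi>] by simp
  qed
  then have "distributional_solution \<Omega> a \<theta> f (\<lambda>x. G (v x))"
    unfolding distributional_solution_def
    using test_closure_W11_0[OF closure] test_closure_W11_gradient[OF closure] by blast
  then show ?thesis by blast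
qed

end

theorem theorem1p1:
  fixes \<Omega> :: "(real ^ 'n) set"
    and a f :: "real ^ 'n \<Rightarrow> real"
    and \<alpha> \<beta> \<theta> m :: real
  assumes "CARD('n) > 2"
    and "open \<Omega>" and "bounded \<Omega>"
    and "a \<in> borel_measurable (lebesgue_on \<Omega>)"
    and "0 < \<alpha>" and "0 < \<beta>"
    and "AE x in lebesgue_on \<Omega>. \<alpha> \<le> a x \<and> a x \<le> \<beta>"
    and "1 / (real CARD('n) - 1) < \<theta>" and "\<theta> < 1"
    and "m = real CARD('n) / (real CARD('n) + 1 - \<theta> * (real CARD('n) - 1))"
    and "f \<in> Lp m \<Omega>"
  shows "\<exists>u. distributional_solution \<Omega> a \<theta> f u"
proof -
  interpret elliptic_coefficient \<Omega> a \<alpha> \<beta>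
    using assms by unfold_locales auto
  define N where "N = real CARD('n)"
  have N: "N > 2" using assms(1) by (simp add: N_def)
  have \<theta>N: "1 < \<theta> * (N - 1)" using assms(8) N by (simp add: N_def field_simps)
  have "\<theta> * (N - 1) < 1 * (N - 1)" using assms(9) N by (intro mult_strict_right_mono) auto
  then have D: "N + 1 - \<theta> * (N - 1) > 0" by simp
  have p: "p = N / (N - 1)" by (simp add: p_def N_def)
  have m: "m = N / (N + 1 - \<theta> * (N - 1))" using assms(10) by (simp add: N_def)
  \<comment> \<open>The lower bound on \<theta> makes the denominator less than N, and \<theta> < 1
    keeps it positive.\<close>
  have "1 < m" unfolding m using D \<theta>N N by (simp add: field_simps)
  \<comment> \<open>The defining property of m: both sides equal \<theta> - 1 / (N - 1).\<close>
  moreover have "\<theta> - p + 1 = p * (1 - 1 / m)"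
    unfolding m p using D N by (simp add: field_simps)
  moreover have "0 \<le> \<theta>" using assms(8) N by (intro order_trans[OF _ less_imp_le[OF assms(8)]]) (simp add: N_def)
  ultimately show ?thesis
    using assms(9,11) by (intro ex_distributional_solution[of \<theta> m f]) (auto simp: Lp_def)
qed

end
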